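(* Let $q=2$. Let $A=\begin{pmatrix}a_{11} & a_{12} \\ a_{21} & 0\end{pmatrix}$ with entries in $\mathbb{C}_\infty$, $\operatorname{ord}a_{11}=-1$, $a_{12}\neq0$, $a_{21}\neq0$, and put $u=\operatorname{ord}a_{12}$, $v=\operatorname{ord}a_{21}$. If $(u,v)\in D_{12}$ and $v\le-\frac43$, then $h^1(M(A))=4$.
   Context: Let $q=2$ and $\theta$ a variable. $\mathbb{C}_\infty$ is the completion of an algebraic closure of the completion of $\mathbb{F}_q(\theta)$ at the valuation at infinity $\operatorname{ord}$, normalized by $\operatorname{ord}\theta=-1$ (and $\operatorname{ord}0=+\infty$). $\mathbb{C}_\infty[T,\tau]$ is the ring of non-commutative polynomials with relations $Ta=aT$, $T\tau=\tau T$, $\tau a=a^q\tau$ for $a\in\mathbb{C}_\infty$; $\mathbb{C}_\infty\{\tau\}$ is the subring generated over $\mathbb{C}_\infty$ by $\tau$. For a $2\times2$ matrix $A$ over $\mathbb{C}_\infty$, $M(A)$ is the left $\mathbb{C}_\infty[T,\tau]$-module (Anderson t-motive of dimension 2 and rank 4) which is free over $\mathbb{C}_\infty\{\tau\}$ with basis $e_1,e_2$, where multiplication by $T$ is given, for the column $e_*=(e_1,e_2)^t$, by $Te_*=\theta e_*+A\tau e_*+\tau^2e_*$. It is free of rank 4 over $\mathbb{C}_\infty[T]$. $\mathbb{C}_\infty\{T\}$ is the ring of power series $\sum_{i\ge0}a_iT^i$ with $a_i\in\mathbb{C}_\infty$, $a_i\to0$, on which $\tau$ acts by $\tau(\sum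 a_iT^i)=\sum a_i^qT^i$. On $M\otimes_{\mathbb{C}_\infty[T]}\mathbb{C}_\infty\{T\}$, $\tau$ acts by $\tau(m\otimes f)=\tau(m)\otimes\tau(f)$. $H^1(M)$ is the $\mathbb{F}_q[T]$-module of $\tau$-invariant elements of $M\otimes_{\mathbb{C}_\infty[T]}\mathbb{C}_\infty\{T\}$; it is free, and $h^1(M)$ is its rank over $\mathbb{F}_q[T]$. The domain $D_{12}$ is the set of $(u,v)$ with $\operatorname{ord}\frac{\theta^q}{a_{21}}<\operatorname{ord}\frac{\theta^{q^2}}{a_{21}^{q^2}}$ and $\operatorname{ord}\frac{\theta^q}{a_{21}}<\operatorname{ord}a_{12}^q$; for $q=2$ this is $-v-2<-4v-4$ and $-v-2<2u$, i.e. $v<-\frac23$ and $v>-2u-2$. *)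

theory Defs
  imports
    "HOL-Analysis.Analysis"
    "HOL-Computational_Algebra.Computational_Algebra"
    "HOL-Algebra.Module"
    "HOL-Algebra.Free_Abelian_Groups"
begin

abbreviation (input) q :: nat where "q \<equiv> 2"

section \<open>The field of constants\<close>

text \<open>
  The field is specified up to valued-field isomorphism: it is any complete valued field that
  contains a normalized copy of the rational function field over the field with \<open>q\<close> elements and
  in which the elements algebraic over the closure of that subfield form a dense algebraically
  closed subset.  As the ambient field is complete, the closure of a subfield is its completion.
\<close>

definition Fq :: "'a::field set" where
  "Fq = {x. x ^ q = x}"

definition poly_over :: "'a::zero set \<Rightarrow> 'a poly set" where
  "poly_over S = {p. \<forall>i. coeff p i \<in> S}"

definition rational_functions :: "'a::field \<Rightarrow> 'a set" where
  "rational_functions \<theta> =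
     {poly f \<theta> / poly g \<theta> | f g. f \<in> poly_over Fq \<and> g \<in> poly_over Fq \<and> poly g \<theta> \<noteq> 0}"

definition ord_closure :: "('a::field \<Rightarrow> ereal) \<Rightarrow> 'a set \<Rightarrow> 'a set" where
  "ord_closure ord S = {x. \<forall>r::real. \<exists>y\<in>S. ord (x - y) > ereal r}"

definition algebraic_over :: "'a::field set \<Rightarrow> 'a set" where
  "algebraic_over K = {x. \<exists>p \<in> poly_over K. p \<noteq> 0 \<and> poly p x = 0}"

locale C_infinity =
  fixes ord :: "'a::field \<Rightarrow> ereal" and \<theta> :: 'a
  assumes char: "CHAR('a) = q"
    and ord_eq_infinity_iff: "ord x = \<infinity> \<longleftrightarrow> x = 0"
    and ord_not_minus_infinity: "ord x \<noteq> - \<infinity>"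
    and ord_mult: "ord (x * y) = ord x + ord y"
    and ord_add: "ord (x + y) \<ge> min (ord x) (ord y)"
    and ord_theta: "ord \<theta> = -1"
    and complete:
      "(\<And>r::real. \<exists>N. \<forall>m\<ge>N. \<forall>n\<ge>N. ord (s m - s n) > ereal r) \<Longrightarrow>
         \<exists>l. (\<lambda>n. ord (s n - l)) \<longlonglongrightarrow> \<infinity>"
    and algebraic_closed:
      "p \<in> poly_over (algebraic_over (ord_closure ord (rational_functions \<theta>))) \<Longrightarrow> degree p > 0 \<Longrightarrow>
         \<exists>x \<in> algebraic_over (ord_closure ord (rational_functions \<theta>)). poly p x = 0"
    and algebraic_dense:
      "ord_closure ord (algebraic_over (ord_closure ord (rational_functions \<theta>))) = UNIV"


section \<open>Skew polynomials\<close>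

text \<open>
  A polynomial \<open>\<Sum>i. b i X^i\<close> is read as the skew polynomial \<open>\<Sum>i. b i \<tau>^i\<close>, with
  \<open>\<tau> b = \<sigma> b \<tau>\<close>.  For \<open>\<sigma> = frob\<close> on \<open>'a\<close> this is the ring \<open>C{\<tau>}\<close>; for \<open>\<sigma> = map_poly frob\<close> on
  \<open>'a poly\<close> (the polynomials in \<open>T\<close>) it is \<open>C[T,\<tau>]\<close>, whose elements thus have type
  \<open>'a poly poly\<close> with \<open>\<tau>\<close> as the outer and \<open>T\<close> as the inner variable.
\<close>

definition skew_mult :: "('b::comm_ring_1 \<Rightarrow> 'b) \<Rightarrow> 'b poly \<Rightarrow> 'b poly \<Rightarrow> 'b poly" where
  "skew_mult \<sigma> f g =
     (\<Sum>i\<le>degree f. \<Sum>j\<le>degree g. Polynomial.monom (coeff f i * (\<sigma> ^^ i) (coeff g j)) (i + j))"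

definition frob :: "'a::comm_semiring_1 \<Rightarrow> 'a" where
  "frob x = x ^ q"

lemma skew_mult_tau_const:
  "skew_mult frob (Polynomial.monom 1 1) [:a:] = skew_mult frob [:frob a:] (Polynomial.monom 1 1)"
  for a :: "'a::field"
  by (simp add: skew_mult_def frob_def degree_monom_eq)

lemma skew_mult_tau_T:
  "skew_mult (map_poly frob) (Polynomial.monom 1 1) [:Polynomial.monom (1::'a::field) 1:] =
   skew_mult (map_poly frob) [:Polynomial.monom 1 1:] (Polynomial.monom 1 1)"
  by (simp add: skew_mult_def frob_def degree_monom_eq map_poly_monom)


section \<open>The t-motive\<close>

text \<open>
  The row \<open>m\<close> of skew polynomials stands for the element \<open>m$1 e_1 + m$2 e_2\<close>.  As \<open>T\<close> commutes with
  the constants and with \<open>\<tau>\<close>, it acts by multiplying the row on the right by \<open>\<theta> + A \<tau> + \<tau>^2\<close>.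
\<close>

type_synonym 'a motive = "('a poly) ^ 2"

definition T_matrix :: "'a::field \<Rightarrow> 'a ^ 2 ^ 2 \<Rightarrow> 'a poly ^ 2 ^ 2" where
  "T_matrix \<theta> A = (\<chi> i j. [: if i = j then \<theta> else 0, A $ i $ j, if i = j then 1 else 0 :])"

definition T_action :: "'a::field \<Rightarrow> 'a ^ 2 ^ 2 \<Rightarrow> 'a motive \<Rightarrow> 'a motive" where
  "T_action \<theta> A m = (\<chi> j. \<Sum>i\<in>UNIV. skew_mult frob (m $ i) (T_matrix \<theta> A $ i $ j))"

definition left_action :: "'a::field poly \<Rightarrow> 'a motive \<Rightarrow> 'a motive" where
  "left_action f m = (\<chi> j. skew_mult frob f (m $ j))"

text \<open>
  A left \<open>C[T,\<tau>]\<close>-module is a module record with scalars of type \<open>'a poly poly\<close>.  The fields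
  \<open>mult\<close> and \<open>one\<close>, present only because module records extend ring records, have no meaning.
\<close>

definition anderson_motive :: "'a::field \<Rightarrow> 'a ^ 2 ^ 2 \<Rightarrow> ('a poly poly, 'a motive) module" where
  "anderson_motive \<theta> A =
     \<lparr>carrier = UNIV, monoid.mult = undefined, monoid.one = undefined,
      ring.zero = 0, ring.add = (+),
      module.smult = (\<lambda>F m. \<Sum>j\<le>degree F. \<Sum>i\<le>degree (coeff F j).
        left_action [:coeff (coeff F j) i:]
          ((T_action \<theta> A ^^ i) (left_action (Polynomial.monom 1 j) m)))\<rparr>"

abbreviation tau :: "'a::field poly poly" where
  "tau \<equiv> Polynomial.monom 1 1"

abbreviation T_var :: "'a::field poly poly" where
  "T_var \<equiv> [:Polynomial.monom 1 1:]"

abbreviation basis_vector :: "2 \<Rightarrow> 'a::field motive" where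
  "basis_vector i \<equiv> axis i 1"

lemma skew_mult_one_right: "skew_mult frob f 1 = f" for f :: "'a::field poly"
proof -
  have "(frob ^^ i) (1::'a) = 1" for i
    by (induction i) (auto simp: frob_def)
  then show ?thesis
    by (simp add: skew_mult_def poly_as_sum_of_monoms)
qed

lemma skew_mult_one_left: "skew_mult frob 1 f = f" for f :: "'a::field poly"
  by (simp add: skew_mult_def poly_as_sum_of_monoms)

lemma skew_mult_zero_right: "skew_mult frob f 0 = 0" for f :: "'a::field poly"
proof -
  have "(frob ^^ i) (0::'a) = 0" for i
    by (induction i) (auto simp: frob_def)
  then show ?thesis
    by (simp add: skew_mult_def)
qed

lemma skew_mult_zero_left: "skew_mult frob 0 f = 0" for f :: "'a::field poly"
  by (simp add: skew_mult_def)

lemma left_action_basis_vector: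
  "left_action f (basis_vector i) = (\<chi> j. if j = i then f else 0)" for f :: "'a::field poly"
  by (auto simp: left_action_def axis_def vec_eq_iff skew_mult_one_right skew_mult_zero_right)

lemma motive_basis: "m = (\<Sum>i\<in>UNIV. left_action (c i) (basis_vector i)) \<longleftrightarrow> c = (\<lambda>i. m $ i)"
  for m :: "'a::field motive"
  by (auto simp: left_action_basis_vector vec_eq_iff fun_eq_iff sum.delta)

lemma T_basis_vector:
  "T_var \<odot>\<^bsub>anderson_motive \<theta> A\<^esub> basis_vector i =
     left_action [:\<theta>:] (basis_vector i)
     + (\<Sum>j\<in>UNIV. left_action [:0, A $ i $ j:] (basis_vector j))
     + left_action (Polynomial.monom 1 2) (basis_vector i)"
proof -
  have la1: "left_action 1 m = m" for m :: "'a motive"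
    by (simp add: left_action_def vec_eq_iff skew_mult_one_left)
  have la0: "left_action 0 m = 0" for m :: "'a motive"
    by (simp add: left_action_def vec_eq_iff skew_mult_zero_left)
  have T: "T_action \<theta> A (basis_vector i) = (\<chi> j. T_matrix \<theta> A $ i $ j)"
    unfolding T_action_def vec_eq_iff
    by (auto simp: axis_def skew_mult_one_left skew_mult_zero_left if_distrib[of "\<lambda>x. skew_mult frob x _"]
        sum.delta cong: if_cong)
  have "T_var \<odot>\<^bsub>anderson_motive \<theta> A\<^esub> basis_vector i = T_action \<theta> A (basis_vector i)"
    by (simp add: anderson_motive_def degree_monom_eq la1 la0 flip: one_pCons)
  also have "\<dots> = left_action [:\<theta>:] (basis_vector i)
     + (\<Sum>j\<in>UNIV. left_action [:0, A $ i $ j:] (basis_vector j))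
     + left_action (Polynomial.monom 1 2) (basis_vector i)"
    unfolding T by (auto simp: vec_eq_iff left_action_basis_vector sum.delta T_matrix_def
        monom_altdef numeral_2_eq_2)
  finally show ?thesis .
qed


section \<open>Tensor products\<close>

definition ring_on :: "'b::comm_ring_1 set \<Rightarrow> 'b ring" where
  "ring_on S = \<lparr>carrier = S, monoid.mult = (*), monoid.one = 1,
      ring.zero = 0, ring.add = (+)\<rparr>"

definition tensor_free ::
  "('r, 'm) module \<Rightarrow> ('r, 'n) module \<Rightarrow> ('m \<times> 'n \<Rightarrow>\<^sub>0 int) monoid" where
  "tensor_free M N = free_Abelian_group (carrier M \<times> carrier N)"

definition tensor_relations ::
  "'r ring \<Rightarrow> ('r, 'm) module \<Rightarrow> ('r, 'n) module \<Rightarrow> ('m \<times> 'n \<Rightarrow>\<^sub>0 int) set" where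
  "tensor_relations R M N =
     {frag_of (x \<oplus>\<^bsub>M\<^esub> x', y) - frag_of (x, y) - frag_of (x', y) | x x' y.
        x \<in> carrier M \<and> x' \<in> carrier M \<and> y \<in> carrier N} \<union>
     {frag_of (x, y \<oplus>\<^bsub>N\<^esub> y') - frag_of (x, y) - frag_of (x, y') | x y y'.
        x \<in> carrier M \<and> y \<in> carrier N \<and> y' \<in> carrier N} \<union>
     {frag_of (r \<odot>\<^bsub>M\<^esub> x, y) - frag_of (x, r \<odot>\<^bsub>N\<^esub> y) | r x y.
        r \<in> carrier R \<and> x \<in> carrier M \<and> y \<in> carrier N}"

definition tensor_kernel ::
  "'r ring \<Rightarrow> ('r, 'm) module \<Rightarrow> ('r, 'n) module \<Rightarrow> ('m \<times> 'n \<Rightarrow>\<^sub>0 int) set" where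
  "tensor_kernel R M N = generate (tensor_free M N) (tensor_relations R M N)"

definition tensor_group ::
  "'r ring \<Rightarrow> ('r, 'm) module \<Rightarrow> ('r, 'n) module \<Rightarrow> ('m \<times> 'n \<Rightarrow>\<^sub>0 int) set monoid" where
  "tensor_group R M N = tensor_free M N Mod tensor_kernel R M N"

text \<open>
  The additive endomorphism of the tensor product that sends \<open>x \<otimes> y\<close> to \<open>f x \<otimes> g y\<close>.  The maps
  \<open>f\<close> and \<open>g\<close> need not be linear (\<open>\<tau>\<close> is only semilinear); the definition is meaningful
  whenever the map induced on the free group preserves the kernel.
\<close>

definition tensor_map ::
  "'r ring \<Rightarrow> ('r, 'm) module \<Rightarrow> ('r, 'n) module \<Rightarrow> ('m \<Rightarrow> 'm) \<Rightarrow> ('n \<Rightarrow> 'n) \<Rightarrow>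
     ('m \<times> 'n \<Rightarrow>\<^sub>0 int) set \<Rightarrow> ('m \<times> 'n \<Rightarrow>\<^sub>0 int) set" where
  "tensor_map R M N f g X =
     the_elem ((\<lambda>z. tensor_kernel R M N #>\<^bsub>tensor_free M N\<^esub>
                      frag_extend (\<lambda>(x, y). frag_of (f x, g y)) z) ` X)"


section \<open>The module of invariants and its rank\<close>

text \<open>
  The series \<open>\<Sum>i. a i T^i\<close> in \<open>C{T}\<close> are those with \<open>a i \<longlonglongrightarrow> 0\<close>, that is \<open>ord (a i) \<longlonglongrightarrow> \<infinity>\<close>.
\<close>

definition tate_algebra :: "('a::field \<Rightarrow> ereal) \<Rightarrow> 'a fps set" where
  "tate_algebra ord = {f. (\<lambda>i. ord (fps_nth f i)) \<longlonglongrightarrow> \<infinity>}"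

definition tate_module :: "('a::field \<Rightarrow> ereal) \<Rightarrow> ('a poly, 'a fps) module" where
  "tate_module ord =
     \<lparr>carrier = tate_algebra ord, monoid.mult = (*), monoid.one = 1,
      ring.zero = 0, ring.add = (+),
      module.smult = (\<lambda>p f. fps_of_poly p * f)\<rparr>"

definition tate_tau :: "'a::field fps \<Rightarrow> 'a fps" where
  "tate_tau f = Abs_fps (\<lambda>i. frob (fps_nth f i))"

definition restrict_to_CT :: "('a::field poly poly, 'm) module \<Rightarrow> ('a poly, 'm) module" where
  "restrict_to_CT M =
     \<lparr>carrier = carrier M, monoid.mult = monoid.mult M, monoid.one = monoid.one M,
      ring.zero = ring.zero M, ring.add = ring.add M,
      module.smult = (\<lambda>p m. [:p:] \<odot>\<^bsub>M\<^esub> m)\<rparr>"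

definition H1_tensor_group where
  "H1_tensor_group ord M =
     tensor_group (ring_on UNIV) (restrict_to_CT M) (tate_module ord)"

definition H1_tensor_map where
  "H1_tensor_map ord M =
     tensor_map (ring_on UNIV) (restrict_to_CT M) (tate_module ord)"

definition FqT :: "'a::field poly ring" where
  "FqT = ring_on (poly_over Fq)"

definition H1 :: "('a::field \<Rightarrow> ereal) \<Rightarrow> ('a poly poly, 'm) module \<Rightarrow>
    ('a poly, ('m \<times> 'a fps \<Rightarrow>\<^sub>0 int) set) module" where
  "H1 ord M =
     \<lparr>carrier = {X \<in> carrier (H1_tensor_group ord M).
        H1_tensor_map ord M (\<lambda>m. tau \<odot>\<^bsub>M\<^esub> m) tate_tau X = X},
      monoid.mult = undefined, monoid.one = undefined,
      ring.zero = monoid.one (H1_tensor_group ord M),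
      ring.add = monoid.mult (H1_tensor_group ord M),
      module.smult = (\<lambda>p. H1_tensor_map ord M (\<lambda>m. m) (\<lambda>f. fps_of_poly p * f))\<rparr>"

definition finite_module_basis :: "'r ring \<Rightarrow> ('r, 'm) module \<Rightarrow> 'm set \<Rightarrow> bool" where
  "finite_module_basis R M B \<longleftrightarrow> finite B \<and> B \<subseteq> carrier M \<and>
     (\<forall>x \<in> carrier M. \<exists>!c. c \<in> B \<rightarrow>\<^sub>E carrier R \<and> x = (\<Oplus>\<^bsub>M\<^esub>b\<in>B. c b \<odot>\<^bsub>M\<^esub> b))"

text \<open>
  The rank is specified only for free modules with a finite basis; over a nonzero commutative ring
  all finite bases have the same cardinality.
\<close>

definition module_rank :: "'r ring \<Rightarrow> ('r, 'm) module \<Rightarrow> nat" where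
  "module_rank R M = (THE n. \<exists>B. finite_module_basis R M B \<and> card B = n)"

definition h1 :: "('a::field \<Rightarrow> ereal) \<Rightarrow> ('a poly poly, 'm) module \<Rightarrow> nat" where
  "h1 ord M = module_rank FqT (H1 ord M)"


section \<open>The domain\<close>

text \<open>
  For \<open>u = ord a_12\<close> and \<open>v = ord a_21\<close> the inequalities are
  \<open>ord (\<theta>^q / a_21) < ord (\<theta>^(q^2) / a_21^(q^2))\<close> and \<open>ord (\<theta>^q / a_21) < ord (a_12^q)\<close>.
\<close>

definition D12 :: "(real \<times> real) set" where
  "D12 = {(u, v). - real q - v < - real (q\<^sup>2) - real (q\<^sup>2) * v \<and> - real q - v < real q * u}"

end

theory Submission
  imports Defs
begin

text \<open>
  In the basis \<open>e\<^sub>1, e\<^sub>2, \<tau>e\<^sub>1, \<tau>e\<^sub>2\<close> over \<open>C[T]\<close> an invariant element is determined by its last two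
  coordinates \<open>\<Sum> b\<^sub>i T\<^sup>i\<close> and \<open>\<Sum> c\<^sub>i T\<^sup>i\<close>, which satisfy
  \<open>b\<^sub>i = \<theta>\<^sup>2 b\<^sub>i\<^sup>4 + a\<^sub>1\<^sub>1 b\<^sub>i\<^sup>2 + a\<^sub>2\<^sub>1 c\<^sub>i\<^sup>2 + b\<^sub>i\<^sub>-\<^sub>1\<^sup>4\<close> and \<open>c\<^sub>i = \<theta>\<^sup>2 c\<^sub>i\<^sup>4 + a\<^sub>1\<^sub>2 b\<^sub>i\<^sup>2 + c\<^sub>i\<^sub>-\<^sub>1\<^sup>4\<close>.
  Eliminating \<open>c\<^sub>0\<close> makes \<open>b\<^sub>0\<close> a root of a separable additive polynomial of degree 16.  Conversely
  every root extends to a solution tending to 0: its valuation is at least \<open>(10/3 + v)/4\<close>, which is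
  where \<open>v \<le> -4/3\<close> enters, and choosing at each step a root \<open>b\<^sub>i\<close> of largest valuation gains \<open>1/2\<close> per step.
  Hence the invariants modulo \<open>T\<close> form a space with 16 elements.  Filtering the invariants by the index
  from which on all \<open>b\<^sub>i\<close> have valuation above 1 (step 0 of this filtration is 0) and lifting a basis
  modulo \<open>T\<close> that is adapted to the filtration gives a basis over \<open>F\<^sub>q[T]\<close>, necessarily of 4 elements.
\<close>

section \<open>The valuation and the roots of polynomials\<close>

text \<open>The invariants are not known in advance to be finitely generated over F_q[T]. Lifting an
  arbitrary basis modulo \<open>T\<close> and dividing by \<open>T\<close> again and again would
  therefore only give expansions with power series coefficients. With an adapted basis the remainder
  stays in its step of the filtration and division by \<open>T\<close> lowers the step, so the
  expansion stops. The bound 1 is the valuation beyond which the linear term of the polynomial of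
  degree 16 outweighs all others, which leaves 0 as the only root there. Two obstacles lie outside
  this argument. The field is only assumed to contain a dense algebraically closed subset, so roots
  in the field itself have to be obtained from completeness. And the tensor product is a quotient of
  the free abelian group on pairs; it is identified with 4-tuples of Tate series by a map on the
  motive that is defined through the basis \<open>e_1, e_2\<close> over \<open>C{tau}\<close>, from
  which the independence of the four generators over C[T] can be read off.\<close>

context C_infinity
begin

lemma add_self [simp]: "x + x = (0::'a)"
proof -
  have "of_nat CHAR('a) = (0::'a)" by (rule of_nat_CHAR)
  then have "1 + 1 = (0::'a)" by (simp add: char)
  then show ?thesis by (metis mult_2 mult_zero_left one_add_one)
qed

lemma uminus_eq: "- x = (x::'a)"
  using add_self by (metis add_eq_0_iff)

lemma minus_eq: "x - y = x + (y::'a)"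
  by (metis diff_conv_add_uminus uminus_eq)

section \<open>Lower bounds on valuations\<close>

definition val :: "'a \<Rightarrow> real" where "val x = real_of_ereal (ord x)"

text \<open>\<open>val 0\<close> is the meaningless number 0 rather than infinity. Estimates are
  therefore stated with this predicate, which 0 satisfies for every bound.\<close>

definition ge :: "real \<Rightarrow> 'a \<Rightarrow> bool" where "ge r x \<longleftrightarrow> ereal r \<le> ord x"

lemma ord_val: "x \<noteq> 0 \<Longrightarrow> ord x = ereal (val x)"
  unfolding val_def using ord_eq_infinity_iff[of x] ord_not_minus_infinity[of x] by (cases "ord x") auto

lemma ge_iff: "ge r x \<longleftrightarrow> x = 0 \<or> r \<le> val x"
  by (cases "x = 0") (use ord_eq_infinity_iff[of 0] in \<open>auto simp: ge_def ord_val\<close>)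

lemma ord_eq_iff: "ord x = ereal r \<longleftrightarrow> x \<noteq> 0 \<and> val x = r"
  by (cases "x = 0") (use ord_eq_infinity_iff[of 0] in \<open>auto simp: ord_val\<close>)

lemma ge_0 [simp]: "ge r 0"
  by (simp add: ge_iff)

lemma ge_mono: "ge r x \<Longrightarrow> s \<le> r \<Longrightarrow> ge s x"
  by (auto simp: ge_iff)

lemma ge_add: "ge r x \<Longrightarrow> ge r y \<Longrightarrow> ge r (x + y)"
  unfolding ge_def using ord_add[of x y] by (meson min.boundedI order_trans)

lemma ge_diff: "ge r x \<Longrightarrow> ge r y \<Longrightarrow> ge r (x - y)"
  by (simp add: minus_eq ge_add)

lemma ge_sum: "(\<And>i. i \<in> I \<Longrightarrow> ge r (f i)) \<Longrightarrow> ge r (sum f I)"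
  by (induction I rule: infinite_finite_induct) (auto intro: ge_add)

lemma val_mult: "x \<noteq> 0 \<Longrightarrow> y \<noteq> 0 \<Longrightarrow> val (x * y) = val x + val y"
  using ord_mult[of x y] by (simp add: ord_val)

lemma val_1 [simp]: "val 1 = 0"
  using val_mult[of 1 1] by simp

lemma val_power: "x \<noteq> 0 \<Longrightarrow> val (x ^ n) = real n * val x"
  by (induction n) (auto simp: val_mult algebra_simps)

lemma val_inverse: "x \<noteq> 0 \<Longrightarrow> val (inverse x) = - val x"
  using val_mult[of x "inverse x"] by simp

lemma val_divide: "x \<noteq> 0 \<Longrightarrow> y \<noteq> 0 \<Longrightarrow> val (x / y) = val x - val y"
  by (simp add: divide_inverse val_mult val_inverse)



lemma ge_1 [simp]: "r \<le> 0 \<Longrightarrow> ge r 1"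
  by (simp add: ge_iff)

lemma ge_mult: "ge r x \<Longrightarrow> ge s y \<Longrightarrow> ge (r + s) (x * y)"
  by (cases "x = 0 \<or> y = 0") (auto simp: ge_iff val_mult)

lemma ge_power: "ge r x \<Longrightarrow> ge (real n * r) (x ^ n)"
  by (cases "x = 0"; cases "n = 0") (auto simp: ge_iff val_power mult_left_mono)

lemma ge_power_iff: "0 < n \<Longrightarrow> ge (real n * r) (x ^ n) \<longleftrightarrow> ge r x"
  by (cases "x = 0") (auto simp: ge_iff val_power)

lemma eq_0_if_ge: "(\<And>r. ge r x) \<Longrightarrow> x = 0"
  unfolding ge_iff by (metis gt_ex linorder_not_le)

lemma ge_prod_list:
  assumes "\<And>x. x \<in> set xs \<Longrightarrow> ge (- b) x"
  shows "ge (- (real (length xs) * b)) (prod_list xs)"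
  using assms
proof (induction xs)
  case (Cons x xs)
  then have "ge (- b + - (real (length xs) * b)) (x * prod_list xs)"
    by (intro ge_mult) auto
  then show ?case by (simp add: algebra_simps)
qed simp

text \<open>Otherwise the valuations of the factors would add up to less than
  \<open>length xs * t\<close>. This turns smallness of the value of a polynomial into nearness of
  one of its roots.\<close>

lemma prod_list_large_factor:
  assumes "ge (real (length xs) * t) (prod_list xs)" "xs \<noteq> []"
  shows "\<exists>x\<in>set xs. ge t x"
proof (rule ccontr)
  assume "\<not> ?thesis"
  then have "prod_list xs \<noteq> 0 \<and> val (prod_list xs) < real (length xs) * t"
    using assms(2)
  proof (induction xs)
    case (Cons x xs)
    then show ?case
      by (cases "xs = []") (auto simp: val_mult ge_iff algebra_simps)
  qed simp
  then show False using assms(1) by (auto simp: ge_iff)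
qed

text \<open>At a root of valuation below \<open>- b\<close> the leading term would have strictly
  smaller valuation than the sum of the other terms.\<close>

lemma monic_root_bound:
  assumes "lead_coeff f = 1" "\<And>i. ge (- b) (coeff f i)" "0 \<le> b" "poly f x = 0"
  shows "ge (- b) x"
proof (rule ccontr)
  assume neg: "\<not> ge (- b) x"
  then have x0: "x \<noteq> 0" and xv: "val x < - b" by (auto simp: ge_iff)
  define n where "n = degree f"
  have "0 < n"
    using assms(1,4) unfolding n_def by (metis degree_eq_zeroE lead_coeff_pCons(2) neq0_conv poly_0_coeff_0 coeff_pCons_0 one_neq_zero poly_pCons mult_zero_right add.right_neutral poly_0)
  have "(\<Sum>i<n. coeff f i * x ^ i) + x ^ n = 0"
    using assms(1,4) unfolding poly_altdef n_def by (simp add: lessThan_Suc_atMost[symmetric])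
  then have eq: "x ^ n = (\<Sum>i<n. coeff f i * x ^ i)"
    by (metis add_eq_0_iff uminus_eq)
  have "ge (- b + real (n - 1) * val x) (\<Sum>i<n. coeff f i * x ^ i)"
  proof (rule ge_sum)
    fix i assume "i \<in> {..<n}"
    then have i: "real i \<le> real (n - 1)" by auto
    have "ge (- b + real i * val x) (coeff f i * x ^ i)"
      using assms(2) x0 by (intro ge_mult) (auto simp: ge_iff val_power)
    then show "ge (- b + real (n - 1) * val x) (coeff f i * x ^ i)"
      by (rule ge_mono) (use i xv assms(3) in \<open>auto intro!: mult_right_mono_neg\<close>)
  qed
  then have "- b + real (n - 1) * val x \<le> real n * val x"
    unfolding eq[symmetric] using x0 by (auto simp: ge_iff val_power)
  then show False using xv \<open>0 < n\<close> by (cases n) (auto simp: algebra_simps)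
qed

lemma ge_poly:
  assumes "\<And>i. ge r (coeff f i)" "degree f \<le> n" "0 \<le> b" "ge (- b) x"
  shows "ge (r - real n * b) (poly f x)"
  unfolding poly_altdef
proof (rule ge_sum)
  fix i assume "i \<in> {..degree f}"
  then have "real i \<le> real n" using assms(2) by auto
  moreover have "ge (r + real i * - b) (coeff f i * x ^ i)"
    by (intro ge_mult ge_power assms)
  ultimately show "ge (r - real n * b) (coeff f i * x ^ i)"
    by (elim ge_mono) (use assms(3) in \<open>auto intro!: mult_right_mono\<close>)
qed

lemma coeffs_bounded: "\<exists>b\<ge>0. \<forall>i. ge (- b) (coeff f i)" for f :: "'a poly"
proof -
  define b where "b = (\<Sum>i\<le>degree f. \<bar>val (coeff f i)\<bar>)"
  have "ge (- b) (coeff f i)" for i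
  proof (cases "i \<le> degree f")
    case True
    then have "\<bar>val (coeff f i)\<bar> \<le> b"
      unfolding b_def by (intro member_le_sum) auto
    then show ?thesis by (auto simp: ge_iff)
  qed (simp add: coeff_eq_0)
  then show ?thesis by (intro exI[of _ b]) (auto simp: b_def sum_nonneg)
qed

section \<open>Algebraic closedness of the whole field\<close>

definition Alg :: "'a set" where
  "Alg = algebraic_over (ord_closure ord (rational_functions \<theta>))"

lemma Alg_root: "(\<And>i. coeff p i \<in> Alg) \<Longrightarrow> degree p > 0 \<Longrightarrow> \<exists>x\<in>Alg. poly p x = 0"
  using algebraic_closed[of p] unfolding Alg_def poly_over_def by blast

lemma Alg_dense: "\<exists>y\<in>Alg. ge r (x - y)"
proof -
  have "x \<in> ord_closure ord Alg" using algebraic_dense unfolding Alg_def by simp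
  then show ?thesis unfolding ord_closure_def ge_def by (blast intro: less_imp_le)
qed

text \<open>The monic polynomials that approximate \<open>f\<close> below have 0 and 1 among their
  coefficients, and all of these must lie in \<open>Alg\<close>.\<close>

lemma Alg_01: "0 \<in> Alg" "1 \<in> Alg"
proof -
  let ?K = "ord_closure ord (rational_functions \<theta>)"
  have const: "c \<in> ?K" if "c = 0 \<or> c = 1" for c
  proof -
    have pc: "[:c:] \<in> poly_over Fq" "[:1:] \<in> poly_over (Fq :: 'a set)"
      using that by (auto simp: poly_over_def Fq_def coeff_pCons split: nat.splits)
    have "c = poly [:c:] \<theta> / poly [:1:] \<theta>" by simp
    then have "c \<in> rational_functions \<theta>"
      unfolding rational_functions_def using pc by (force simp del: one_pCons)
    moreover have "ord (c - c) = \<infinity>" using ord_eq_infinity_iff by simp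
    ultimately show ?thesis unfolding ord_closure_def by force
  qed
  have "c \<in> Alg" if "c = 0 \<or> c = 1" for c
  proof -
    have "[:c, 1:] \<in> poly_over ?K"
      using const that by (auto simp: poly_over_def coeff_pCons split: nat.splits)
    moreover have "poly [:c, 1:] c = 0" "[:c, 1:] \<noteq> 0" by auto
    ultimately show ?thesis unfolding Alg_def algebraic_over_def by blast
  qed
  then show "0 \<in> Alg" "1 \<in> Alg" by auto
qed

definition linear_factors :: "'a list \<Rightarrow> 'a poly" where
  "linear_factors rs = prod_list (map (\<lambda>r. [:- r, 1:]) rs)"

lemma linear_factors_simps [simp]:
  "linear_factors [] = 1" "linear_factors (r # rs) = [:- r, 1:] * linear_factors rs"
  by (auto simp: linear_factors_def)

lemma linear_factors_monic: "lead_coeff (linear_factors rs) = 1 \<and> degree (linear_factors rs) = length rs"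
proof (induction rs)
  case (Cons r rs)
  then have "linear_factors rs \<noteq> 0" by auto
  have "lead_coeff ([:- r, 1:] * linear_factors rs) = 1"
    using Cons unfolding lead_coeff_mult by auto
  moreover have "degree ([:- r, 1:] * linear_factors rs) = Suc (length rs)"
    using Cons \<open>linear_factors rs \<noteq> 0\<close> by (subst degree_mult_eq) auto
  ultimately show ?case by simp
qed simp

lemma poly_linear_factors: "poly (linear_factors rs) x = prod_list (map (\<lambda>r. x - r) rs)"
  by (induction rs) (auto simp: algebra_simps)

text \<open>
  Only density and the existence of one root in \<open>Alg\<close> are available: after splitting off that root
  the quotient leaves \<open>Alg\<close> and is approximated again.
\<close>

lemma approx_linear_factors:
  assumes "lead_coeff f = 1"
  shows "\<exists>rs. length rs = degree f \<and> (\<forall>i. ge t (coeff (f - linear_factors rs) i))"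
  using assms
proof (induction "degree f" arbitrary: f t)
  case 0
  then have "f = 1" by (metis degree_0_id of_nat_1 one_poly_eq_simps(1) one_pCons)
  then show ?case by (intro exI[of _ "[]"]) auto
next
  case (Suc n)
  \<comment> \<open>As \<open>t' \<ge> 0\<close>, the approximation \<open>g\<close> inherits the
    coefficient bound \<open>- b\<close> of \<open>f\<close>, and its root \<open>r\<close> obeys
    the same bound.\<close>
  define t' where "t' = max t 0"
  obtain b where b: "0 \<le> b" "\<And>i. ge (- b) (coeff f i)"
    using coeffs_bounded by blast
  obtain s where s: "\<And>i. s i \<in> Alg" "\<And>i. ge t' (coeff f i - s i)"
    using Alg_dense[of t' "coeff f i" for i] that by metis
  define g where "g = (\<Sum>i\<le>n. Polynomial.monom (s i) i) + Polynomial.monom 1 (Suc n)"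
  have cg: "coeff g i = (if i \<le> n then s i else if i = Suc n then 1 else 0)" for i
    unfolding g_def by (auto simp: coeff_sum sum.delta)
  have dg: "degree g = Suc n"
    by (rule antisym[OF degree_le le_degree]) (auto simp: cg)
  obtain r where r: "poly g r = 0"
  proof -
    have "\<exists>x\<in>Alg. poly g x = 0"
      by (rule Alg_root) (auto simp: cg dg s(1) Alg_01)
    then show ?thesis using that by blast
  qed
  have fg: "ge t' (coeff (f - g) i)" for i
    using s(2) Suc.prems Suc.hyps(2) by (auto simp: cg coeff_eq_0)
  have gb: "ge (- b) (coeff g i)" for i
  proof -
    have "ge (- b) (coeff f i - coeff (f - g) i)"
      using b fg by (intro ge_diff) (auto intro: ge_mono[of t'] simp: t'_def)
    then show ?thesis by simp
  qed
  have lg: "lead_coeff g = 1" by (simp add: cg dg)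
  have rb: "ge (- b) r"
    by (rule monic_root_bound[OF lg gb b(1) r])
  obtain h where h: "g = [:- r, 1:] * h"
    using r unfolding poly_eq_0_iff_dvd by (auto elim: dvdE)
  then have "h \<noteq> 0" using dg by auto
  have "Suc n = degree [:- r, 1:] + degree h"
    using \<open>h \<noteq> 0\<close> unfolding h dg[symmetric] by (intro degree_mult_eq) auto
  then have dh: "n = degree h" by simp
  have "lead_coeff g = lead_coeff h" unfolding h by (simp only: lead_coeff_mult) simp
  then have lh: "lead_coeff h = 1" using lg by simp
  \<comment> \<open>The surplus \<open>b\<close> pays for the multiplication by \<open>r\<close>,
    whose valuation may be as low as \<open>- b\<close>.\<close>
  obtain rs where rs: "length rs = degree h" "\<And>i. ge (t' + b) (coeff (h - linear_factors rs) i)"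
    using Suc.hyps(1)[OF dh lh, of "t' + b"] by blast
  define e where "e = h - linear_factors rs"
  have "f - linear_factors (r # rs) = (f - g) + [:- r, 1:] * e"
    by (simp add: h e_def algebra_simps smult_diff_right)
  moreover have "ge t (coeff ((f - g) + [:- r, 1:] * e) i)" for i
  proof -
    have e: "ge t (r * coeff e i)" "ge t (coeff e j)" for j
      using ge_mult[OF rb rs(2)[of i]] rs(2)[of j] b(1)
      by (auto simp: e_def t'_def elim!: ge_mono)
    show ?thesis
      using e ge_mono[OF fg[of i], of t]
      by (cases i) (auto simp: t'_def uminus_eq minus_eq intro!: ge_add)
  qed
  ultimately have "\<forall>i. ge t (coeff (f - linear_factors (r # rs)) i)" by (simp only:) blast
  moreover have "length (r # rs) = degree f" using rs(1) dh Suc.hyps(2) by simp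
  ultimately show ?case by blast
qed

text \<open>Split polynomials converging to \<open>F\<close> have nearby roots: the next polynomial
  is small at a root of the present one, so one of its linear factors is small there. A chain of
  such roots is Cauchy, and its limit is a root of \<open>F\<close>.\<close>

theorem root_exists:
  assumes "0 < degree (f :: 'a poly)"
  shows "\<exists>x. poly f x = 0"
proof -
  define F where "F = Polynomial.smult (inverse (lead_coeff f)) f"
  have f0: "lead_coeff f \<noteq> 0" using assms by auto
  define n where "n = degree F"
  have n: "0 < n" and monic: "lead_coeff F = 1"
    using assms f0 by (auto simp: F_def n_def)
  obtain rs where rs: "\<And>k. length (rs k) = n" "\<And>k i. ge (real k) (coeff (F - linear_factors (rs k)) i)"
  proof -
    have "\<forall>k. \<exists>rs. length rs = n \<and> (\<forall>i. ge (real k) (coeff (F - linear_factors rs) i))"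
      using approx_linear_factors[OF monic] unfolding n_def by blast
    then show ?thesis using that by metis
  qed
  let ?L = "\<lambda>k. linear_factors (rs k)"
  obtain b where b: "0 \<le> b" "\<And>i. ge (- b) (coeff F i)"
    using coeffs_bounded by blast
  have deg: "degree (?L k) = n" "lead_coeff (?L k) = 1" for k
    using linear_factors_monic[of "rs k"] unfolding rs(1) by auto
  have Lb: "ge (- b) (coeff (?L k) i)" for k i
  proof -
    have "ge (- b) (coeff F i - coeff (F - ?L k) i)"
      using b rs(2) by (intro ge_diff) (auto intro: ge_mono[of "real k"])
    then show ?thesis by simp
  qed
  have root: "poly (?L k) x = 0" if "x \<in> set (rs k)" for k x
    using that by (auto simp: poly_linear_factors prod_list_zero_iff)
  have rootb: "ge (- b) x" if "x \<in> set (rs k)" for k x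
    by (rule monic_root_bound[OF deg(2) Lb b(1) root[OF that]])
  \<comment> \<open>The product of the \<open>n\<close> distances from a root to the roots of the
    next polynomial has valuation at least \<open>k - n * b\<close>; \<open>\<delta> k\<close> is
    the average share of one distance.\<close>
  define \<delta> where "\<delta> k = real k / real n - b" for k
  have step: "\<exists>y\<in>set (rs (Suc k)). ge (\<delta> k) (x - y)" if x: "x \<in> set (rs k)" for k x
  proof -
    have "ge (real k) (coeff (?L (Suc k) - ?L k) i)" for i
    proof -
      have "ge (real k) (coeff (F - ?L k) i - coeff (F - ?L (Suc k)) i)"
        by (intro ge_diff rs(2) ge_mono[OF rs(2)[of "Suc k"]]) auto
      then show ?thesis by simp
    qed
    moreover have "degree (?L (Suc k) - ?L k) \<le> n"
      by (metis deg(1) degree_diff_le order_refl)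
    ultimately have "ge (real k - real n * b) (poly (?L (Suc k) - ?L k) x)"
      using rootb[OF x] b(1) by (intro ge_poly)
    then have "ge (real k - real n * b) (prod_list (map (\<lambda>r. x - r) (rs (Suc k))))"
      using root[OF x] by (simp add: poly_linear_factors)
    moreover have "real k - real n * b = real (length (map (\<lambda>r. x - r) (rs (Suc k)))) * \<delta> k"
      using n by (simp add: \<delta>_def rs(1) field_simps)
    ultimately have "\<exists>z\<in>set (map (\<lambda>r. x - r) (rs (Suc k))). ge (\<delta> k) z"
      using rs(1)[of "Suc k"] n by (intro prod_list_large_factor) auto
    then show ?thesis by auto
  qed
  have start: "\<exists>x. x \<in> set (rs 0)"
    using rs(1)[of 0] n by (cases "rs 0") auto
  obtain s where s: "\<And>k. s k \<in> set (rs k)" "\<And>k. ge (\<delta> k) (s k - s (Suc k))"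
    using dependent_nat_choice[of "\<lambda>k x. x \<in> set (rs k)" "\<lambda>k x y. ge (\<delta> k) (x - y)"] start step by metis
  have tail: "ge (\<delta> N) (s N - s (N + j))" for N j
  proof (induction j)
    case (Suc j)
    have "ge (\<delta> N) (s (N + j) - s (Suc (N + j)))"
      using s(2) by (rule ge_mono) (auto simp: \<delta>_def divide_right_mono)
    from ge_add[OF Suc this] show ?case by simp
  qed simp
  have cauchy: "\<exists>N. \<forall>m\<ge>N. \<forall>k\<ge>N. ord (s m - s k) > ereal r" for r
  proof -
    obtain N :: nat where "real n * (r + 1 + b) \<le> real N" using real_arch_simple by blast
    then have N: "r + 1 \<le> \<delta> N" using n by (simp add: \<delta>_def field_simps)
    have "ord (s m - s k) > ereal r" if mk: "m \<ge> N" "k \<ge> N" for m k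
    proof -
      have "ge (\<delta> N) ((s N - s k) - (s N - s m))"
        using tail[of N "m - N"] tail[of N "k - N"] mk by (intro ge_diff[of "\<delta> N" "s N - s k" "s N - s m"]) auto
      then have "ge (r + 1) (s m - s k)" using N by (auto elim: ge_mono)
      then show ?thesis unfolding ge_def by (rule less_le_trans[rotated]) simp
    qed
    then show ?thesis by blast
  qed
  obtain l where l: "(\<lambda>k. ord (s k - l)) \<longlonglongrightarrow> \<infinity>"
    using complete[OF cauchy] by blast
  have near: "\<exists>k\<ge>N. ge r (s k - l)" for r and N :: nat
  proof -
    have "eventually (\<lambda>k. ord (s k - l) > ereal r) sequentially"
      using l unfolding tendsto_PInfty by blast
    then obtain M where "\<forall>k\<ge>M. ord (s k - l) > ereal r"
      unfolding eventually_sequentially by blast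
    then show ?thesis unfolding ge_def
      by (intro exI[of _ "max M N"]) (auto intro: less_imp_le)
  qed
  have lb: "ge (- b) l"
  proof -
    obtain k where "ge (- b) (s k - l)" using near by blast
    from ge_diff[OF rootb[OF s(1)[of k]] this] show ?thesis by simp
  qed
  have "poly F l = 0"
  proof (rule eq_0_if_ge)
    fix r
    obtain N :: nat where N: "r + real n * b \<le> real N" using real_arch_simple by blast
    obtain k where k: "k \<ge> N" "ge (r + real n * b) (s k - l)" using near by blast
    have "degree (F - ?L k) \<le> n"
      by (metis deg(1) degree_diff_le n_def order_refl)
    then have "ge (real k - real n * b) (poly (F - ?L k) l)"
      using rs(2) lb b(1) by (intro ge_poly)
    then have 1: "ge r (poly (F - ?L k) l)"
      by (rule ge_mono) (use N k in auto)
    \<comment> \<open>The factor belonging to \<open>s k\<close> is small because \<open>s k\<close>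
      is close to \<open>l\<close>; each remaining factor loses at most \<open>b\<close>.\<close>
    obtain xs ys where xy: "rs k = xs @ s k # ys"
      using s(1)[of k] by (meson split_list)
    let ?d = "\<lambda>zs. prod_list (map (\<lambda>r. l - r) zs)"
    have d: "ge (- (real (length zs) * b)) (?d zs)" if "set zs \<subseteq> set (rs k)" for zs
      using ge_prod_list[of "map (\<lambda>r. l - r) zs" b] that lb rootb by (force intro!: ge_diff)
    have "poly (?L k) l = (s k - l) * ?d (xs @ ys)"
      by (simp add: poly_linear_factors xy minus_eq add.commute)
    moreover have "ge (r + real n * b + - (real (length (xs @ ys)) * b)) ((s k - l) * ?d (xs @ ys))"
      by (intro ge_mult k d) (auto simp: xy)
    moreover have "real (length (xs @ ys)) * b \<le> real n * b"
      using rs(1)[of k] b(1) by (intro mult_right_mono) (auto simp: xy)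
    ultimately have 2: "ge r (poly (?L k) l)" by (auto elim: ge_mono)
    from ge_add[OF 1 2] show "ge r (poly F l)" by simp
  qed
  then show ?thesis using f0 by (auto simp: F_def)
qed

text \<open>A root of largest valuation lies on the first slope of the Newton polygon.\<close>

lemma newton_root:
  assumes "0 < degree (f :: 'a poly)"
  shows "\<exists>x. poly f x = 0 \<and> (\<forall>k r. ge r (coeff f 0) \<longrightarrow> ge r (coeff f k * x ^ k))"
  using assms
proof (induction "degree f" arbitrary: f)
  case (Suc n)
  obtain r where "poly f r = 0" using root_exists Suc.prems by blast
  then obtain g where g: "f = [:- r, 1:] * g" unfolding poly_eq_0_iff_dvd by (auto elim: dvdE)
  then have "g \<noteq> 0" using Suc.prems by auto
  have "Suc n = degree [:- r, 1:] + degree g"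
    using \<open>g \<noteq> 0\<close> unfolding Suc.hyps(2) g by (intro degree_mult_eq) auto
  then have dg: "n = degree g" by simp
  have c0: "coeff f 0 = r * coeff g 0" and cS: "coeff f (Suc k) = coeff g k + r * coeff g (Suc k)" for k
    by (simp_all add: g uminus_eq minus_eq add.commute)
  show ?case
  proof (cases "n = 0")
    case True
    have "ge t (coeff f k * r ^ k)" if "ge t (coeff f 0)" for k t
    proof (cases k)
      case (Suc j)
      then show ?thesis using that True dg by (cases j) (auto simp: cS c0 coeff_eq_0 mult.commute)
    qed (use that in auto)
    moreover have "poly f r = 0" by (simp add: g)
    ultimately show ?thesis by blast
  next
    case False
    then obtain x where x: "poly g x = 0" "\<And>k t. ge t (coeff g 0) \<Longrightarrow> ge t (coeff g k * x ^ k)"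
      using Suc.hyps(1)[OF dg] dg by auto
    \<comment> \<open>Of the root \<open>r\<close> split off and the root \<open>x\<close> of the
      quotient, \<open>m\<close> is one of largest valuation.\<close>
    define m where "m = (if x = 0 \<or> (r \<noteq> 0 \<and> val r \<le> val x) then x else r)"
    have mr: "ge t m" if "ge t r" for t
      using that by (auto simp: m_def ge_iff)
    have mx: "ge t m" if "ge t x" for t
      using that by (auto simp: m_def ge_iff)
    have prod_mono: "ge t (c * y)" if "ge t (c * z)" "\<And>s. ge s z \<Longrightarrow> ge s y" for t c y z
    proof (cases "c = 0")
      case False
      then have "ge (t - val c) z" using that(1) by (cases "z = 0") (auto simp: ge_iff val_mult)
      then have "ge (t - val c) y" using that(2) by blast
      then show ?thesis using False by (cases "y = 0") (auto simp: ge_iff val_mult)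
    qed simp
    have pow: "ge s (m ^ k)" if "ge s (x ^ k)" for s k
    proof (cases "k = 0")
      case False
      then have "ge (s / real k) x" using that by (subst ge_power_iff[of k, symmetric]) auto
      then have "ge (s / real k) m" by (rule mx)
      then show ?thesis using False ge_power_iff[of k "s / real k" m] by auto
    qed (use that in auto)
    have "ge t (coeff f k * m ^ k)" if t: "ge t (coeff f 0)" for k t
    proof (cases "r = 0")
      case True
      then have "x = m \<or> m = 0" by (auto simp: m_def)
      then have "m = 0" using True mr by (metis eq_0_if_ge ge_0)
      then show ?thesis using t by (cases k) auto
    next
      case r: False
      \<comment> \<open>The constant coefficient of \<open>g\<close> is that of \<open>f\<close>
        divided by \<open>r\<close>. The loss \<open>val r\<close> is regained in both summands of a
        coefficient of \<open>f\<close>: from a further factor \<open>m\<close> in one, from the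
        factor \<open>r\<close> in the other.\<close>
      then have t': "ge (t - val r) (coeff g 0)"
        using t by (cases "coeff g 0 = 0") (auto simp: c0 ge_iff val_mult)
      have gm: "ge (t - val r) (coeff g j * m ^ j)" for j
        using x(2)[OF t'] pow by (rule prod_mono)
      have rr: "ge (val r) r" and mv: "ge (val r) m" using mr by (auto simp: ge_iff)
      show ?thesis
      proof (cases k)
        case (Suc j)
        have "ge (t - val r + val r) ((coeff g j * m ^ j) * m)" "ge (val r + (t - val r)) (r * (coeff g k * m ^ k))"
          by (intro ge_mult gm rr mv)+
        then have "ge t ((coeff g j * m ^ j) * m + r * (coeff g k * m ^ k))" by (intro ge_add) auto
        then show ?thesis by (simp add: Suc cS algebra_simps)
      qed (use t in simp)
    qed
    moreover have "poly f m = 0" using x(1) by (auto simp: m_def g)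
    ultimately show ?thesis by blast
  qed
qed simp

text \<open>When a root \<open>r\<close> is split off, the derivative of \<open>f\<close> at
  \<open>r\<close> is the value of the quotient at \<open>r\<close>. Hence \<open>r\<close> is not a
  root of the quotient, and the number of roots grows by one.\<close>

lemma card_roots_separable:
  assumes "\<And>x. poly f x = 0 \<Longrightarrow> poly (pderiv f) x \<noteq> 0" "f \<noteq> 0"
  shows "card {x. poly f x = 0} = degree (f :: 'a poly)"
  using assms
proof (induction "degree f" arbitrary: f)
  case 0
  then obtain c where "f = [:c:]" by (metis degree_eq_zeroE)
  then show ?case using 0 by simp
next
  case (Suc n)
  obtain r where "poly f r = 0" using root_exists Suc.hyps(2) by force
  then obtain g where g: "f = [:- r, 1:] * g" unfolding poly_eq_0_iff_dvd by (auto elim: dvdE)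
  then have "g \<noteq> 0" using Suc.prems by auto
  have "Suc n = degree [:- r, 1:] + degree g"
    using \<open>g \<noteq> 0\<close> unfolding Suc.hyps(2) g by (intro degree_mult_eq) auto
  then have dg: "n = degree g" by simp
  have pd: "poly (pderiv f) x = (x - r) * poly (pderiv g) x + poly g x" for x
    unfolding g pderiv_mult by (simp add: pderiv_pCons algebra_simps)
  have "poly g r \<noteq> 0" using Suc.prems(1)[of r] pd[of r] g by simp
  have "poly (pderiv g) x \<noteq> 0" if "poly g x = 0" for x
    using Suc.prems(1)[of x] that pd[of x] g by auto
  then have "card {x. poly g x = 0} = n" using Suc.hyps(1)[OF dg] \<open>g \<noteq> 0\<close> dg by simp
  moreover have "{x. poly f x = 0} = insert r {x. poly g x = 0}" by (auto simp: g)
  moreover have "finite {x. poly g x = 0}" using \<open>g \<noteq> 0\<close> by (rule poly_roots_finite)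
  ultimately show ?case using \<open>poly g r \<noteq> 0\<close> Suc.hyps(2) by simp
qed

end

section \<open>Tensor products with a free module\<close>

locale tensor_closed =
  fixes R :: "'r ring" and M :: "('r, 'm) module" and N :: "('r, 'n) module"
  assumes M_add: "x \<in> carrier M \<Longrightarrow> x' \<in> carrier M \<Longrightarrow> x \<oplus>\<^bsub>M\<^esub> x' \<in> carrier M"
    and M_smult: "r \<in> carrier R \<Longrightarrow> x \<in> carrier M \<Longrightarrow> r \<odot>\<^bsub>M\<^esub> x \<in> carrier M"
    and N_add: "y \<in> carrier N \<Longrightarrow> y' \<in> carrier N \<Longrightarrow> y \<oplus>\<^bsub>N\<^esub> y' \<in> carrier N"
    and N_smult: "r \<in> carrier R \<Longrightarrow> y \<in> carrier N \<Longrightarrow> r \<odot>\<^bsub>N\<^esub> y \<in> carrier N"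
begin

abbreviation "F \<equiv> tensor_free M N"
abbreviation "K \<equiv> tensor_kernel R M N"
abbreviation "S \<equiv> carrier M \<times> carrier N"

lemma comm_group_F: "comm_group F"
  unfolding tensor_free_def by (rule abelian_free_Abelian_group)

lemma carrier_F: "z \<in> carrier F \<longleftrightarrow> Poly_Mapping.keys z \<subseteq> S"
  unfolding tensor_free_def by simp

lemma mult_F [simp]: "x \<otimes>\<^bsub>F\<^esub> y = x + y" and one_F [simp]: "\<one>\<^bsub>F\<^esub> = 0"
  unfolding tensor_free_def by auto

lemma F_closed:
  "0 \<in> carrier F" "x \<in> carrier F \<Longrightarrow> y \<in> carrier F \<Longrightarrow> x + y \<in> carrier F"
  "x \<in> carrier F \<Longrightarrow> y \<in> carrier F \<Longrightarrow> x - y \<in> carrier F"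
  unfolding carrier_F using keys_add[of x y] keys_diff[of x y] by auto

lemma F_sum: "(\<And>j. j \<in> J \<Longrightarrow> f j \<in> carrier F) \<Longrightarrow> sum f J \<in> carrier F"
  unfolding tensor_free_def by (rule sum_closed_free_Abelian_group)

lemma frag_in_F: "x \<in> carrier M \<Longrightarrow> y \<in> carrier N \<Longrightarrow> frag_of (x, y) \<in> carrier F"
  unfolding carrier_F by simp

lemma relations_in_F: "tensor_relations R M N \<subseteq> carrier F"
  unfolding tensor_relations_def
  by (auto intro!: F_closed frag_in_F M_add M_smult N_add N_smult)

lemma subgroup_K: "subgroup K F"
  unfolding tensor_kernel_def
  by (rule group.generate_is_subgroup[OF comm_group.axioms(2)[OF comm_group_F] relations_in_F])

lemma inv_F: "x \<in> carrier F \<Longrightarrow> inv\<^bsub>F\<^esub> x = - x"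
  unfolding tensor_free_def by simp

lemma K_in_F: "x \<in> K \<Longrightarrow> x \<in> carrier F"
  using subgroup.subset[OF subgroup_K] by auto

lemma K_closed:
  "0 \<in> K" "x \<in> K \<Longrightarrow> y \<in> K \<Longrightarrow> x + y \<in> K" "x \<in> K \<Longrightarrow> - x \<in> K"
  "x \<in> K \<Longrightarrow> y \<in> K \<Longrightarrow> x - y \<in> K"
proof -
  show 1: "x + y \<in> K" if "x \<in> K" "y \<in> K" for x y
    using subgroup.m_closed[OF subgroup_K] that by simp
  show 2: "- x \<in> K" if "x \<in> K" for x
    using subgroup.m_inv_closed[OF subgroup_K that] inv_F[OF K_in_F[OF that]] by simp
  show "0 \<in> K" using subgroup.one_closed[OF subgroup_K] by simp
  show "x - y \<in> K" if "x \<in> K" "y \<in> K"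
    using 1[OF that(1) 2[OF that(2)]] by simp
qed

lemma K_sum: "(\<And>j. j \<in> J \<Longrightarrow> f j \<in> K) \<Longrightarrow> sum f J \<in> K"
  by (induction J rule: infinite_finite_induct) (auto intro: K_closed)

lemma relations_in_K:
  "x \<in> carrier M \<Longrightarrow> x' \<in> carrier M \<Longrightarrow> y \<in> carrier N \<Longrightarrow>
    frag_of (x \<oplus>\<^bsub>M\<^esub> x', y) - frag_of (x, y) - frag_of (x', y) \<in> K"
  "x \<in> carrier M \<Longrightarrow> y \<in> carrier N \<Longrightarrow> y' \<in> carrier N \<Longrightarrow>
    frag_of (x, y \<oplus>\<^bsub>N\<^esub> y') - frag_of (x, y) - frag_of (x, y') \<in> K"
  "r \<in> carrier R \<Longrightarrow> x \<in> carrier M \<Longrightarrow> y \<in> carrier N \<Longrightarrow>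
    frag_of (r \<odot>\<^bsub>M\<^esub> x, y) - frag_of (x, r \<odot>\<^bsub>N\<^esub> y) \<in> K"
proof -
  have *: "z \<in> K" if "z \<in> tensor_relations R M N" for z
    using that unfolding tensor_kernel_def by (rule generate.incl)
  show "x \<in> carrier M \<Longrightarrow> x' \<in> carrier M \<Longrightarrow> y \<in> carrier N \<Longrightarrow>
    frag_of (x \<oplus>\<^bsub>M\<^esub> x', y) - frag_of (x, y) - frag_of (x', y) \<in> K"
    by (rule *, unfold tensor_relations_def) blast
  show "x \<in> carrier M \<Longrightarrow> y \<in> carrier N \<Longrightarrow> y' \<in> carrier N \<Longrightarrow>
    frag_of (x, y \<oplus>\<^bsub>N\<^esub> y') - frag_of (x, y) - frag_of (x, y') \<in> K"
    by (rule *, unfold tensor_relations_def) blast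
  show "r \<in> carrier R \<Longrightarrow> x \<in> carrier M \<Longrightarrow> y \<in> carrier N \<Longrightarrow>
    frag_of (r \<odot>\<^bsub>M\<^esub> x, y) - frag_of (x, r \<odot>\<^bsub>N\<^esub> y) \<in> K"
    by (rule *, unfold tensor_relations_def) blast
qed

end

text \<open>A criterion for \<open>W\<close> to be the tensor product: the balanced map
  \<open>\<beta>\<close> induces a map from tensors to \<open>W\<close>, while
  \<open>generates\<close> and \<open>\<pi>_diff\<close> bring every tensor into the form given by
  \<open>\<epsilon>\<close> and \<open>\<pi>\<close>, so that it is determined by its image in
  \<open>W\<close>.\<close>

locale tensor_coordinates = tensor_closed R M N
  for R :: "'r ring" and M :: "('r, 'm) module" and N :: "('r, 'n) module" +
  fixes W :: "'w::ab_group_add set" and \<beta> :: "'m \<Rightarrow> 'n \<Rightarrow> 'w"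
    and I :: "'i set" and \<epsilon> :: "'i \<Rightarrow> 'm" and \<pi> :: "'i \<Rightarrow> 'w \<Rightarrow> 'n"
  assumes W_0: "0 \<in> W" and W_diff: "w \<in> W \<Longrightarrow> w' \<in> W \<Longrightarrow> w - w' \<in> W"
    and \<beta>_in: "x \<in> carrier M \<Longrightarrow> y \<in> carrier N \<Longrightarrow> \<beta> x y \<in> W"
    and \<beta>_add_left: "x \<in> carrier M \<Longrightarrow> x' \<in> carrier M \<Longrightarrow> y \<in> carrier N \<Longrightarrow>
      \<beta> (x \<oplus>\<^bsub>M\<^esub> x') y = \<beta> x y + \<beta> x' y"
    and \<beta>_add_right: "x \<in> carrier M \<Longrightarrow> y \<in> carrier N \<Longrightarrow> y' \<in> carrier N \<Longrightarrow>
      \<beta> x (y \<oplus>\<^bsub>N\<^esub> y') = \<beta> x y + \<beta> x y'"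
    and \<beta>_balanced: "r \<in> carrier R \<Longrightarrow> x \<in> carrier M \<Longrightarrow> y \<in> carrier N \<Longrightarrow>
      \<beta> (r \<odot>\<^bsub>M\<^esub> x) y = \<beta> x (r \<odot>\<^bsub>N\<^esub> y)"
    and finite_I: "finite I"
    and \<epsilon>_in: "i \<in> I \<Longrightarrow> \<epsilon> i \<in> carrier M"
    and \<pi>_in: "i \<in> I \<Longrightarrow> w \<in> W \<Longrightarrow> \<pi> i w \<in> carrier N"
    and \<pi>_diff: "i \<in> I \<Longrightarrow> w \<in> W \<Longrightarrow> w' \<in> W \<Longrightarrow> \<pi> i w = \<pi> i (w - w') \<oplus>\<^bsub>N\<^esub> \<pi> i w'"
    and \<beta>_\<pi>: "w \<in> W \<Longrightarrow> (\<Sum>i\<in>I. \<beta> (\<epsilon> i) (\<pi> i w)) = w"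
    and generates: "x \<in> carrier M \<Longrightarrow> y \<in> carrier N \<Longrightarrow>
      frag_of (x, y) - (\<Sum>i\<in>I. frag_of (\<epsilon> i, \<pi> i (\<beta> x y))) \<in> tensor_kernel R M N"
begin

definition canonical :: "'w \<Rightarrow> 'm \<times> 'n \<Rightarrow>\<^sub>0 int" where
  "canonical w = (\<Sum>i\<in>I. frag_of (\<epsilon> i, \<pi> i w))"

lemma canonical_in_F: "w \<in> W \<Longrightarrow> canonical w \<in> carrier F"
  unfolding canonical_def by (intro F_sum frag_in_F \<epsilon>_in \<pi>_in)

lemma canonical_diff:
  assumes "w \<in> W" "w' \<in> W"
  shows "canonical (w - w') - (canonical w - canonical w') \<in> K"
proof -
  have "canonical (w - w') - (canonical w - canonical w') =
      - (\<Sum>i\<in>I. frag_of (\<epsilon> i, \<pi> i w) - frag_of (\<epsilon> i, \<pi> i (w - w')) - frag_of (\<epsilon> i, \<pi> i w'))"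
    unfolding canonical_def by (simp add: sum_subtractf)
  moreover have "frag_of (\<epsilon> i, \<pi> i w) - frag_of (\<epsilon> i, \<pi> i (w - w')) - frag_of (\<epsilon> i, \<pi> i w') \<in> K"
    if "i \<in> I" for i
    unfolding \<pi>_diff[OF that assms] by (intro relations_in_K \<epsilon>_in \<pi>_in that W_diff assms)
  ultimately show ?thesis by (auto intro!: K_sum K_closed(3))
qed

text \<open>The additive extension of \<open>\<beta>\<close> to the free group; the universal
  property supplies one.\<close>

definition extension :: "('m \<times> 'n \<Rightarrow>\<^sub>0 int) \<Rightarrow> 'w" where
  "extension = (SOME h. (\<forall>x\<in>carrier F. \<forall>y\<in>carrier F. h (x + y) = h x + h y) \<and>
     (\<forall>x\<in>carrier M. \<forall>y\<in>carrier N. h (frag_of (x, y)) = \<beta> x y))"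

lemma extension:
  "x \<in> carrier F \<Longrightarrow> y \<in> carrier F \<Longrightarrow> extension (x + y) = extension x + extension y"
  "a \<in> carrier M \<Longrightarrow> b \<in> carrier N \<Longrightarrow> extension (frag_of (a, b)) = \<beta> a b"
proof -
  \<comment> \<open>The universal property speaks of group records, so the additive group of the
    type is wrapped as one.\<close>
  define G where "G = \<lparr>carrier = (UNIV :: 'w set), monoid.mult = ((+) :: 'w \<Rightarrow> _), one = 0\<rparr>"
  have "comm_group G"
  proof (rule comm_groupI)
    show "\<exists>y\<in>carrier G. y \<otimes>\<^bsub>G\<^esub> x = \<one>\<^bsub>G\<^esub>" for x
      by (rule bexI[of _ "- x"]) (auto simp: G_def)
  qed (auto simp: G_def ac_simps)
  then interpret G: comm_group G .
  obtain h where h: "h \<in> hom F G" "\<And>x. x \<in> S \<Longrightarrow> h (frag_of x) = (\<lambda>(x, y). \<beta> x y) x"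
    using G.free_Abelian_group_universal[of "\<lambda>(x, y). \<beta> x y" S] unfolding tensor_free_def
    by (auto simp: G_def)
  have "\<exists>h. (\<forall>x\<in>carrier F. \<forall>y\<in>carrier F. h (x + y) = h x + h y) \<and>
     (\<forall>x\<in>carrier M. \<forall>y\<in>carrier N. h (frag_of (x, y)) = \<beta> x y)"
    using h by (intro exI[of _ h]) (auto simp: hom_def G_def)
  from someI_ex[OF this]
  show "x \<in> carrier F \<Longrightarrow> y \<in> carrier F \<Longrightarrow> extension (x + y) = extension x + extension y"
    and "a \<in> carrier M \<Longrightarrow> b \<in> carrier N \<Longrightarrow> extension (frag_of (a, b)) = \<beta> a b"
    unfolding extension_def by blast+
qed

lemma extension_0 [simp]: "extension 0 = 0"
  using extension(1)[of 0 0] F_closed(1) by simp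

lemma extension_diff:
  "x \<in> carrier F \<Longrightarrow> y \<in> carrier F \<Longrightarrow> extension (x - y) = extension x - extension y"
  using extension(1)[of "x - y" y] F_closed(3) by simp

lemma extension_sum:
  "(\<And>j. j \<in> J \<Longrightarrow> f j \<in> carrier F) \<Longrightarrow> extension (sum f J) = (\<Sum>j\<in>J. extension (f j))"
  by (induction J rule: infinite_finite_induct) (auto simp: extension F_sum)

lemma F_induct [consumes 1, case_names zero diff of]:
  assumes "z \<in> carrier F" "P 0"
    "\<And>x y. x \<in> carrier F \<Longrightarrow> y \<in> carrier F \<Longrightarrow> P x \<Longrightarrow> P y \<Longrightarrow> P (x - y)"
    "\<And>a b. a \<in> carrier M \<Longrightarrow> b \<in> carrier N \<Longrightarrow> P (frag_of (a, b))"
  shows "P z"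
  using assms unfolding carrier_F
  by (intro free_Abelian_group_induct[of z S P]) auto

lemma extension_in: "z \<in> carrier F \<Longrightarrow> extension z \<in> W"
  by (induction rule: F_induct) (auto simp: W_0 extension_diff W_diff extension(2) \<beta>_in)

lemma extension_canonical: "w \<in> W \<Longrightarrow> extension (canonical w) = w"
  unfolding canonical_def
  by (subst extension_sum) (auto simp: frag_in_F \<epsilon>_in \<pi>_in extension(2) \<beta>_\<pi>)

lemma canonical_extension: "z \<in> carrier F \<Longrightarrow> z - canonical (extension z) \<in> K"
proof (induction rule: F_induct)
  case zero
  show ?case using canonical_diff[of 0 0] W_0 K_closed(3)[of "canonical 0"] by simp
next
  case (diff x y)
  have "(x - canonical (extension x)) - (y - canonical (extension y)) -
      (canonical (extension x - extension y) - (canonical (extension x) - canonical (extension y))) \<in> K"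
    by (intro K_closed(4) diff canonical_diff extension_in)
  then show ?case using diff by (simp add: extension_diff algebra_simps)
next
  case (of a b)
  then show ?case using generates by (simp add: extension(2) canonical_def)
qed

text \<open>The relations are killed because \<open>\<beta>\<close> is biadditive and balanced.
  Conversely an element with coordinates 0 is congruent to \<open>canonical 0\<close> modulo
  \<open>K\<close>, and so is 0.\<close>

lemma K_eq: "K = {z \<in> carrier F. extension z = 0}"
proof (intro equalityI subsetI)
  fix z assume "z \<in> K"
  then have "z \<in> generate F (tensor_relations R M N)" unfolding tensor_kernel_def .
  then show "z \<in> {z \<in> carrier F. extension z = 0}"
  proof (induction rule: generate.induct)
    case one then show ?case by (simp add: F_closed)
  next
    case (incl h)
    then have "extension h = 0"
      unfolding tensor_relations_def
      by (auto simp: extension_diff F_closed frag_in_F M_add M_smult N_add N_smult extension(2)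
          \<beta>_add_left \<beta>_add_right \<beta>_balanced)
    then show ?case using incl relations_in_F by auto
  next
    case (inv h)
    then have h: "h \<in> carrier F" using relations_in_F by auto
    have "extension h = 0"
      using inv unfolding tensor_relations_def
      by (auto simp: extension_diff F_closed frag_in_F M_add M_smult N_add N_smult extension(2)
          \<beta>_add_left \<beta>_add_right \<beta>_balanced)
    then show ?case using h extension_diff[of 0 h] F_closed(3)[of 0 h] by (simp add: inv_F F_closed)
  next
    case (eng x y)
    then show ?case by (simp add: extension F_closed)
  qed
next
  fix z assume z: "z \<in> {z \<in> carrier F. extension z = 0}"
  have "z - canonical 0 \<in> K" using canonical_extension[of z] z by simp
  moreover have "0 - canonical 0 \<in> K" using canonical_extension[of 0] F_closed(1) by simp
  ultimately have "(z - canonical 0) - (0 - canonical 0) \<in> K" by (rule K_closed(4))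
  then show "z \<in> K" by simp
qed

text \<open>The cosets of \<open>K\<close> are the fibres of \<open>extension\<close>, so a tensor
  can be named by its coordinates.\<close>

definition fibre :: "'w \<Rightarrow> ('m \<times> 'n \<Rightarrow>\<^sub>0 int) set" where
  "fibre w = {z \<in> carrier F. extension z = w}"

lemma fibre_inj: "w \<in> W \<Longrightarrow> fibre w = fibre w' \<Longrightarrow> w = w'"
  using canonical_in_F[of w] extension_canonical[of w] unfolding fibre_def by auto

lemma coset_eq_fibre: "z \<in> carrier F \<Longrightarrow> K #>\<^bsub>F\<^esub> z = fibre (extension z)"
proof (intro equalityI subsetI)
  fix x assume z: "z \<in> carrier F" and "x \<in> K #>\<^bsub>F\<^esub> z"
  then show "x \<in> fibre (extension z)"
    by (auto simp: r_coset_def fibre_def K_eq F_closed extension)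
next
  fix x assume z: "z \<in> carrier F" and x: "x \<in> fibre (extension z)"
  then have "x - z \<in> K" by (auto simp: fibre_def K_eq F_closed extension_diff)
  then show "x \<in> K #>\<^bsub>F\<^esub> z" unfolding r_coset_def by (auto intro!: bexI[of _ "x - z"])
qed

lemma carrier_tensor: "carrier (tensor_group R M N) = fibre ` W"
proof -
  have "carrier (tensor_group R M N) = (\<lambda>z. K #>\<^bsub>F\<^esub> z) ` carrier F"
    unfolding tensor_group_def FactGroup_def by (auto simp: RCOSETS_def)
  also have "\<dots> = (\<lambda>z. fibre (extension z)) ` carrier F"
    by (intro image_cong) (auto simp: coset_eq_fibre)
  also have "\<dots> = fibre ` W"
    using extension_in extension_canonical canonical_in_F by (auto simp: image_iff) metis
  finally show ?thesis .
qed

lemma one_tensor: "\<one>\<^bsub>tensor_group R M N\<^esub> = fibre 0"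
  unfolding tensor_group_def FactGroup_def by (simp add: fibre_def K_eq)

lemma mult_tensor:
  assumes "w \<in> W" "w' \<in> W"
  shows "fibre w \<otimes>\<^bsub>tensor_group R M N\<^esub> fibre w' = fibre (w + w')"
proof -
  have "fibre w <#>\<^bsub>F\<^esub> fibre w' = fibre (w + w')"
  proof (intro equalityI subsetI)
    fix x assume x: "x \<in> fibre (w + w')"
    then have "x - canonical w' \<in> fibre w" "canonical w' \<in> fibre w'"
      using assms by (auto simp: fibre_def F_closed canonical_in_F extension_diff extension_canonical)
    moreover have "x = (x - canonical w') + canonical w'" by simp
    ultimately show "x \<in> fibre w <#>\<^bsub>F\<^esub> fibre w'"
      unfolding set_mult_def mult_F by blast
  qed (auto simp: set_mult_def fibre_def F_closed extension)
  then show ?thesis unfolding tensor_group_def FactGroup_def by simp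
qed

text \<open>\<open>t\<close> has to be additive, not linear, so this covers the semilinear tau as
  well as multiplication by a polynomial. All elements of a coset yield the same coset, which makes
  \<open>the_elem\<close> in \<open>tensor_map\<close> meaningful.\<close>

lemma tensor_map_fibre:
  assumes w: "w \<in> W"
    and t_diff: "\<And>w w'. w \<in> W \<Longrightarrow> w' \<in> W \<Longrightarrow> t (w - w') = t w - t w'"
    and f: "\<And>x. x \<in> carrier M \<Longrightarrow> f x \<in> carrier M" and g: "\<And>y. y \<in> carrier N \<Longrightarrow> g y \<in> carrier N"
    and t: "\<And>x y. x \<in> carrier M \<Longrightarrow> y \<in> carrier N \<Longrightarrow> t (\<beta> x y) = \<beta> (f x) (g y)"
  shows "tensor_map R M N f g (fibre w) = fibre (t w)"
proof -
  let ?h = "frag_extend (\<lambda>(x, y). frag_of (f x, g y))"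
  have h: "?h z \<in> carrier F \<and> extension (?h z) = t (extension z)" if "z \<in> carrier F" for z
    using that
  proof (induction rule: F_induct)
    case zero
    show ?case using t_diff[of 0 0] W_0 by (simp add: F_closed)
  next
    case (diff x y)
    then show ?case
      by (simp add: frag_extend_diff F_closed extension_diff t_diff extension_in)
  next
    case (of a b)
    then show ?case by (simp add: frag_in_F f g extension(2) t)
  qed
  have "(\<lambda>z. K #>\<^bsub>F\<^esub> ?h z) ` fibre w = (\<lambda>z. fibre (t w)) ` fibre w"
    by (intro image_cong) (use h in \<open>auto simp: coset_eq_fibre fibre_def\<close>)
  also have "\<dots> = {fibre (t w)}"
    using canonical_in_F[OF w] extension_canonical[OF w] by (auto simp: fibre_def)
  finally show ?thesis unfolding tensor_map_def by simp
qed

end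

section \<open>Generators of the motive\<close>

context C_infinity
begin



lemma frob_add: "frob (x + y) = frob x + (frob y :: 'a)"
proof -
  have "2 * (x * y) = 0" by (simp only: mult_2 add_self)
  then show ?thesis by (simp add: frob_def power2_sum mult.assoc)
qed

lemma frob_0 [simp]: "frob 0 = (0 :: 'a)" and frob_1 [simp]: "frob 1 = (1 :: 'a)"
  by (auto simp: frob_def)

lemma frob_mult: "frob (x * y) = frob x * (frob y :: 'a)"
  by (simp add: frob_def power_mult_distrib)

lemma frob_sum: "frob (sum f I) = (\<Sum>i\<in>I. frob (f i :: 'a))"
  by (induction I rule: infinite_finite_induct) (auto simp: frob_add)

lemma frob_pow_0 [simp]: "(frob ^^ i) 0 = (0 :: 'a)"
  by (induction i) auto



section \<open>Left multiplication in the skew polynomial ring\<close>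

lemma coeff_skew_mult:
  "coeff (skew_mult frob f g) n = (\<Sum>i\<le>n. coeff f i * (frob ^^ i) (coeff g (n - i) :: 'a))"
proof -
  let ?a = "\<lambda>i j. coeff f i * (frob ^^ i) (coeff g j)"
  have "coeff (skew_mult frob f g) n =
      (\<Sum>i\<le>degree f. \<Sum>j\<le>degree g. if i + j = n then ?a i j else 0)"
    by (simp add: skew_mult_def coeff_sum)
  also have "\<dots> = (\<Sum>i\<le>degree f. if i \<le> n then ?a i (n - i) else 0)"
  proof (rule sum.cong)
    fix i
    have "(\<Sum>j\<le>degree g. if i + j = n then ?a i j else 0) =
        (\<Sum>j\<le>degree g. if j = n - i then (if i \<le> n then ?a i j else 0) else 0)"
      by (intro sum.cong) auto
    also have "\<dots> = (if i \<le> n then ?a i (n - i) else 0)"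
      by (auto simp: coeff_eq_0)
    finally show "(\<Sum>j\<le>degree g. if i + j = n then ?a i j else 0) = (if i \<le> n then ?a i (n - i) else 0)" .
  qed simp
  also have "\<dots> = (\<Sum>i\<le>n. ?a i (n - i))"
    by (intro sum.mono_neutral_cong) (auto simp: coeff_eq_0)
  finally show ?thesis .
qed

definition tau_poly :: "'a poly \<Rightarrow> 'a poly" where
  "tau_poly f = pCons 0 (map_poly frob f)"

lemma coeff_tau_poly: "coeff (tau_poly f) n = (case n of 0 \<Rightarrow> 0 | Suc k \<Rightarrow> frob (coeff f k))"
  by (simp add: tau_poly_def coeff_pCons coeff_map_poly split: nat.splits)

lemma skew_mult_const: "skew_mult frob [:a:] g = Polynomial.smult a (g :: 'a poly)"
proof (rule poly_eqI)
  fix n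
  have "coeff (skew_mult frob [:a:] g) n = (\<Sum>i\<le>n. if i = 0 then a * coeff g n else 0)"
    unfolding coeff_skew_mult by (intro sum.cong) (auto simp: coeff_pCons split: nat.splits)
  then show "coeff (skew_mult frob [:a:] g) n = coeff (Polynomial.smult a g) n" by simp
qed

lemma skew_mult_tau: "skew_mult frob (Polynomial.monom 1 1) g = tau_poly (g :: 'a poly)"
proof (rule poly_eqI)
  fix n
  have "coeff (skew_mult frob (Polynomial.monom 1 1) g) n =
      (\<Sum>i\<le>n. if i = 1 then frob (coeff g (n - 1)) else 0)"
    unfolding coeff_skew_mult by (intro sum.cong) auto
  then show "coeff (skew_mult frob (Polynomial.monom 1 1) g) n = coeff (tau_poly g) n"
    by (auto simp: coeff_tau_poly split: nat.splits)
qed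

lemma skew_mult_add_left: "skew_mult frob (f + f') g = skew_mult frob f g + skew_mult frob f' (g :: 'a poly)"
  by (rule poly_eqI) (simp add: coeff_skew_mult algebra_simps sum.distrib)

lemma skew_mult_smult_left:
  "skew_mult frob (Polynomial.smult a f) g = Polynomial.smult a (skew_mult frob f (g :: 'a poly))"
  by (rule poly_eqI) (simp add: coeff_skew_mult algebra_simps sum_distrib_left)

lemma skew_mult_tau_left: "skew_mult frob (tau_poly f) g = tau_poly (skew_mult frob f (g :: 'a poly))"
proof (rule poly_eqI)
  fix n
  show "coeff (skew_mult frob (tau_poly f) g) n = coeff (tau_poly (skew_mult frob f g)) n"
  proof (cases n)
    case (Suc k)
    show ?thesis
      unfolding Suc coeff_skew_mult coeff_tau_poly sum.atMost_Suc_shift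
      by (simp add: coeff_skew_mult frob_sum frob_mult)
  qed (simp add: coeff_skew_mult coeff_tau_poly)
qed

lemma tau_poly_add: "tau_poly (f + g) = tau_poly f + (tau_poly g :: 'a poly)"
  by (rule poly_eqI) (auto simp: coeff_tau_poly frob_add split: nat.splits)

lemma tau_poly_sum: "tau_poly (sum f I) = (\<Sum>i\<in>I. tau_poly (f i))"
proof -
  have "tau_poly 0 = 0" by (simp add: tau_poly_def)
  then show ?thesis by (induction I rule: infinite_finite_induct) (auto simp: tau_poly_add)
qed

section \<open>Constants, tau and T acting on the motive\<close>

definition scale :: "'a \<Rightarrow> 'a motive \<Rightarrow> 'a motive" where
  "scale a m = left_action [:a:] m"

definition tau_motive :: "'a motive \<Rightarrow> 'a motive" where
  "tau_motive m = left_action (Polynomial.monom 1 1) m"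

lemma scale_nth: "scale a m $ j = Polynomial.smult a (m $ j)"
  by (simp add: scale_def left_action_def skew_mult_const)

lemma tau_motive_nth: "tau_motive m $ j = tau_poly (m $ j)"
  unfolding tau_motive_def left_action_def skew_mult_tau by simp

lemma scale_add: "scale a (m + m') = scale a m + scale a m'"
  "scale (a + b) m = scale a m + scale b m"
  by (auto simp: vec_eq_iff scale_nth smult_add_right smult_add_left)

lemma scale_scale: "scale a (scale b m) = scale (a * b) m"
  and scale_0 [simp]: "scale 0 m = 0" "scale a 0 = 0" and scale_1 [simp]: "scale 1 m = m"
  by (auto simp: vec_eq_iff scale_nth)

lemma tau_motive_add: "tau_motive (m + m') = tau_motive m + tau_motive m'"
  by (auto simp: vec_eq_iff tau_motive_nth tau_poly_add)

lemma tau_motive_scale: "tau_motive (scale a m) = scale (frob a) (tau_motive m)"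
  by (auto simp: vec_eq_iff tau_motive_nth scale_nth poly_eq_iff coeff_tau_poly frob_mult split: nat.splits)

text \<open>The basis vectors generate the motive over \<open>C{tau}\<close>, a ring generated by
  the constants and tau. This reduces membership in a submodule, and compatibility of a map with
  \<open>T\<close>, to the basis vectors.\<close>

lemma motive_induct [case_names basis add scale tau]:
  assumes basis: "\<And>j. P (axis j 1)"
    and add: "\<And>m m'. P m \<Longrightarrow> P m' \<Longrightarrow> P (m + m')"
    and scale: "\<And>a m. P m \<Longrightarrow> P (scale a m)"
    and tau: "\<And>m. P m \<Longrightarrow> P (tau_motive m)"
  shows "P (m :: 'a motive)"
proof -
  have 1: "P (axis j (Polynomial.monom 1 n))" for j n
  proof (induction n)
    case (Suc n)
    have "axis j (Polynomial.monom 1 (Suc n)) = tau_motive (axis j (Polynomial.monom 1 n))"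
      by (auto simp: vec_eq_iff axis_def tau_motive_nth poly_eq_iff coeff_tau_poly split: nat.splits)
    then show ?case using tau[OF Suc] by simp
  qed (use basis in simp)
  have 2: "P (axis j (Polynomial.monom a n))" for j a n
  proof -
    have "axis j (Polynomial.monom a n) = scale a (axis j (Polynomial.monom 1 n))"
      by (auto simp: vec_eq_iff axis_def scale_nth smult_monom)
    then show ?thesis using scale[OF 1] by simp
  qed
  have 3: "P (axis j (\<Sum>n\<le>N. Polynomial.monom (c n) n))" for j N c
  proof (induction N)
    case (Suc N)
    have "axis j (\<Sum>n\<le>Suc N. Polynomial.monom (c n) n) =
        axis j (\<Sum>n\<le>N. Polynomial.monom (c n) n) + axis j (Polynomial.monom (c (Suc N)) (Suc N))"
      by (auto simp: vec_eq_iff axis_def)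
    then show ?case using add[OF Suc 2] by simp
  qed (use 2 in simp)
  have 4: "P (axis j f)" for j f
    using 3[of j "coeff f" "degree f"] by (simp add: poly_as_sum_of_monoms)
  have "m = axis 1 (m $ 1) + axis 2 (m $ 2)"
    by (simp add: vec_eq_iff axis_def forall_2)
  then show ?thesis using add[OF 4 4] by metis
qed

lemma T_action_add: "T_action \<theta> A (m + m') = T_action \<theta> A m + T_action \<theta> A m'"
  by (simp add: T_action_def vec_eq_iff skew_mult_add_left sum.distrib)

lemma T_action_scale: "T_action \<theta> A (scale a m) = scale a (T_action \<theta> A m)"
  by (simp add: T_action_def vec_eq_iff scale_nth skew_mult_smult_left forall_2 sum_2 smult_add_right)

lemma T_action_tau: "T_action \<theta> A (tau_motive m) = tau_motive (T_action \<theta> A m)"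
  by (simp add: T_action_def vec_eq_iff tau_motive_nth skew_mult_tau_left tau_poly_sum)

lemma T_action_axis:
  "T_action \<theta> A (axis j 1) = scale \<theta> (axis j 1) + (\<Sum>i\<in>UNIV. scale (A $ j $ i) (tau_motive (axis i 1)))
     + tau_motive (tau_motive (axis j 1))"
proof -
  have "T_action \<theta> A (axis j 1) $ i = T_matrix \<theta> A $ j $ i" for i
    by (simp add: T_action_def axis_def skew_mult_one_left skew_mult_zero_left
        if_distrib[of "\<lambda>x. skew_mult frob x _"] sum.delta cong: if_cong)
  moreover have t: "tau_poly 0 = 0" "tau_poly 1 = [:0, 1:]" "tau_poly [:0, 1:] = [:0, 0, 1:]"
    by (auto simp: poly_eq_iff coeff_tau_poly coeff_pCons split: nat.splits)
  ultimately show ?thesis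
    by (simp add: vec_eq_iff forall_2 sum_2 scale_nth tau_motive_nth T_matrix_def axis_def)
qed

definition poly_action :: "'a ^ 2 ^ 2 \<Rightarrow> 'a poly \<Rightarrow> 'a motive \<Rightarrow> 'a motive" where
  "poly_action A p m = (\<Sum>i\<le>degree p. scale (coeff p i) ((T_action \<theta> A ^^ i) m))"

lemma smult_restrict: "p \<odot>\<^bsub>restrict_to_CT (anderson_motive \<theta> A)\<^esub> m = poly_action A p m"
proof -
  have "left_action (Polynomial.monom 1 0) m = m"
    using scale_1[of m] by (simp add: scale_def monom_0)
  then show ?thesis by (simp add: restrict_to_CT_def anderson_motive_def poly_action_def scale_def)
qed

lemma smult_tau: "tau \<odot>\<^bsub>anderson_motive \<theta> A\<^esub> m = tau_motive m"
proof -
  have "left_action 0 x = (0 :: 'a motive)" "left_action 1 x = x" for x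
    using scale_0(1)[of x] scale_1[of x] by (simp_all add: scale_def one_pCons)
  then show ?thesis by (simp add: anderson_motive_def degree_monom_eq tau_motive_def flip: one_pCons)
qed

lemma T_action_0: "T_action \<theta> A 0 = 0"
  using T_action_scale[of A 0 0] by simp

lemma T_action_sum: "T_action \<theta> A (sum f I) = (\<Sum>i\<in>I. T_action \<theta> A (f i))"
  by (induction I rule: infinite_finite_induct) (auto simp: T_action_0 T_action_add)

lemma poly_action_0 [simp]: "poly_action A 0 m = 0"
  by (simp add: poly_action_def)

lemma poly_action_pCons: "poly_action A (pCons a p) m = scale a m + T_action \<theta> A (poly_action A p m)"
proof (cases "p = 0")
  case True
  then show ?thesis
    by (cases "a = 0") (auto simp: poly_action_def T_action_0)
next
  case False
  then show ?thesis
    unfolding poly_action_def degree_pCons_eq[OF False] sum.atMost_Suc_shift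
    by (simp add: T_action_sum T_action_scale)
qed

lemma poly_action_1 [simp]: "poly_action A 1 m = m"
  using poly_action_pCons[of A 1 0 m] by (simp add: one_pCons scale_1 T_action_0)

lemma poly_action_add: "poly_action A (p + p') m = poly_action A p m + poly_action A p' m"
  by (induction p p' rule: poly_induct2) (auto simp: poly_action_pCons scale_add T_action_add)

lemma poly_action_smult: "poly_action A (Polynomial.smult a p) m = scale a (poly_action A p m)"
  by (induction p) (auto simp: poly_action_pCons scale_add scale_scale T_action_scale scale_0)

lemma tau_motive_poly_action:
  "tau_motive (poly_action A p m) = poly_action A (map_poly frob p) (tau_motive m)"
proof (induction p)
  case 0
  show ?case using tau_motive_scale[of 0 0] by (simp add: scale_0)
next
  case (pCons a p)
  have "map_poly frob (pCons a p) = pCons (frob a) (map_poly frob p)"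
    by (rule map_poly_pCons) simp
  then show ?case
    using pCons by (simp add: poly_action_pCons tau_motive_add tau_motive_scale T_action_tau[symmetric])
qed

section \<open>Four generators over C[T]\<close>

definition generator :: "4 \<Rightarrow> 'a motive" where
  "generator k = (if k = 1 then axis 1 1 else if k = 2 then axis 2 1
     else if k = 3 then tau_motive (axis 1 1) else tau_motive (axis 2 1))"

lemma generator_simps [simp]:
  "generator 1 = axis 1 1" "generator 2 = axis 2 1"
  "generator 3 = tau_motive (axis 1 1)" "generator 4 = tau_motive (axis 2 1)"
  by (auto simp: generator_def)

text \<open>The equation that defines \<open>T\<close> on a basis vector, solved for the square of
  tau; in characteristic 2 no signs appear.\<close>

lemma tau_squared:
  "tau_motive (tau_motive (axis j 1)) = T_action \<theta> A (axis j 1) + scale \<theta> (axis j 1)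
     + (\<Sum>i\<in>UNIV. scale (A $ j $ i) (tau_motive (axis i 1)))"
proof -
  have "x + x = (0 :: 'a motive)" for x
    by (auto simp only: vec_eq_iff poly_eq_iff vector_add_component coeff_add add_self zero_index coeff_0)
  moreover have "(x + y + z) + x + y = z + (x + x) + (y + y)" for x y z :: "'a motive"
    by (simp only: ac_simps)
  ultimately show ?thesis unfolding T_action_axis by (simp only: add.right_neutral)
qed

text \<open>The span over C[T] is stable under constants and \<open>T\<close> by construction, and
  under tau because \<open>tau_squared\<close> puts the images of the last two generators back into
  it. \<open>motive_induct\<close> then shows that it is everything.\<close>

lemma generators_span: "\<exists>p. m = (\<Sum>k\<in>UNIV. poly_action A (p k) (generator k))"
proof -
  define Sp where "Sp = {\<Sum>k\<in>UNIV. poly_action A (p k) (generator k) | p. True}"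
  have SpI: "(\<Sum>k\<in>UNIV. poly_action A (p k) (generator k)) \<in> Sp" for p
    unfolding Sp_def by blast
  have add: "x + y \<in> Sp" if x: "x \<in> Sp" "y \<in> Sp" for x y
  proof -
    obtain p p' where "x = (\<Sum>k\<in>UNIV. poly_action A (p k) (generator k))"
      "y = (\<Sum>k\<in>UNIV. poly_action A (p' k) (generator k))"
      using x unfolding Sp_def by blast
    then have "x + y = (\<Sum>k\<in>UNIV. poly_action A (p k + p' k) (generator k))"
      by (simp add: poly_action_add sum.distrib)
    then show ?thesis using SpI by metis
  qed
  have scale: "scale a x \<in> Sp" if x: "x \<in> Sp" for a x
  proof -
    obtain p where "x = (\<Sum>k\<in>UNIV. poly_action A (p k) (generator k))"
      using x unfolding Sp_def by blast
    then have "scale a x = (\<Sum>k\<in>UNIV. poly_action A (Polynomial.smult a (p k)) (generator k))"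
      by (simp add: poly_action_smult sum_4 scale_add)
    then show ?thesis using SpI by metis
  qed
  have T: "T_action \<theta> A x \<in> Sp" if x: "x \<in> Sp" for x
  proof -
    obtain p where "x = (\<Sum>k\<in>UNIV. poly_action A (p k) (generator k))"
      using x unfolding Sp_def by blast
    then have "T_action \<theta> A x = (\<Sum>k\<in>UNIV. poly_action A (pCons 0 (p k)) (generator k))"
      by (simp add: poly_action_pCons T_action_sum)
    then show ?thesis using SpI by metis
  qed
  have pa: "poly_action A p x \<in> Sp" if x: "x \<in> Sp" for p x
  proof (induction p)
    case 0
    show ?case using SpI[of "\<lambda>_. 0"] by simp
  next
    case (pCons a p)
    then show ?case unfolding poly_action_pCons by (intro add scale T x)
  qed
  have gen: "generator k \<in> Sp" for k
  proof -
    have "(\<Sum>j\<in>UNIV. poly_action A (if j = k then 1 else 0) (generator j)) =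
        (\<Sum>j\<in>UNIV. if j = k then generator j else 0)"
      by (intro sum.cong) auto
    then show ?thesis using SpI[of "\<lambda>j. if j = k then 1 else 0"] by simp
  qed
  have ax: "axis j 1 \<in> Sp" "tau_motive (axis j 1) \<in> Sp" for j :: 2
    using gen[of 1] gen[of 2] gen[of 3] gen[of 4] exhaust_2[of j] by auto
  have tau_gen: "tau_motive (generator k) \<in> Sp" for k
  proof -
    have "tau_motive (tau_motive (axis j 1)) \<in> Sp" for j
      unfolding tau_squared[of j A] sum_2 by (intro add scale T ax)
    then show ?thesis using exhaust_4[of k] ax by auto
  qed
  have "m \<in> Sp"
  proof (induction m rule: motive_induct)
    case (tau m)
    then obtain p where "m = (\<Sum>k\<in>UNIV. poly_action A (p k) (generator k))"
      unfolding Sp_def by blast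
    then have eq: "tau_motive m = (\<Sum>k\<in>UNIV. poly_action A (map_poly frob (p k)) (tau_motive (generator k)))"
      by (simp add: sum_4 tau_motive_add tau_motive_poly_action)
    show ?case unfolding eq sum_4 by (intro add pa tau_gen)
  qed (auto intro: ax add scale)
  then show ?thesis unfolding Sp_def by blast
qed

end

section \<open>Coordinates on the invariants\<close>

context C_infinity
begin

section \<open>The Tate algebra and its Frobenius\<close>

lemma tate_iff: "f \<in> tate_algebra ord \<longleftrightarrow> (\<forall>r. \<exists>N. \<forall>i\<ge>N. ge r (fps_nth f i))"
proof -
  have "f \<in> tate_algebra ord \<longleftrightarrow> (\<forall>r. \<exists>N. \<forall>i\<ge>N. ereal r < ord (fps_nth f i))"
    unfolding tate_algebra_def by (simp add: tendsto_PInfty eventually_sequentially)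
  also have "\<dots> \<longleftrightarrow> (\<forall>r. \<exists>N. \<forall>i\<ge>N. ge r (fps_nth f i))"
  proof (intro iffI allI)
    fix r assume "\<forall>r. \<exists>N. \<forall>i\<ge>N. ge r (fps_nth f i)"
    then obtain N where "\<forall>i\<ge>N. ge (r + 1) (fps_nth f i)" by blast
    then show "\<exists>N. \<forall>i\<ge>N. ereal r < ord (fps_nth f i)"
      unfolding ge_def by (meson less_add_one less_ereal.simps(1) order_less_le_trans)
  next
    fix r assume "\<forall>r. \<exists>N. \<forall>i\<ge>N. ereal r < ord (fps_nth f i)"
    then obtain N where "\<forall>i\<ge>N. ereal r < ord (fps_nth f i)" by blast
    then show "\<exists>N. \<forall>i\<ge>N. ge r (fps_nth f i)"
      unfolding ge_def by (meson less_imp_le)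
  qed
  finally show ?thesis .
qed

lemma tate_0 [simp]: "0 \<in> tate_algebra ord"
  by (simp add: tate_iff)

lemma tate_add: "f \<in> tate_algebra ord \<Longrightarrow> g \<in> tate_algebra ord \<Longrightarrow> f + g \<in> tate_algebra ord"
  unfolding tate_iff
proof
  fix r assume f: "\<forall>r. \<exists>N. \<forall>i\<ge>N. ge r (fps_nth f i)" and g: "\<forall>r. \<exists>N. \<forall>i\<ge>N. ge r (fps_nth g i)"
  obtain M N where "\<forall>i\<ge>M. ge r (fps_nth f i)" "\<forall>i\<ge>N. ge r (fps_nth g i)"
    using f g by blast
  then show "\<exists>N. \<forall>i\<ge>N. ge r (fps_nth (f + g) i)"
    by (intro exI[of _ "max M N"]) (auto intro: ge_add)
qed

lemma tate_const: "f \<in> tate_algebra ord \<Longrightarrow> fps_const c * f \<in> tate_algebra ord"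
  unfolding tate_iff
proof
  fix r assume f: "\<forall>r. \<exists>N. \<forall>i\<ge>N. ge r (fps_nth f i)"
  obtain N where N: "\<forall>i\<ge>N. ge (r - val c) (fps_nth f i)" using f by blast
  have "ge r (c * fps_nth f i)" if "i \<ge> N" for i
    using ge_mult[of "val c" c "r - val c" "fps_nth f i"] N that by (simp add: ge_iff[of "val c"])
  then show "\<exists>N. \<forall>i\<ge>N. ge r (fps_nth (fps_const c * f) i)" by auto
qed

lemma tate_X: "f \<in> tate_algebra ord \<Longrightarrow> fps_X * f \<in> tate_algebra ord"
  unfolding tate_iff
proof
  fix r assume f: "\<forall>r. \<exists>N. \<forall>i\<ge>N. ge r (fps_nth f i)"
  obtain N where N: "\<forall>i\<ge>N. ge r (fps_nth f i)" using f by blast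
  have "ge r (fps_nth (fps_X * f) i)" if "i \<ge> Suc N" for i
    using N that by (cases i) auto
  then show "\<exists>N. \<forall>i\<ge>N. ge r (fps_nth (fps_X * f) i)" by blast
qed

lemma tate_poly: "f \<in> tate_algebra ord \<Longrightarrow> fps_of_poly p * f \<in> tate_algebra ord"
proof (induction p)
  case (pCons a p)
  have "fps_of_poly (pCons a p) * f = fps_const a * f + fps_X * (fps_of_poly p * f)"
    by (simp add: fps_of_poly_pCons algebra_simps)
  then show ?case using pCons by (simp add: tate_add tate_const tate_X)
qed simp

lemma tate_tau_nth [simp]: "fps_nth (tate_tau f) i = frob (fps_nth f i)"
  by (simp add: tate_tau_def)

lemma tate_tau_in: "f \<in> tate_algebra ord \<Longrightarrow> tate_tau f \<in> tate_algebra ord"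
  unfolding tate_iff
proof
  fix r assume f: "\<forall>r. \<exists>N. \<forall>i\<ge>N. ge r (fps_nth f i)"
  obtain N where N: "\<forall>i\<ge>N. ge (r / 2) (fps_nth f i)" using f by blast
  have "ge r (frob (fps_nth f i))" if "i \<ge> N" for i
    using ge_power[of "r / 2" "fps_nth f i" 2] N that by (simp add: frob_def)
  then show "\<exists>N. \<forall>i\<ge>N. ge r (fps_nth (tate_tau f) i)" by auto
qed

lemma tate_tau_add: "tate_tau (f + g) = tate_tau f + (tate_tau g :: 'a fps)"
  by (rule fps_ext) (simp add: frob_add)

lemma tate_tau_mult: "tate_tau (f * g) = tate_tau f * (tate_tau g :: 'a fps)"
  by (rule fps_ext) (simp add: fps_mult_nth frob_sum frob_mult)

lemma tate_tau_const: "tate_tau (fps_const a) = fps_const (frob a :: 'a)"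
  by (rule fps_ext) simp

lemma tate_tau_X: "tate_tau fps_X = (fps_X :: 'a fps)"
  by (rule fps_ext) simp

lemma tate_tau_01 [simp]: "tate_tau 0 = (0 :: 'a fps)" "tate_tau 1 = (1 :: 'a fps)"
  by (auto intro!: fps_ext)

lemma frob_Fq: "p \<in> poly_over Fq \<Longrightarrow> tate_tau (fps_of_poly p) = (fps_of_poly p :: 'a fps)"
  by (rule fps_ext) (auto simp: poly_over_def Fq_def frob_def)

lemma fps_minus_eq: "f - g = f + (g :: 'a fps)"
  by (rule fps_ext) (simp add: minus_eq)

lemma fps_add_self: "f + f = (0 :: 'a fps)"
  by (rule fps_ext) (simp only: fps_add_nth add_self fps_zero_nth)

lemma vec_minus_eq: "w - w' = w + (w' :: 'a fps ^ 'n)"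
  by (simp add: vec_eq_iff fps_minus_eq)

lemma vec_add_self: "w + w = (0 :: 'a fps ^ 'n)"
  by (simp only: vec_eq_iff vector_add_component fps_add_self zero_index) simp

end

section \<open>The action of tau in four coordinates\<close>

locale motive_data = C_infinity ord \<theta> for ord :: "'a::field \<Rightarrow> ereal" and \<theta> +
  fixes a11 a12 a21 :: 'a
begin

definition A :: "'a ^ 2 ^ 2" where "A = vector [vector [a11, a12], vector [a21, 0]]"

lemma A_nth [simp]: "A $ 1 $ 1 = a11" "A $ 1 $ 2 = a12" "A $ 2 $ 1 = a21" "A $ 2 $ 2 = 0"
  by (simp_all add: A_def)

text \<open>The semilinear action of tau in the basis \<open>e_1, e_2, tau e_1, tau e_2\<close>. The
  coefficients come from \<open>tau^2 e_1 = (T + \<theta>) e_1 + a11 tau e_1 + a12 tau e_2\<close>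
  and \<open>tau^2 e_2 = (T + \<theta>) e_2 + a21 tau e_1\<close>.\<close>

definition tauW :: "'a fps ^ 4 \<Rightarrow> 'a fps ^ 4" where
  "tauW w = (\<chi> k.
     if k = 1 then (fps_X + fps_const \<theta>) * tate_tau (w $ 3)
     else if k = 2 then (fps_X + fps_const \<theta>) * tate_tau (w $ 4)
     else if k = 3 then tate_tau (w $ 1) + fps_const a11 * tate_tau (w $ 3) + fps_const a21 * tate_tau (w $ 4)
     else tate_tau (w $ 2) + fps_const a12 * tate_tau (w $ 3))"

lemma tauW_nth:
  "tauW w $ 1 = (fps_X + fps_const \<theta>) * tate_tau (w $ 3)"
  "tauW w $ 2 = (fps_X + fps_const \<theta>) * tate_tau (w $ 4)"
  "tauW w $ 3 = tate_tau (w $ 1) + fps_const a11 * tate_tau (w $ 3) + fps_const a21 * tate_tau (w $ 4)"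
  "tauW w $ 4 = tate_tau (w $ 2) + fps_const a12 * tate_tau (w $ 3)"
  by (simp_all add: tauW_def)

lemma tauW_add: "tauW (w + w') = tauW w + tauW w'"
  by (simp add: vec_eq_iff forall_4 tauW_nth tate_tau_add algebra_simps)

lemma tauW_0 [simp]: "tauW 0 = 0"
  by (simp add: vec_eq_iff forall_4 tauW_nth)

lemma tauW_sum: "tauW (sum f I) = (\<Sum>i\<in>I. tauW (f i))"
  by (induction I rule: infinite_finite_induct) (auto simp: tauW_add)

lemma tauW_smult: "tauW (f *s w) = tate_tau f *s tauW w"
  by (simp add: vec_eq_iff forall_4 tauW_nth tate_tau_mult algebra_simps)

definition start :: "2 \<Rightarrow> 'a fps ^ 4" where
  "start j = axis (if j = 1 then 1 else 2) 1"

text \<open>The coordinates with respect to the four generators. Taken from the unique coefficients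
  over \<open>C{tau}\<close> they are well defined at once; \<open>phi_T\<close> shows that they
  respect \<open>T\<close>, and with \<open>phi_generator\<close> this makes the generators
  independent over C[T].\<close>

definition phi :: "'a motive \<Rightarrow> 'a fps ^ 4" where
  "phi m = (\<Sum>j\<in>UNIV. \<Sum>n\<le>degree (m $ j). fps_const (coeff (m $ j) n) *s (tauW ^^ n) (start j))"

lemma phi_upto:
  fixes m :: "'a motive"
  assumes "\<And>j. degree (m $ j) \<le> N"
  shows "phi m = (\<Sum>j\<in>UNIV. \<Sum>n\<le>N. fps_const (coeff (m $ j) n) *s (tauW ^^ n) (start j))"
  unfolding phi_def
  by (intro sum.cong sum.mono_neutral_left) (use assms in \<open>auto simp: coeff_eq_0\<close>)

lemma degree_bound: "\<exists>N. (\<forall>j. degree (m $ j) \<le> N) \<and> (\<forall>j. degree (m' $ j) \<le> N)" for m m' :: "'a motive"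
proof -
  let ?S = "range (\<lambda>j. degree (m $ j)) \<union> range (\<lambda>j. degree (m' $ j))"
  have "finite ?S" by simp
  then have "x \<le> Max ?S" if "x \<in> ?S" for x using that by (rule Max_ge)
  then show ?thesis by blast
qed

lemma phi_add: "phi (m + m') = phi m + phi m'"
proof -
  obtain N where N: "\<And>j. degree (m $ j) \<le> N" "\<And>j. degree (m' $ j) \<le> N"
    using degree_bound by metis
  then have "degree ((m + m') $ j) \<le> N" for j by (simp add: degree_add_le)
  then show ?thesis
    by (subst (1 2 3) phi_upto[of _ N])
      (auto simp: N sum.distrib vector_sadd_rdistrib simp flip: fps_const_add)
qed

lemma phi_0 [simp]: "phi 0 = 0"
  by (simp add: phi_def)

lemma phi_sum: "phi (sum f I) = (\<Sum>i\<in>I. phi (f i))"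
  by (induction I rule: infinite_finite_induct) (auto simp: phi_add)

lemma vec_smult_sum: "f *s sum g I = (\<Sum>i\<in>I. f *s (g i :: 'a fps ^ 'n))"
  by (simp add: vec_eq_iff sum_distrib_left)

lemma phi_scale: "phi (scale a m) = fps_const a *s phi m"
proof -
  obtain N where N: "\<And>j. degree (m $ j) \<le> N" using degree_bound by metis
  then have "degree (scale a m $ j) \<le> N" for j
    using degree_smult_le order_trans by (fastforce simp: scale_nth)
  then show ?thesis
    by (subst (1 2) phi_upto[of _ N])
      (auto simp: N vec_smult_sum scale_nth vector_smult_assoc simp flip: fps_const_mult)
qed

lemma phi_tau: "phi (tau_motive m) = tauW (phi m)"
proof -
  obtain N where N: "\<And>j. degree (m $ j) \<le> N" using degree_bound by metis
  then have "coeff (m $ j) n = 0" if "N < n" for j n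
    using that by (intro coeff_eq_0) (rule le_less_trans)
  then have N': "degree (tau_motive m $ j) \<le> Suc N" for j
    by (intro degree_le) (auto simp: tau_motive_nth coeff_tau_poly split: nat.splits)
  show ?thesis
    unfolding phi_upto[of m, OF N] phi_upto[of "tau_motive m", OF N'] sum.atMost_Suc_shift
    by (simp add: tau_motive_nth coeff_tau_poly tauW_sum tauW_smult tate_tau_const)
qed

lemma phi_axis: "phi (axis j 1) = start j"
proof -
  have "phi (axis j 1) = (\<Sum>i\<in>UNIV. if i = j then start i else 0)"
    unfolding phi_def by (intro sum.cong) (auto simp: axis_def)
  then show ?thesis by simp
qed

lemma start_nth:
  "start 1 $ 1 = 1" "start 1 $ 2 = 0" "start 1 $ 3 = 0" "start 1 $ 4 = 0"
  "start 2 $ 1 = 0" "start 2 $ 2 = 1" "start 2 $ 3 = 0" "start 2 $ 4 = 0"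
  by (simp_all add: start_def axis_def)

text \<open>On a basis vector the terms with \<open>\<theta>\<close> and with the entries of
  \<open>A\<close> cancel against those produced by applying \<open>tauW\<close> twice. Constants
  and tau are compatible with \<open>T\<close> on both sides.\<close>

lemma phi_T: "phi (T_action \<theta> A m) = fps_X *s phi m"
proof (induction m rule: motive_induct)
  case (basis j)
  have cancel: "x + (y + x) = y" "x + (x + y) = y" for x y :: "'a fps"
    using fps_add_self[of x] by (metis add.assoc add.commute add_0)+
  have "j = 1 \<or> j = 2" by (rule exhaust_2)
  then show ?case
    unfolding T_action_axis sum_2
    by (auto simp: phi_add phi_scale phi_tau phi_axis vec_eq_iff forall_4 tauW_nth start_nth
        tate_tau_const cancel fps_add_self)
next
  case (add m m')
  then show ?case by (simp add: T_action_add phi_add vector_add_ldistrib)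
next
  case (scale a m)
  then show ?case by (simp add: T_action_scale phi_scale vector_smult_assoc mult.commute)
next
  case (tau m)
  then show ?case by (simp add: T_action_tau phi_tau tauW_smult tate_tau_X)
qed

lemma phi_poly_action: "phi (poly_action A p m) = fps_of_poly p *s phi m"
proof (induction p)
  case (pCons a p)
  then show ?case
    by (simp add: poly_action_pCons phi_add phi_scale phi_T fps_of_poly_pCons vector_sadd_rdistrib
        vector_smult_assoc mult.commute)
qed (simp add: vec_eq_iff)

lemma phi_generator: "phi (generator k) = axis k 1"
proof -
  have "phi (generator k) $ i = (if i = k then 1 else 0)" for i
    using exhaust_4[of k] exhaust_4[of i] by (auto simp: phi_tau phi_axis tauW_nth start_nth)
  then show ?thesis by (simp add: vec_eq_iff axis_def)
qed

section \<open>The tensor product as 4-tuples of Tate series\<close>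

definition W :: "('a fps ^ 4) set" where
  "W = {w. \<forall>k. w $ k \<in> tate_algebra ord}"

definition beta :: "'a motive \<Rightarrow> 'a fps \<Rightarrow> 'a fps ^ 4" where
  "beta m f = (\<chi> k. phi m $ k * f)"

lemma beta_nth [simp]: "beta m f $ k = phi m $ k * f"
  by (simp add: beta_def)

abbreviation "CT \<equiv> ring_on (UNIV :: 'a poly set)"
abbreviation "MA \<equiv> restrict_to_CT (anderson_motive \<theta> A)"
abbreviation "N \<equiv> tate_module ord"

lemma MA_simps [simp]: "carrier MA = UNIV" "x \<oplus>\<^bsub>MA\<^esub> y = x + y"
  by (auto simp: restrict_to_CT_def anderson_motive_def)

lemma N_simps [simp]: "carrier N = tate_algebra ord" "x \<oplus>\<^bsub>N\<^esub> y = x + y" "p \<odot>\<^bsub>N\<^esub> x = fps_of_poly p * x"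
  by (auto simp: tate_module_def)

lemma CT_simps [simp]: "carrier CT = UNIV"
  by (simp add: ring_on_def)

interpretation closed: tensor_closed CT MA N
  by unfold_locales (auto simp: tate_add tate_poly)

lemma frag_of_sum:
  assumes "finite J" "f \<in> tate_algebra ord"
  shows "frag_of (sum m J, f) - (\<Sum>j\<in>J. frag_of (m j, f)) \<in> tensor_kernel CT MA N"
  using assms(1)
proof (induction J rule: finite_induct)
  case empty
  \<comment> \<open>Additivity at \<open>0 + 0\<close> puts the pair \<open>(0, f)\<close> into the
    kernel.\<close>
  have "frag_of (0 \<oplus>\<^bsub>MA\<^esub> 0, f) - frag_of (0, f) - frag_of (0, f) \<in> tensor_kernel CT MA N"
    by (rule closed.relations_in_K) (use assms(2) in auto)
  from closed.K_closed(3)[OF this] show ?case by simp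
next
  case (insert j J)
  have "frag_of (m j \<oplus>\<^bsub>MA\<^esub> sum m J, f) - frag_of (m j, f) - frag_of (sum m J, f) \<in> tensor_kernel CT MA N"
    by (rule closed.relations_in_K) (use assms(2) in auto)
  from closed.K_closed(2)[OF this insert.IH] show ?case using insert by (simp add: algebra_simps)
qed

text \<open>Expand \<open>m\<close> in the generators and move each polynomial coefficient across
  the tensor sign.\<close>

lemma tensor_generates:
  assumes "f \<in> tate_algebra ord"
  shows "frag_of (m, f) - (\<Sum>k\<in>UNIV. frag_of (generator k, beta m f $ k)) \<in> tensor_kernel CT MA N"
proof -
  obtain p where p: "m = (\<Sum>k\<in>UNIV. poly_action A (p k) (generator k))"
    using generators_span by blast
  have ph: "phi m $ k = fps_of_poly (p k)" for k
  proof -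
    have "phi m $ k = (\<Sum>i\<in>UNIV. if i = k then fps_of_poly (p i) else 0)"
      unfolding p phi_sum phi_poly_action phi_generator sum_component
      by (intro sum.cong) (auto simp: axis_def)
    then show ?thesis by simp
  qed
  have "frag_of (p k \<odot>\<^bsub>MA\<^esub> generator k, f) - frag_of (generator k, p k \<odot>\<^bsub>N\<^esub> f) \<in> tensor_kernel CT MA N" for k
    by (rule closed.relations_in_K) (use assms in auto)
  then have "(\<Sum>k\<in>UNIV. frag_of (poly_action A (p k) (generator k), f)
      - frag_of (generator k, beta m f $ k)) \<in> tensor_kernel CT MA N"
    by (intro closed.K_sum) (simp add: smult_restrict ph)
  from closed.K_closed(2)[OF this frag_of_sum[OF _ assms, of UNIV "\<lambda>k. poly_action A (p k) (generator k)"]]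
  show ?thesis by (simp add: sum_subtractf p[symmetric])
qed

interpretation tensor: tensor_coordinates CT MA N W beta UNIV generator "\<lambda>k w. vec_nth w k"
proof unfold_locales
  fix w assume "w \<in> W"
  have "(\<Sum>i\<in>UNIV. beta (generator i) (w $ i)) $ k = w $ k" for k
  proof -
    have "(\<Sum>i\<in>UNIV. beta (generator i) (w $ i)) $ k = (\<Sum>i\<in>UNIV. if i = k then w $ i else 0)"
      unfolding sum_component by (intro sum.cong) (auto simp: phi_generator axis_def)
    then show ?thesis by simp
  qed
  then show "(\<Sum>i\<in>UNIV. beta (generator i) (w $ i)) = w" by (simp add: vec_eq_iff)
next
  fix m f assume "m \<in> carrier MA" "f \<in> carrier N"
  have "phi m $ k * f \<in> tate_algebra ord" for k
  proof -
    obtain p where p: "m = (\<Sum>k\<in>UNIV. poly_action A (p k) (generator k))"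
      using generators_span by blast
    have "phi m = (\<Sum>k\<in>UNIV. fps_of_poly (p k) *s axis k 1)"
      unfolding p phi_sum phi_poly_action phi_generator ..
    then have "phi m $ k = fps_of_poly (p k)"
      using exhaust_4[of k] by (auto simp: sum_4 axis_def)
    then show ?thesis using \<open>f \<in> carrier N\<close> by (simp add: tate_poly)
  qed
  then show "beta m f \<in> W" by (simp add: W_def)
next
  fix m f assume "m \<in> carrier MA" "f \<in> carrier N"
  then show "frag_of (m, f) - (\<Sum>k\<in>UNIV. frag_of (generator k, beta m f $ k)) \<in> tensor_kernel CT MA N"
    using tensor_generates by simp
qed (auto simp: W_def vec_eq_iff phi_add smult_restrict phi_poly_action tate_add fps_minus_eq
       algebra_simps fps_add_self)

section \<open>The invariants as fixed vectors\<close>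

definition V :: "('a fps ^ 4) set" where
  "V = {w \<in> W. tauW w = w}"

lemma tauW_in_W: "w \<in> W \<Longrightarrow> tauW w \<in> W"
  by (simp add: W_def forall_4 tauW_nth distrib_right tate_add tate_X tate_const tate_tau_in)

abbreviation "H \<equiv> H1 ord (anderson_motive \<theta> A)"

lemma H_map_tau:
  "w \<in> W \<Longrightarrow> H1_tensor_map ord (anderson_motive \<theta> A) (\<lambda>m. tau \<odot>\<^bsub>anderson_motive \<theta> A\<^esub> m) tate_tau
    (tensor.fibre w) = tensor.fibre (tauW w)"
  unfolding H1_tensor_map_def smult_tau
  by (rule tensor.tensor_map_fibre)
    (auto simp: vec_minus_eq tauW_add tate_tau_in, simp add: vec_eq_iff forall_4 phi_tau tauW_nth tate_tau_mult algebra_simps)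

lemma H_carrier: "carrier H = tensor.fibre ` V"
proof -
  have "carrier H = {X \<in> tensor.fibre ` W.
     H1_tensor_map ord (anderson_motive \<theta> A) (\<lambda>m. tau \<odot>\<^bsub>anderson_motive \<theta> A\<^esub> m) tate_tau X = X}"
    unfolding H1_def H1_tensor_group_def by (simp add: tensor.carrier_tensor)
  also have "\<dots> = tensor.fibre ` V"
    unfolding V_def using H_map_tau tensor.fibre_inj tauW_in_W by auto
  finally show ?thesis .
qed

lemma V_in_W: "w \<in> V \<Longrightarrow> w \<in> W"
  by (simp add: V_def)

lemma V_0: "0 \<in> V"
  by (simp add: V_def W_def)

lemma V_add: "w \<in> V \<Longrightarrow> w' \<in> V \<Longrightarrow> w + w' \<in> V"
  by (simp add: V_def W_def tate_add tauW_add)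

lemma V_smult: "p \<in> poly_over Fq \<Longrightarrow> w \<in> V \<Longrightarrow> fps_of_poly p *s w \<in> V"
  by (simp add: V_def W_def tate_poly tauW_smult frob_Fq)

lemma H_zero: "\<zero>\<^bsub>H\<^esub> = tensor.fibre 0"
  unfolding H1_def H1_tensor_group_def by (simp add: tensor.one_tensor)

lemma H_add: "w \<in> V \<Longrightarrow> w' \<in> V \<Longrightarrow> tensor.fibre w \<oplus>\<^bsub>H\<^esub> tensor.fibre w' = tensor.fibre (w + w')"
  unfolding H1_def H1_tensor_group_def by (simp add: tensor.mult_tensor V_in_W)

lemma H_smult: "w \<in> V \<Longrightarrow> p \<odot>\<^bsub>H\<^esub> tensor.fibre w = tensor.fibre (fps_of_poly p *s w)"
  unfolding H1_def H1_tensor_map_def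
  by simp (rule tensor.tensor_map_fibre;
    auto simp: V_in_W vec_minus_eq vector_add_ldistrib tate_poly vec_eq_iff)

text \<open>These properties of the isomorphism \<open>\<Phi>\<close> are all that the computation
  of the rank uses about \<open>H\<close>.\<close>

theorem H1_coordinates:
  obtains \<Phi> where "bij_betw \<Phi> (carrier H) V" "\<zero>\<^bsub>H\<^esub> \<in> carrier H \<and> \<Phi> \<zero>\<^bsub>H\<^esub> = 0"
    "\<And>x y. x \<in> carrier H \<Longrightarrow> y \<in> carrier H \<Longrightarrow> x \<oplus>\<^bsub>H\<^esub> y \<in> carrier H \<and> \<Phi> (x \<oplus>\<^bsub>H\<^esub> y) = \<Phi> x + \<Phi> y"
    "\<And>p x. p \<in> poly_over Fq \<Longrightarrow> x \<in> carrier H \<Longrightarrow>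
      p \<odot>\<^bsub>H\<^esub> x \<in> carrier H \<and> \<Phi> (p \<odot>\<^bsub>H\<^esub> x) = fps_of_poly p *s \<Phi> x"
proof
  let ?\<Phi> = "inv_into V tensor.fibre"
  have inj: "inj_on tensor.fibre V"
    using tensor.fibre_inj V_in_W by (auto intro!: inj_onI)
  then have inv: "?\<Phi> (tensor.fibre w) = w" if "w \<in> V" for w
    using that by (rule inv_into_f_f)
  show "bij_betw ?\<Phi> (carrier H) V"
    unfolding H_carrier using inj by (simp add: bij_betw_inv_into inj_on_imp_bij_betw)
  show "\<zero>\<^bsub>H\<^esub> \<in> carrier H \<and> ?\<Phi> \<zero>\<^bsub>H\<^esub> = 0" by (simp add: H_zero H_carrier inv V_0)
  show "x \<oplus>\<^bsub>H\<^esub> y \<in> carrier H \<and> ?\<Phi> (x \<oplus>\<^bsub>H\<^esub> y) = ?\<Phi> x + ?\<Phi> y"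
    if "x \<in> carrier H" "y \<in> carrier H" for x y
    using that unfolding H_carrier by (auto simp: H_add inv V_add)
  show "p \<odot>\<^bsub>H\<^esub> x \<in> carrier H \<and> ?\<Phi> (p \<odot>\<^bsub>H\<^esub> x) = fps_of_poly p *s ?\<Phi> x"
    if "p \<in> poly_over Fq" "x \<in> carrier H" for p x
    using that unfolding H_carrier by (auto simp: H_smult inv V_smult)
qed

end

section \<open>Bases of filtered lattices\<close>

text \<open>Over F_2 a linear combination is a subset sum. When two of them are added, the common
  terms cancel.\<close>

lemma sum_symmetric_difference:
  fixes h :: "'i \<Rightarrow> 'b::ab_group_add"
  assumes "\<And>x. x + x = (0 :: 'b)" "finite S" "finite S'"
  shows "sum h S + sum h S' = sum h ((S - S') \<union> (S' - S))"
proof -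
  have "sum h S = sum h (S - S') + sum h (S \<inter> S')" "sum h S' = sum h (S' - S) + sum h (S \<inter> S')"
    using sum.Int_Diff[OF assms(2), of h S'] sum.Int_Diff[OF assms(3), of h S]
    by (simp_all add: Int_commute add.commute)
  then have "sum h S + sum h S' = (sum h (S - S') + sum h (S' - S)) + (sum h (S \<inter> S') + sum h (S \<inter> S'))"
    by (simp only: ac_simps)
  also have "\<dots> = sum h (S - S') + sum h (S' - S)" by (simp only: assms(1) add_0_right)
  also have "\<dots> = sum h ((S - S') \<union> (S' - S))"
    using assms by (subst sum.union_disjoint) auto
  finally show ?thesis .
qed

context C_infinity
begin

lemma Fq_eq: "Fq = {0, 1 :: 'a}"
proof -
  have "x\<^sup>2 = x \<longleftrightarrow> x = 0 \<or> x = 1" for x :: 'a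
    by (auto simp: power2_eq_square)
  then show ?thesis by (auto simp: Fq_def)
qed

lemma Fq_01 [simp]: "0 \<in> (Fq :: 'a set)" "1 \<in> (Fq :: 'a set)"
  by (simp_all add: Fq_eq)

lemma poly_over_pCons: "a \<in> Fq \<Longrightarrow> p \<in> poly_over Fq \<Longrightarrow> pCons a p \<in> poly_over (Fq :: 'a set)"
  by (auto simp: poly_over_def coeff_pCons split: nat.splits)

lemma poly_over_Fq_0: "0 \<in> poly_over (Fq :: 'a set)"
  by (simp add: poly_over_def Fq_eq)

lemma poly_over_Fq_diff:
  "p \<in> poly_over Fq \<Longrightarrow> p' \<in> poly_over Fq \<Longrightarrow> p - p' \<in> poly_over (Fq :: 'a set)"
proof -
  have "x + y \<in> Fq" if "x \<in> Fq" "y \<in> Fq" for x y :: 'a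
    using that add_self[of 1] by (auto simp only: Fq_eq insert_iff empty_iff) simp_all
  then show "p \<in> poly_over Fq \<Longrightarrow> p' \<in> poly_over Fq \<Longrightarrow> ?thesis"
    unfolding poly_over_def by (simp add: minus_eq)
qed

text \<open>Linear independence over F_2, encoded by subsets because the coefficients are 0 or
  1.\<close>

definition indep :: "'i set \<Rightarrow> ('i \<Rightarrow> 'a) \<Rightarrow> bool" where
  "indep I h \<longleftrightarrow> (\<forall>S\<subseteq>I. sum h S = 0 \<longrightarrow> S = {})"

lemma indepD: "indep I h \<Longrightarrow> S \<subseteq> I \<Longrightarrow> sum h S = 0 \<Longrightarrow> S = {}"
  by (simp add: indep_def)

lemma indep_inj: "finite I \<Longrightarrow> indep I h \<Longrightarrow> inj_on (sum h) (Pow I)"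
proof (rule inj_onI)
  fix S S' assume I: "finite I" "indep I h" and S: "S \<in> Pow I" "S' \<in> Pow I" and eq: "sum h S = sum h S'"
  have "finite S" "finite S'" using S I(1) finite_subset by auto
  then have "sum h ((S - S') \<union> (S' - S)) = sum h S + sum h S'"
    by (rule sum_symmetric_difference[symmetric, OF add_self])
  then have "sum h ((S - S') \<union> (S' - S)) = 0" unfolding eq by (simp only: add_self)
  moreover have "(S - S') \<union> (S' - S) \<subseteq> I" using S by auto
  ultimately have "(S - S') \<union> (S' - S) = {}"
    by (intro indepD[OF I(2)])
  then show "S = S'" by blast
qed

end

text \<open>\<open>e\<close> stands for reduction modulo \<open>T\<close>: its kernel on
  \<open>V\<close> is \<open>T V\<close>. The sets \<open>Fil n\<close> are additive groups that
  need not be modules; by \<open>Fil_X\<close> division by \<open>T\<close> descends through them,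
  and the descent ends at 0.\<close>

locale filtered_lattice = C_infinity ord \<theta> for ord :: "'a::field \<Rightarrow> ereal" and \<theta> +
  fixes V :: "('a fps ^ 'n::finite) set" and e :: "'a fps ^ 'n \<Rightarrow> 'a" and Fil :: "nat \<Rightarrow> ('a fps ^ 'n) set"
  assumes V_0: "0 \<in> V" and V_add: "w \<in> V \<Longrightarrow> w' \<in> V \<Longrightarrow> w + w' \<in> V"
    and V_smult: "p \<in> poly_over Fq \<Longrightarrow> w \<in> V \<Longrightarrow> fps_of_poly p *s w \<in> V"
    and e_add: "e (w + w') = e w + e w'"
    and e_smult: "e (fps_of_poly p *s w) = coeff p 0 * e w"
    and divide: "w \<in> V \<Longrightarrow> e w = 0 \<Longrightarrow> \<exists>w'\<in>V. w = fps_X *s w'"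
    and finite_image: "finite (e ` V)"
    and Fil_0: "Fil 0 = {0}"
    and Fil_V: "Fil n \<subseteq> V" and V_Fil: "V \<subseteq> (\<Union>n. Fil n)"
    and Fil_Suc: "Fil n \<subseteq> Fil (Suc n)"
    and Fil_add: "w \<in> Fil n \<Longrightarrow> w' \<in> Fil n \<Longrightarrow> w + w' \<in> Fil n"
    and Fil_X: "w \<in> V \<Longrightarrow> fps_X *s w \<in> Fil (Suc n) \<Longrightarrow> w \<in> Fil n"
begin

lemma Fil_mono: "m \<le> n \<Longrightarrow> Fil m \<subseteq> Fil n"
  using Fil_Suc by (rule lift_Suc_mono_le)

lemma e_0: "e 0 = 0"
  using e_add[of 0 0] by simp

lemma e_sum: "e (sum f I) = (\<Sum>i\<in>I. e (f i))"
  by (induction I rule: infinite_finite_induct) (auto simp: e_0 e_add)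

lemma V_sum: "(\<And>i. i \<in> I \<Longrightarrow> f i \<in> V) \<Longrightarrow> sum f I \<in> V"
  by (induction I rule: infinite_finite_induct) (auto simp: V_0 V_add)

lemma Fil_sum: "(\<And>i. i \<in> I \<Longrightarrow> f i \<in> Fil n) \<Longrightarrow> sum f I \<in> Fil n"
  using Fil_mono[of 0 n] Fil_0 by (induction I rule: infinite_finite_induct) (auto simp: Fil_add)

lemma card_indep_le:
  assumes "finite B" "B \<subseteq> V" "indep B e"
  shows "2 ^ card B \<le> card (e ` V)"
proof -
  have "sum e ` Pow B \<subseteq> e ` V"
  proof
    fix x assume "x \<in> sum e ` Pow B"
    then obtain S where "S \<subseteq> B" "x = e (\<Sum>b\<in>S. b)" by (auto simp: e_sum)
    then show "x \<in> e ` V" using assms(2) by (auto intro!: imageI V_sum)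
  qed
  then have "card (sum e ` Pow B) \<le> card (e ` V)" by (rule card_mono[OF finite_image])
  then show ?thesis using indep_inj[OF assms(1,3)] assms(1) by (simp add: card_image card_Pow)
qed

text \<open>A largest independent set between \<open>B0\<close> and \<open>X\<close> spans; it
  exists because the finite image of \<open>e\<close> bounds the size of independent sets.\<close>

lemma extend_indep:
  assumes "finite B0" "B0 \<subseteq> X" "X \<subseteq> V" "indep B0 e"
  obtains B where "finite B" "B0 \<subseteq> B" "B \<subseteq> X" "indep B e" "\<And>x. x \<in> X \<Longrightarrow> \<exists>S\<subseteq>B. e x = sum e S"
proof -
  define P where "P B \<longleftrightarrow> finite B \<and> B0 \<subseteq> B \<and> B \<subseteq> X \<and> indep B e" for B
  have bd: "card B < card (e ` V)" if "P B" for B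
  proof -
    have "2 ^ card B \<le> card (e ` V)" using that assms(3) by (intro card_indep_le) (auto simp: P_def)
    then show ?thesis using less_exp[of "card B"] by linarith
  qed
  have "P B0" using assms by (simp add: P_def)
  then have "\<exists>B. P B \<and> (\<forall>B'. P B' \<longrightarrow> card B' \<le> card B)"
    by (rule ex_has_greatest_nat[where b = "card (e ` V)"]) (simp add: bd)
  then obtain B where PB: "P B" and B2: "\<And>B'. P B' \<Longrightarrow> card B' \<le> card B" by blast
  then have B1: "finite B" "B0 \<subseteq> B" "B \<subseteq> X" "indep B e" by (auto simp: P_def)
  have "\<exists>S\<subseteq>B. e x = sum e S" if x: "x \<in> X" for x
  proof (cases "x \<in> B")
    case True
    then show ?thesis by (intro exI[of _ "{x}"]) auto
  next
    case False
    then have "\<not> P (insert x B)" using B2[of "insert x B"] B1(1) by auto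
    then have "\<not> indep (insert x B) e" using B1 x by (auto simp: P_def)
    then obtain S where S: "S \<subseteq> insert x B" "sum e S = 0" "S \<noteq> {}" unfolding indep_def by blast
    \<comment> \<open>\<open>B\<close> itself is independent, so the dependence involves
      \<open>x\<close> and can be solved for \<open>e x\<close>.\<close>
    have "x \<in> S" using S indepD[OF B1(4), of S] by (meson subset_insert)
    moreover have "finite S" using S(1) B1(1) finite_subset by blast
    ultimately have "e x + sum e (S - {x}) = 0" using S(2) by (simp add: sum.remove)
    then have "e x = sum e (S - {x})" by (metis add_eq_0_iff uminus_eq)
    then show ?thesis using S(1) by (intro exI[of _ "S - {x}"]) auto
  qed
  then show ?thesis using that[OF B1] by blast
qed

text \<open>Enlarging the independent set along the filtration adapts it to every step at once.\<close>

lemma adapted_upto: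
  "\<exists>B. finite B \<and> B \<subseteq> Fil n \<and> indep B e \<and> (\<forall>m\<le>n. \<forall>z\<in>Fil m. \<exists>S\<subseteq>B \<inter> Fil m. e z = sum e S)"
proof (induction n)
  case 0
  show ?case by (intro exI[of _ "{}"]) (auto simp: indep_def Fil_0 e_0)
next
  case (Suc n)
  then obtain B where B: "finite B" "B \<subseteq> Fil n" "indep B e"
    "\<And>m z. m \<le> n \<Longrightarrow> z \<in> Fil m \<Longrightarrow> \<exists>S\<subseteq>B \<inter> Fil m. e z = sum e S" by blast
  have BS: "B \<subseteq> Fil (Suc n)" using B(2) Fil_Suc by blast
  obtain B' where B': "finite B'" "B \<subseteq> B'" "B' \<subseteq> Fil (Suc n)" "indep B' e"
    "\<And>x. x \<in> Fil (Suc n) \<Longrightarrow> \<exists>S\<subseteq>B'. e x = sum e S"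
    by (rule extend_indep[OF B(1) BS Fil_V B(3)]) blast
  have "\<exists>S\<subseteq>B' \<inter> Fil m. e z = sum e S" if m: "m \<le> Suc n" "z \<in> Fil m" for m z
  proof (cases "m = Suc n")
    case True
    then show ?thesis using B'(3) B'(5)[of z] m by (simp add: Int_absorb2)
  next
    case False
    then show ?thesis using B(4)[of m z] m B'(2) by (meson Int_mono le_SucE order_refl subset_trans)
  qed
  then show ?case using B' by blast
qed

text \<open>As the image of \<open>e\<close> is finite, some \<open>Fil n\<close> already attains
  all values of \<open>e\<close>. A set adapted up to \<open>n\<close> then serves every later step
  too.\<close>

lemma adapted:
  obtains B where "finite B" "B \<subseteq> V" "indep B e" "\<And>m z. z \<in> Fil m \<Longrightarrow> \<exists>S\<subseteq>B \<inter> Fil m. e z = sum e S"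
proof -
  obtain C where C: "finite C" "C \<subseteq> V" "e ` V = e ` C"
    using finite_subset_image[OF finite_image, of e V] by auto
  obtain k where k: "\<And>x. x \<in> C \<Longrightarrow> x \<in> Fil (k x)" using C(2) V_Fil by (metis UN_E subsetD)
  define n where "n = Max (insert 0 (k ` C))"
  have "k x \<le> n" if "x \<in> C" for x unfolding n_def using C(1) that by (intro Max_ge) auto
  then have Cn: "C \<subseteq> Fil n" using k Fil_mono by blast
  obtain B where B: "finite B" "B \<subseteq> Fil n" "indep B e"
    "\<And>m z. m \<le> n \<Longrightarrow> z \<in> Fil m \<Longrightarrow> \<exists>S\<subseteq>B \<inter> Fil m. e z = sum e S"
    using adapted_upto[of n] by blast
  have "\<exists>S\<subseteq>B \<inter> Fil m. e z = sum e S" if z: "z \<in> Fil m" for m z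
  proof (cases "m \<le> n")
    case False
    have "e z \<in> e ` C" using z Fil_V C(3) by blast
    then obtain x where "x \<in> Fil n" "e z = e x" using Cn by blast
    then obtain S where "S \<subseteq> B \<inter> Fil n" "e z = sum e S" using B(4)[of n x] by auto
    moreover have "Fil n \<subseteq> Fil m" using False by (intro Fil_mono) simp
    ultimately show ?thesis by blast
  qed (use B(4) z in blast)
  then show ?thesis using that B Fil_V by (meson subset_trans)
qed

section \<open>Bases over F_q[T]\<close>

definition comb :: "'i set \<Rightarrow> ('i \<Rightarrow> 'a fps ^ 'n) \<Rightarrow> ('i \<Rightarrow> 'a poly) \<Rightarrow> 'a fps ^ 'n" where
  "comb I g c = (\<Sum>i\<in>I. fps_of_poly (c i) *s g i)"

text \<open>Separates the constant terms of the coefficients, which over F_2 amount to the subset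
  \<open>S\<close>, from the part divisible by \<open>T\<close>.\<close>

lemma comb_pCons:
  assumes "finite I" "S \<subseteq> I"
  shows "comb I g (\<lambda>i. pCons (if i \<in> S then 1 else 0) (c i)) = sum g S + fps_X *s comb I g c"
proof -
  have "fps_of_poly (pCons (if i \<in> S then 1 else 0) (c i)) *s g i =
      (if i \<in> S then g i else 0) + fps_X *s (fps_of_poly (c i) *s g i)" for i
    by (simp add: fps_of_poly_pCons vec_eq_iff algebra_simps)
  moreover have "sum g S = (\<Sum>i\<in>I. if i \<in> S then g i else 0)"
    using assms by (simp add: sum.If_cases Int_absorb1)
  moreover have "fps_X *s comb I g c = (\<Sum>i\<in>I. fps_X *s (fps_of_poly (c i) *s g i))"
    unfolding comb_def by (simp add: vec_eq_iff sum_distrib_left mult.assoc)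
  ultimately show ?thesis by (simp add: comb_def sum.distrib)
qed

lemma e_comb: "e (comb I g c) = (\<Sum>i\<in>I. coeff (c i) 0 * e (g i))"
  by (simp add: comb_def e_sum e_smult)

lemma e_comb_Fq:
  assumes "finite I" "\<And>i. i \<in> I \<Longrightarrow> c i \<in> poly_over Fq"
  shows "e (comb I g c) = (\<Sum>i\<in>{i \<in> I. coeff (c i) 0 \<noteq> 0}. e (g i))"
proof -
  have "coeff (c i) 0 \<in> {0, 1}" if "i \<in> I" for i
    using assms(2)[OF that] unfolding poly_over_def Fq_eq by blast
  then have "(\<Sum>i\<in>I. coeff (c i) 0 * e (g i)) = (\<Sum>i\<in>I. if coeff (c i) 0 \<noteq> 0 then e (g i) else 0)"
    by (intro sum.cong) auto
  then show ?thesis using assms(1) by (simp add: e_comb sum.inter_filter)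
qed

text \<open>A family instead of a set: it is applied to subsets of \<open>V\<close> with
  \<open>g\<close> the identity, and to subsets of an abstract module with \<open>g\<close> the
  isomorphism onto \<open>V\<close>.\<close>

definition basis_family :: "'i set \<Rightarrow> ('i \<Rightarrow> 'a fps ^ 'n) \<Rightarrow> bool" where
  "basis_family I g \<longleftrightarrow> finite I \<and> g ` I \<subseteq> V \<and>
     (\<forall>z\<in>V. \<exists>c\<in>I \<rightarrow> poly_over Fq. z = comb I g c) \<and>
     (\<forall>c\<in>I \<rightarrow> poly_over Fq. comb I g c = 0 \<longrightarrow> (\<forall>i\<in>I. c i = 0))"

lemma X_cancel: "fps_X *s w = 0 \<Longrightarrow> w = (0 :: 'a fps ^ 'n)"
  by (simp add: vec_eq_iff)

lemma basis_exists: "\<exists>B. B \<subseteq> V \<and> basis_family B (\<lambda>b. b)"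
proof -
  obtain B where B: "finite B" "B \<subseteq> V" "indep B e"
    "\<And>m z. z \<in> Fil m \<Longrightarrow> \<exists>S\<subseteq>B \<inter> Fil m. e z = sum e S"
    using adapted by blast
  let ?comb = "comb B (\<lambda>b. b)"
  have span: "\<exists>c\<in>B \<rightarrow> poly_over Fq. z = ?comb c" if "z \<in> Fil m" for m z
    using that
  proof (induction m arbitrary: z)
    case 0
    then have "z = ?comb (\<lambda>_. 0)" by (simp add: Fil_0 comb_def vec_eq_iff)
    moreover have "(\<lambda>_. 0) \<in> B \<rightarrow> poly_over (Fq :: 'a set)" using poly_over_Fq_0 by auto
    ultimately show ?case by blast
  next
    case (Suc m)
    \<comment> \<open>Adaptedness provides the correction inside \<open>Fil (Suc m)\<close>. The
      corrected element therefore stays there, and its quotient by \<open>T\<close> lies in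
      \<open>Fil m\<close>.\<close>
    obtain S where S: "S \<subseteq> B \<inter> Fil (Suc m)" "e z = sum e S" using B(4) Suc.prems by blast
    let ?s = "\<Sum>b\<in>S. b"
    have s: "?s \<in> Fil (Suc m)" using S(1) by (intro Fil_sum) auto
    have zs: "z + ?s \<in> Fil (Suc m)" using Suc.prems s by (rule Fil_add)
    have "e (z + ?s) = 0" using S(2) by (simp only: e_add e_sum add_self)
    then obtain w where w: "w \<in> V" "z + ?s = fps_X *s w" using divide zs Fil_V by blast
    then have "w \<in> Fil m" using zs Fil_X by simp
    then obtain c where c: "c \<in> B \<rightarrow> poly_over Fq" "w = ?comb c" using Suc.IH by blast
    have "z = ?s + (z + ?s)" using vec_add_self[of ?s] by (metis add.assoc add.commute add_0)
    then have "z = ?comb (\<lambda>b. pCons (if b \<in> S then 1 else 0) (c b))"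
      using B(1) S(1) w(2) c(2) by (subst comb_pCons) auto
    moreover have "(\<lambda>b. pCons (if b \<in> S then 1 else 0) (c b)) \<in> B \<rightarrow> poly_over Fq"
      using c(1) by (auto intro!: poly_over_pCons)
    ultimately show ?case by blast
  qed
  \<comment> \<open>Induction on a bound for the degrees: the constant terms vanish by independence
    modulo \<open>T\<close>, and then a factor \<open>T\<close> cancels.\<close>
  have ind: "\<forall>b\<in>B. c b = 0"
    if "\<And>b i. b \<in> B \<Longrightarrow> i \<ge> n \<Longrightarrow> coeff (c b) i = 0" "c \<in> B \<rightarrow> poly_over Fq" "?comb c = 0" for n c
    using that
  proof (induction n arbitrary: c)
    case 0
    then show ?case by (simp add: poly_eq_iff)
  next
    case (Suc n)
    have "sum e {b \<in> B. coeff (c b) 0 \<noteq> 0} = 0"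
      using e_comb_Fq[OF B(1), of c "\<lambda>b. b"] Suc.prems(2,3) by (auto simp: e_0 Pi_iff)
    then have "{b \<in> B. coeff (c b) 0 \<noteq> 0} = {}" by (intro indepD[OF B(3)]) auto
    then have c0: "coeff (c b) 0 = 0" if "b \<in> B" for b using that by blast
    define d where "d b = poly_shift 1 (c b)" for b
    have cd: "c b = pCons 0 (d b)" if "b \<in> B" for b
      using c0[OF that] by (auto simp: poly_eq_iff coeff_pCons d_def coeff_poly_shift split: nat.splits)
    have "?comb c = ?comb (\<lambda>b. pCons (if b \<in> {} then 1 else 0) (d b))"
      unfolding comb_def by (intro sum.cong) (auto simp: cd)
    also have "\<dots> = fps_X *s ?comb d" by (subst comb_pCons[OF B(1)]) auto
    finally have "?comb d = 0" using Suc.prems(3) X_cancel by simp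
    moreover have "d \<in> B \<rightarrow> poly_over Fq"
      using Suc.prems(2) by (auto simp: d_def poly_over_def coeff_poly_shift Pi_iff)
    moreover have "coeff (d b) i = 0" if "b \<in> B" "i \<ge> n" for b i
      using Suc.prems(1)[of b "Suc i"] that by (simp add: d_def coeff_poly_shift)
    ultimately have "\<forall>b\<in>B. d b = 0" by (intro Suc.IH) auto
    then show ?case using cd by simp
  qed
  have ind': "\<forall>b\<in>B. c b = 0" if c: "c \<in> B \<rightarrow> poly_over Fq" "?comb c = 0" for c
  proof -
    define n where "n = Suc (\<Sum>b\<in>B. degree (c b))"
    have "coeff (c b) i = 0" if "b \<in> B" "i \<ge> n" for b i
    proof (rule coeff_eq_0)
      have "degree (c b) \<le> (\<Sum>b\<in>B. degree (c b))" using B(1) that(1) by (intro member_le_sum) auto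
      then show "degree (c b) < i" using that(2) by (simp add: n_def)
    qed
    then show ?thesis using c by (intro ind) auto
  qed
  have "basis_family B (\<lambda>b. b)"
    unfolding basis_family_def
  proof (intro conjI ballI impI)
    show "finite B" "(\<lambda>b. b) ` B \<subseteq> V" using B(1,2) by simp_all
  next
    fix c b assume "c \<in> B \<rightarrow> poly_over Fq" "?comb c = 0" "b \<in> B"
    then show "c b = 0" by (rule ind'[rule_format])
  next
    fix z assume "z \<in> V"
    then obtain m where "z \<in> Fil m" using V_Fil by blast
    then show "\<exists>c\<in>B \<rightarrow> poly_over Fq. z = ?comb c" by (rule span)
  qed
  then show ?thesis using B(2) by blast
qed

text \<open>A basis over F_q[T] reduces modulo \<open>T\<close> to a basis of the image of
  \<open>e\<close> over F_2, so its size is determined by that image. This is also why the rank is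
  unique.\<close>

lemma card_basis:
  assumes "basis_family I g"
  shows "2 ^ card I = card (e ` V)"
proof -
  have I: "finite I" "g ` I \<subseteq> V"
    and span: "\<And>z. z \<in> V \<Longrightarrow> \<exists>c\<in>I \<rightarrow> poly_over Fq. z = comb I g c"
    and ind: "\<And>c. c \<in> I \<rightarrow> poly_over Fq \<Longrightarrow> comb I g c = 0 \<Longrightarrow> \<forall>i\<in>I. c i = 0"
    using assms unfolding basis_family_def by auto
  let ?h = "\<lambda>i. e (g i)"
  have "indep I ?h"
    unfolding indep_def
  proof (intro allI impI)
    fix S assume S: "S \<subseteq> I" "sum ?h S = 0"
    have gS: "sum g S \<in> V" using S(1) I(2) by (intro V_sum) auto
    have "e (sum g S) = 0" using S(2) by (simp add: e_sum)
    then obtain w where w: "w \<in> V" "sum g S = fps_X *s w" using divide gS by blast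
    obtain c where c: "c \<in> I \<rightarrow> poly_over Fq" "w = comb I g c" using span w(1) by blast
    \<comment> \<open>The subset sum equals \<open>T w\<close>, so together with the expansion of
      \<open>T w\<close> it gives a relation whose coefficients have constant term 1 exactly on
      \<open>S\<close>.\<close>
    have "comb I g (\<lambda>i. pCons (if i \<in> S then 1 else 0) (c i)) = 0"
      unfolding comb_pCons[OF I(1) S(1)] w(2) c(2)[symmetric] by (rule vec_add_self)
    moreover have "(\<lambda>i. pCons (if i \<in> S then 1 else 0) (c i)) \<in> I \<rightarrow> poly_over Fq"
      using c(1) by (auto intro!: poly_over_pCons)
    ultimately have "\<forall>i\<in>I. pCons (if i \<in> S then 1 else 0) (c i) = 0" by (intro ind)
    then show "S = {}" using S(1) by (force split: if_splits)
  qed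
  moreover have "sum ?h ` Pow I = e ` V"
  proof (intro equalityI subsetI)
    fix x assume "x \<in> sum ?h ` Pow I"
    then obtain S where "S \<subseteq> I" "x = e (sum g S)" by (auto simp: e_sum)
    then show "x \<in> e ` V" using I(2) by (auto intro!: imageI V_sum)
  next
    fix x assume "x \<in> e ` V"
    then obtain c where c: "c \<in> I \<rightarrow> poly_over Fq" "x = e (comb I g c)" using span by blast
    then have "x = sum ?h {i \<in> I. coeff (c i) 0 \<noteq> 0}"
      using e_comb_Fq[OF I(1), of c g] by (auto simp: Pi_iff)
    then show "x \<in> sum ?h ` Pow I" by blast
  qed
  ultimately show ?thesis using indep_inj[OF I(1)] I(1) by (metis card_Pow card_image)
qed

text \<open>Bases of \<open>H\<close> correspond to basis families of \<open>V\<close> under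
  \<open>\<Phi>\<close>. \<open>basis_exists\<close> supplies one, and \<open>card_basis\<close>
  gives all of them the size \<open>n\<close>, as the definite description in
  \<open>module_rank\<close> requires.\<close>

lemma module_rank_eq:
  fixes H :: "('a poly, 'h) module"
  assumes \<Phi>: "bij_betw \<Phi> (carrier H) V" and zero: "\<zero>\<^bsub>H\<^esub> \<in> carrier H \<and> \<Phi> \<zero>\<^bsub>H\<^esub> = 0"
    and add: "\<And>x y. x \<in> carrier H \<Longrightarrow> y \<in> carrier H \<Longrightarrow> x \<oplus>\<^bsub>H\<^esub> y \<in> carrier H \<and> \<Phi> (x \<oplus>\<^bsub>H\<^esub> y) = \<Phi> x + \<Phi> y"
    and smult: "\<And>p x. p \<in> poly_over Fq \<Longrightarrow> x \<in> carrier H \<Longrightarrow>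
      p \<odot>\<^bsub>H\<^esub> x \<in> carrier H \<and> \<Phi> (p \<odot>\<^bsub>H\<^esub> x) = fps_of_poly p *s \<Phi> x"
    and card: "card (e ` V) = 2 ^ n"
  shows "module_rank FqT H = n"
proof -
  have inj: "x = y" if "x \<in> carrier H" "y \<in> carrier H" "\<Phi> x = \<Phi> y" for x y
    using \<Phi> that by (auto simp: bij_betw_def inj_on_def)
  \<comment> \<open>The laws behind \<open>finsum\<close> are pulled back along the injective map
    \<open>\<Phi>\<close>.\<close>
  have "abelian_monoid H"
    by (rule abelian_monoidI) (auto simp: add zero ac_simps intro!: inj)
  then interpret abelian_monoid H .
  have fs: "finsum H f B \<in> carrier H \<and> \<Phi> (finsum H f B) = (\<Sum>b\<in>B. \<Phi> (f b))"
    if "finite B" "f \<in> B \<rightarrow> carrier H" for f and B :: "'h set"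
    using that by (induction B rule: finite_induct) (auto simp: zero add Pi_iff)
  have comb: "(\<Oplus>\<^bsub>H\<^esub>b\<in>B. c b \<odot>\<^bsub>H\<^esub> b) \<in> carrier H \<and> \<Phi> (\<Oplus>\<^bsub>H\<^esub>b\<in>B. c b \<odot>\<^bsub>H\<^esub> b) = comb B \<Phi> c"
    if "finite B" "B \<subseteq> carrier H" "c \<in> B \<rightarrow> poly_over Fq" for B c
  proof -
    have m: "c b \<odot>\<^bsub>H\<^esub> b \<in> carrier H \<and> \<Phi> (c b \<odot>\<^bsub>H\<^esub> b) = fps_of_poly (c b) *s \<Phi> b" if "b \<in> B" for b
      using smult \<open>B \<subseteq> carrier H\<close> \<open>c \<in> B \<rightarrow> poly_over Fq\<close> that by auto
    then have "(\<Sum>b\<in>B. \<Phi> (c b \<odot>\<^bsub>H\<^esub> b)) = comb B \<Phi> c" unfolding comb_def by (intro sum.cong) auto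
    then show ?thesis using fs[OF that(1), of "\<lambda>b. c b \<odot>\<^bsub>H\<^esub> b"] m by auto
  qed
  have FqT: "carrier FqT = poly_over (Fq :: 'a set)" by (simp add: FqT_def ring_on_def)
  have basis1: "basis_family B \<Phi>" if B: "finite_module_basis FqT H B" for B
  proof -
    have fin: "finite B" "B \<subseteq> carrier H"
      and ex: "\<And>x. x \<in> carrier H \<Longrightarrow>
        \<exists>!c. c \<in> B \<rightarrow>\<^sub>E poly_over Fq \<and> x = (\<Oplus>\<^bsub>H\<^esub>b\<in>B. c b \<odot>\<^bsub>H\<^esub> b)"
      using B unfolding finite_module_basis_def FqT by auto
    have "\<exists>c\<in>B \<rightarrow> poly_over Fq. z = comb B \<Phi> c" if z: "z \<in> V" for z
    proof -
      obtain x where x: "x \<in> carrier H" "z = \<Phi> x" using \<Phi> z by (auto simp: bij_betw_def)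
      obtain c where c: "c \<in> B \<rightarrow>\<^sub>E poly_over Fq" "x = (\<Oplus>\<^bsub>H\<^esub>b\<in>B. c b \<odot>\<^bsub>H\<^esub> b)" using ex[OF x(1)] by blast
      then have c': "c \<in> B \<rightarrow> poly_over Fq" by auto
      show ?thesis using comb[OF fin c'] c(2) x(2) c' by auto
    qed
    moreover have "\<forall>b\<in>B. c b = 0" if c: "c \<in> B \<rightarrow> poly_over Fq" "comb B \<Phi> c = 0" for c
    proof -
      \<comment> \<open>Uniqueness concerns extensional functions, so two expansions of zero are
        compared after restriction to \<open>B\<close>.\<close>
      let ?c = "restrict c B" and ?z = "\<lambda>b\<in>B. 0 :: 'a poly"
      have cB: "?c \<in> B \<rightarrow>\<^sub>E poly_over Fq" "?z \<in> B \<rightarrow>\<^sub>E poly_over Fq"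
        using c(1) poly_over_Fq_0 by auto
      then have cP: "?c \<in> B \<rightarrow> poly_over Fq" "?z \<in> B \<rightarrow> poly_over Fq" by auto
      have "comb B \<Phi> ?c = 0" "comb B \<Phi> ?z = 0"
        using c(2) by (auto simp: comb_def vec_eq_iff)
      then have "\<zero>\<^bsub>H\<^esub> = (\<Oplus>\<^bsub>H\<^esub>b\<in>B. ?c b \<odot>\<^bsub>H\<^esub> b)" "\<zero>\<^bsub>H\<^esub> = (\<Oplus>\<^bsub>H\<^esub>b\<in>B. ?z b \<odot>\<^bsub>H\<^esub> b)"
        using comb[OF fin cP(1)] comb[OF fin cP(2)] zero by (auto intro!: inj)
      then have "?c = ?z" using ex[of "\<zero>\<^bsub>H\<^esub>"] zero cB by blast
      then show ?thesis by (metis restrict_apply')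
    qed
    ultimately show ?thesis
      unfolding basis_family_def using fin \<Phi> by (auto simp: bij_betw_def)
  qed
  have basis2: "finite_module_basis FqT H B" if "B \<subseteq> carrier H" "basis_family B \<Phi>" for B
  proof -
    have fin: "finite B"
      and span: "\<And>z. z \<in> V \<Longrightarrow> \<exists>c\<in>B \<rightarrow> poly_over Fq. z = comb B \<Phi> c"
      and ind: "\<And>c. c \<in> B \<rightarrow> poly_over Fq \<Longrightarrow> comb B \<Phi> c = 0 \<Longrightarrow> \<forall>i\<in>B. c i = 0"
      using that(2) unfolding basis_family_def by auto
    have "\<exists>!c. c \<in> B \<rightarrow>\<^sub>E poly_over Fq \<and> x = (\<Oplus>\<^bsub>H\<^esub>b\<in>B. c b \<odot>\<^bsub>H\<^esub> b)" if x: "x \<in> carrier H" for x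
    proof -
      have "\<Phi> x \<in> V" using \<Phi> x by (auto simp: bij_betw_def)
      then obtain c where c: "c \<in> B \<rightarrow> poly_over Fq" "\<Phi> x = comb B \<Phi> c" using span by blast
      have "comb B \<Phi> (restrict c B) = comb B \<Phi> c" by (simp add: comb_def)
      moreover have "restrict c B \<in> B \<rightarrow>\<^sub>E poly_over Fq" "restrict c B \<in> B \<rightarrow> poly_over Fq" using c(1) by auto
      ultimately have "restrict c B \<in> B \<rightarrow>\<^sub>E poly_over Fq \<and> x = (\<Oplus>\<^bsub>H\<^esub>b\<in>B. restrict c B b \<odot>\<^bsub>H\<^esub> b)"
        using comb[OF fin \<open>B \<subseteq> carrier H\<close>, of "restrict c B"] c(2) x by (auto intro!: inj)
      moreover have "d = d'"
        if d: "d \<in> B \<rightarrow>\<^sub>E poly_over Fq" "x = (\<Oplus>\<^bsub>H\<^esub>b\<in>B. d b \<odot>\<^bsub>H\<^esub> b)"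
          and d': "d' \<in> B \<rightarrow>\<^sub>E poly_over Fq" "x = (\<Oplus>\<^bsub>H\<^esub>b\<in>B. d' b \<odot>\<^bsub>H\<^esub> b)" for d d'
      proof -
        have D: "d \<in> B \<rightarrow> poly_over Fq" "d' \<in> B \<rightarrow> poly_over Fq" using d(1) d'(1) by auto
        have "comb B \<Phi> d = comb B \<Phi> d'"
          using comb[OF fin \<open>B \<subseteq> carrier H\<close> D(1)] comb[OF fin \<open>B \<subseteq> carrier H\<close> D(2)] d(2) d'(2) by metis
        then have "comb B \<Phi> (\<lambda>b. d b - d' b) = 0"
          by (simp add: comb_def fps_of_poly_diff vector_ssub_ldistrib vec_eq_iff left_diff_distrib sum_subtractf)
        moreover have "(\<lambda>b. d b - d' b) \<in> B \<rightarrow> poly_over Fq" using D poly_over_Fq_diff by auto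
        ultimately have "\<forall>b\<in>B. d b - d' b = 0" by (intro ind)
        then show "d = d'" using d(1) d'(1) by (intro PiE_ext) auto
      qed
      ultimately show ?thesis by blast
    qed
    then show ?thesis using fin that(1) unfolding finite_module_basis_def FqT by auto
  qed
  obtain B' where B': "B' \<subseteq> V" "basis_family B' (\<lambda>b. b)" using basis_exists by blast
  have B'_span: "\<And>z. z \<in> V \<Longrightarrow> \<exists>c\<in>B' \<rightarrow> poly_over Fq. z = comb B' (\<lambda>b. b) c"
    and B'_ind: "\<And>c. c \<in> B' \<rightarrow> poly_over Fq \<Longrightarrow> comb B' (\<lambda>b. b) c = 0 \<Longrightarrow> \<forall>b\<in>B'. c b = 0"
    using B'(2) unfolding basis_family_def by auto
  define B where "B = {x \<in> carrier H. \<Phi> x \<in> B'}"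
  have bij: "bij_betw \<Phi> B B'"
    using \<Phi> B'(1) unfolding B_def bij_betw_def inj_on_def by auto
  have re: "comb B \<Phi> (\<lambda>b. c (\<Phi> b)) = comb B' (\<lambda>b. b) c" for c
    unfolding comb_def by (rule sum.reindex_bij_betw[OF bij])
  have "basis_family B \<Phi>"
    unfolding basis_family_def
  proof (intro conjI ballI impI)
    show "finite B" using B'(2) bij_betw_finite[OF bij] by (simp add: basis_family_def)
    show "\<Phi> ` B \<subseteq> V" using bij B'(1) by (auto simp: bij_betw_def)
  next
    fix z assume "z \<in> V"
    then obtain c where c: "c \<in> B' \<rightarrow> poly_over Fq" "z = comb B' (\<lambda>b. b) c"
      using B'_span by blast
    then have "(\<lambda>b. c (\<Phi> b)) \<in> B \<rightarrow> poly_over Fq" by (auto simp: B_def)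
    then show "\<exists>c\<in>B \<rightarrow> poly_over Fq. z = comb B \<Phi> c" using re[of c] c(2) by metis
  next
    fix c b assume c: "c \<in> B \<rightarrow> poly_over Fq" "comb B \<Phi> c = 0" and b: "b \<in> B"
    let ?d = "\<lambda>y. c (inv_into B \<Phi> y)"
    have inv: "inv_into B \<Phi> (\<Phi> x) = x" if "x \<in> B" for x
      using bij that by (simp add: bij_betw_def)
    have "comb B \<Phi> (\<lambda>b. ?d (\<Phi> b)) = comb B \<Phi> c"
      unfolding comb_def by (intro sum.cong) (auto simp: inv)
    then have "comb B' (\<lambda>b. b) ?d = 0" using re[of ?d] c(2) by simp
    moreover have "?d \<in> B' \<rightarrow> poly_over Fq"
      using c(1) bij by (auto simp: bij_betw_def intro!: funcset_mem[OF c(1)] inv_into_into)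
    ultimately have "\<forall>y\<in>B'. ?d y = 0" by (intro B'_ind)
    then show "c b = 0" using b inv[OF b] bij by (auto simp: bij_betw_def)
  qed
  then have fmb: "finite_module_basis FqT H B" by (intro basis2) (auto simp: B_def)
  have cardn: "card B = n" if "finite_module_basis FqT H B" for B
    using card_basis[OF basis1[OF that]] card by simp
  show ?thesis
    unfolding module_rank_def using fmb cardn by (intro the_equality) auto
qed

end

section \<open>The coefficient equations\<close>

locale motive_D12 = motive_data ord \<theta> a11 a12 a21
  for ord :: "'a::field \<Rightarrow> ereal" and \<theta> a11 a12 a21 +
  fixes u v :: real
  assumes ord_a11: "ord a11 = -1" and ord_a12: "ord a12 = ereal u" and ord_a21: "ord a21 = ereal v"
    and v_gt: "- 2 * u - 2 < v" and v_le: "v \<le> - (4 / 3)"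
begin

section \<open>The Newton polygon of the eliminated equation\<close>

lemma nonzero: "\<theta> \<noteq> 0" "a11 \<noteq> 0" "a12 \<noteq> 0" "a21 \<noteq> 0"
  and vals: "val \<theta> = -1" "val a11 = -1" "val a12 = u" "val a21 = v"
  using ord_theta ord_a11 ord_a12 ord_a21 ord_eq_iff[of \<theta> "-1"] ord_eq_iff[of a11 "-1"]
    ord_eq_iff[of a12 u] ord_eq_iff[of a21 v] by (auto simp: one_ereal_def)

lemma ge_divide: "ge r x \<Longrightarrow> y \<noteq> 0 \<Longrightarrow> ge (r - val y) (x / y)"
  by (cases "x = 0") (auto simp: ge_iff val_divide)

text \<open>The ultrametric inequality forbids a nonzero term of valuation strictly below the bound
  for the rest of a vanishing sum.\<close>

lemma dominant: "x + y = 0 \<Longrightarrow> ge t y \<Longrightarrow> val x < t \<Longrightarrow> x = 0"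
  by (metis add_eq_0_iff uminus_eq ge_iff linorder_not_le)

definition "c1 = 1 / a21"
definition "c2 = a11 / a21"
definition "c4 = \<theta> ^ 2 / a21 + (\<theta> ^ 4 / a21 ^ 4 + a12 ^ 2)"
definition "c8 = \<theta> ^ 4 * a11 ^ 4 / a21 ^ 4"
definition "c16 = \<theta> ^ 12 / a21 ^ 4"

lemma val_coeffs:
  "c1 \<noteq> 0" "val c1 = - v" "c2 \<noteq> 0" "val c2 = - 1 - v" "c8 \<noteq> 0" "val c8 = - 8 - 4 * v"
  "c16 \<noteq> 0" "val c16 = - 12 - 4 * v"
  using nonzero by (auto simp: c1_def c2_def c8_def c16_def val_divide val_mult val_power vals)

text \<open>The inequalities defining \<open>D12\<close> say that the first summand, of valuation
  \<open>- 2 - v\<close>, strictly dominates the other two.\<close>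

lemma val_c4: "c4 \<noteq> 0" "val c4 = - 2 - v"
proof -
  let ?y = "\<theta> ^ 4 / a21 ^ 4 + a12 ^ 2"
  define t where "t = min (- 4 - 4 * v) (2 * u)"
  have t: "- 2 - v < t" using v_gt v_le by (auto simp: t_def)
  have y: "ge t ?y"
    using nonzero by (intro ge_add) (auto simp: ge_iff val_divide val_power vals t_def)
  have x: "\<theta> ^ 2 / a21 \<noteq> 0" "val (\<theta> ^ 2 / a21) = - 2 - v"
    using nonzero by (auto simp: val_divide val_power vals)
  show "c4 \<noteq> 0"
    using dominant[OF _ y] x t unfolding c4_def by metis
  have "ge (- 2 - v) c4"
    unfolding c4_def
  proof (rule ge_add)
    show "ge (- 2 - v) (\<theta>\<^sup>2 / a21)" using x by (simp add: ge_iff)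
    show "ge (- 2 - v) ?y" using y t by (rule ge_mono[OF _ less_imp_le])
  qed
  then have "- 2 - v \<le> val c4" using \<open>c4 \<noteq> 0\<close> by (simp add: ge_iff)
  moreover have "val c4 \<le> - 2 - v"
  proof (rule ccontr)
    assume c: "\<not> val c4 \<le> - 2 - v"
    have "ge (min t (val c4)) (?y + c4)"
    proof (rule ge_add)
      show "ge (min t (val c4)) ?y" using y by (rule ge_mono) simp
      show "ge (min t (val c4)) c4" by (simp add: ge_iff)
    qed
    moreover have "\<theta> ^ 2 / a21 + (?y + c4) = 0"
      unfolding c4_def using add_self by (metis add.assoc add.commute)
    ultimately show False using dominant[of "\<theta> ^ 2 / a21" "?y + c4" "min t (val c4)"] x t c by auto
  qed
  ultimately show "val c4 = - 2 - v" by simp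
qed

text \<open>
  \<open>Q\<close> arises by substituting the first coefficient equation, solved for \<open>c\<^sup>2\<close>, into the square
  of the second.
\<close>

definition Q :: "'a \<Rightarrow> 'a poly" where
  "Q r = [:r:] + Polynomial.monom c1 1 + Polynomial.monom c2 2 + Polynomial.monom c4 4
     + Polynomial.monom c8 8 + Polynomial.monom c16 16"

lemma poly_Q: "poly (Q r) b = r + c1 * b + c2 * b ^ 2 + c4 * b ^ 4 + c8 * b ^ 8 + c16 * b ^ 16"
  by (simp add: Q_def poly_monom)

lemma coeff_Q: "coeff (Q r) 0 = r" "coeff (Q r) 1 = c1" "coeff (Q r) 2 = c2" "coeff (Q r) 4 = c4"
  by (simp_all add: Q_def coeff_pCons split: nat.splits)

lemma degree_Q: "degree (Q r) = 16"
proof (rule antisym)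
  show "degree (Q r) \<le> 16"
    unfolding Q_def by (intro degree_add_le) (auto intro: order_trans[OF degree_monom_le])
  have "coeff (Q r) 16 = c16" by (simp add: Q_def coeff_pCons split: nat.splits)
  then show "16 \<le> degree (Q r)" using val_coeffs(7) by (intro le_degree) simp
qed

lemma even_0: "even n \<Longrightarrow> of_nat n = (0 :: 'a)"
  using of_nat_eq_0_iff_char_dvd[of n, where 'a = 'a] by (simp add: char)

text \<open>All exponents except 1 are even, so in characteristic 2 the derivative is the nonzero
  constant \<open>c1\<close>.\<close>

lemma card_roots_Q: "card {b. poly (Q 0) b = 0} = 16"
proof -
  have "pderiv (Q 0) = [:c1:]"
    by (simp add: Q_def pderiv_add pderiv_monom pderiv_pCons even_0 monom_0 del: of_nat_numeral)
  then show ?thesis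
    using card_roots_separable[of "Q 0"] val_coeffs(1) degree_Q[of 0] by force
qed

text \<open>The linear term ties with the quadratic one at valuation 1; beyond it the linear term is
  strictly dominant.\<close>

lemma root_large_eq_0:
  assumes "poly (Q 0) b = 0" "1 < val b"
  shows "b = 0"
proof (rule ccontr)
  assume b: "b \<noteq> 0"
  define t where "t = min (min (val (c2 * b ^ 2)) (val (c4 * b ^ 4))) (min (val (c8 * b ^ 8)) (val (c16 * b ^ 16)))"
  have "c1 * b + (c2 * b ^ 2 + c4 * b ^ 4 + c8 * b ^ 8 + c16 * b ^ 16) = 0"
    using assms(1) by (simp add: poly_Q ac_simps)
  moreover have "ge t (c2 * b ^ 2 + c4 * b ^ 4 + c8 * b ^ 8 + c16 * b ^ 16)"
    by (intro ge_add) (auto simp: ge_iff t_def)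
  moreover have "val (c1 * b) < t"
    using assms(2) v_le b val_coeffs val_c4 by (simp add: t_def val_mult val_power)
  ultimately have "c1 * b = 0" by (rule dominant)
  then show False using b val_coeffs by simp
qed

text \<open>The bound is the valuation at which the terms of degree 4 and 16 tie; below it the
  latter is strictly dominant. The condition \<open>v \<le> - (4 / 3)\<close> says exactly that the
  tie with the term of degree 8, at 1/2, is not below the bound, and equally for the term of degree
  2.\<close>

lemma root_bound:
  assumes "poly (Q 0) b = 0"
  shows "ge ((10 / 3 + v) / 4) b"
proof (rule ccontr)
  assume "\<not> ?thesis"
  then have b: "b \<noteq> 0" "val b < (10 / 3 + v) / 4" by (auto simp: ge_iff)
  define t where "t = min (min (val (c1 * b)) (val (c2 * b ^ 2))) (min (val (c4 * b ^ 4)) (val (c8 * b ^ 8)))"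
  have "c16 * b ^ 16 + (c1 * b + c2 * b ^ 2 + c4 * b ^ 4 + c8 * b ^ 8) = 0"
    using assms(1) by (simp add: poly_Q ac_simps)
  moreover have "ge t (c1 * b + c2 * b ^ 2 + c4 * b ^ 4 + c8 * b ^ 8)"
    by (intro ge_add) (auto simp: ge_iff t_def)
  moreover have "val (c16 * b ^ 16) < t"
    using b v_le val_coeffs val_c4 by (simp add: t_def val_mult val_power field_simps)
  ultimately have "c16 * b ^ 16 = 0" by (rule dominant)
  then show False using b val_coeffs by simp
qed

section \<open>Solving the recursion for the coefficients\<close>

definition solves :: "'a \<Rightarrow> 'a \<Rightarrow> 'a \<Rightarrow> 'a \<Rightarrow> bool" where
  "solves \<beta> \<gamma> b c \<longleftrightarrow> b = \<theta> ^ 2 * b ^ 4 + a11 * b ^ 2 + a21 * c ^ 2 + \<beta> \<and>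
     c = \<theta> ^ 2 * c ^ 4 + a12 * b ^ 2 + \<gamma>"

definition rhs :: "'a \<Rightarrow> 'a \<Rightarrow> 'a" where
  "rhs \<beta> \<gamma> = \<theta> ^ 4 * \<beta> ^ 4 / a21 ^ 4 + \<beta> / a21 + \<gamma> ^ 2"

lemma square_add: "(x + y) ^ 2 = x ^ 2 + (y :: 'a) ^ 2"
  using frob_add[of x y] by (simp add: frob_def)

lemma fourth_add: "(x + y) ^ 4 = x ^ 4 + (y :: 'a) ^ 4"
proof -
  have "z ^ 4 = (z ^ 2) ^ 2" for z :: 'a by (simp flip: power_mult)
  then show ?thesis by (simp only: square_add)
qed

lemma add_eq_0: "x + y = 0 \<longleftrightarrow> x = (y :: 'a)"
  by (metis add_eq_0_iff uminus_eq)

lemma solves_iff: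
  "solves \<beta> \<gamma> b c \<longleftrightarrow>
     c ^ 2 = (\<theta> ^ 2 * b ^ 4 + a11 * b ^ 2 + b + \<beta>) / a21 \<and> poly (Q (rhs \<beta> \<gamma>)) b = 0"
proof -
  let ?L = "(\<theta> ^ 2 * b ^ 4 + a11 * b ^ 2 + b + \<beta>) / a21"
  have "b = \<theta> ^ 2 * b ^ 4 + a11 * b ^ 2 + a21 * c ^ 2 + \<beta> \<longleftrightarrow>
      b + (\<theta> ^ 2 * b ^ 4 + a11 * b ^ 2 + a21 * c ^ 2 + \<beta>) = 0"
    by (simp only: add_eq_0)
  also have "\<dots> \<longleftrightarrow> a21 * c ^ 2 + (\<theta> ^ 2 * b ^ 4 + a11 * b ^ 2 + b + \<beta>) = 0"
    by (simp only: ac_simps)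
  also have "\<dots> \<longleftrightarrow> c ^ 2 = ?L"
    unfolding add_eq_0 using nonzero by (simp add: field_simps)
  finally have 1: "b = \<theta> ^ 2 * b ^ 4 + a11 * b ^ 2 + a21 * c ^ 2 + \<beta> \<longleftrightarrow> c ^ 2 = ?L" .
  have 2: "c = \<theta> ^ 2 * c ^ 4 + a12 * b ^ 2 + \<gamma> \<longleftrightarrow> poly (Q (rhs \<beta> \<gamma>)) b = 0" if c: "c ^ 2 = ?L"
  proof -
    have sq: "(x ^ n) ^ 2 = x ^ (2 * n)" "(x ^ n) ^ 4 = x ^ (4 * n)" for x :: 'a and n
      by (simp_all add: mult.commute flip: power_mult)
    have "c ^ 8 = ?L ^ 4" unfolding c[symmetric] sq by simp
    also have "\<dots> = (\<theta> ^ 8 * b ^ 16 + a11 ^ 4 * b ^ 8 + b ^ 4 + \<beta> ^ 4) / a21 ^ 4"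
      by (simp add: power_divide fourth_add power_mult_distrib sq)
    finally have c8: "c ^ 8 = (\<theta> ^ 8 * b ^ 16 + a11 ^ 4 * b ^ 8 + b ^ 4 + \<beta> ^ 4) / a21 ^ 4" .
    \<comment> \<open>Squaring is injective and additive here. After it \<open>c\<close> occurs only
      as \<open>c ^ 2\<close> and \<open>c ^ 8\<close>, both known from the first equation.\<close>
    have "c = \<theta> ^ 2 * c ^ 4 + a12 * b ^ 2 + \<gamma> \<longleftrightarrow> (c + (\<theta> ^ 2 * c ^ 4 + a12 * b ^ 2 + \<gamma>)) ^ 2 = 0"
      by (simp only: power_eq_0_iff add_eq_0) simp
    also have "(c + (\<theta> ^ 2 * c ^ 4 + a12 * b ^ 2 + \<gamma>)) ^ 2 =
        c ^ 2 + (\<theta> ^ 4 * c ^ 8 + a12 ^ 2 * b ^ 4 + \<gamma> ^ 2)"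
      by (simp add: square_add power_mult_distrib sq)
    also have "\<dots> = poly (Q (rhs \<beta> \<gamma>)) b"
      unfolding c c8 poly_Q rhs_def c1_def c2_def c4_def c8_def c16_def
      by (simp add: add_divide_distrib algebra_simps flip: power_add)
    finally show ?thesis .
  qed
  show ?thesis unfolding solves_def 1 using 2 by blast
qed

lemma square_root: "\<exists>c. c ^ 2 = (y :: 'a)"
proof -
  obtain c where "poly [:y, 0, 1:] c = 0" using root_exists[of "[:y, 0, 1:]"] by auto
  then have "y + c ^ 2 = 0" by (simp add: power2_eq_square)
  then show ?thesis unfolding add_eq_0 by metis
qed

text \<open>For \<open>n = 0\<close> these are \<open>root_bound\<close> and half of the 4/3 found
  in \<open>initial\<close>. With \<open>d = 10/3 + 2 * real n\<close> the bound for
  \<open>b ^ 4\<close> is \<open>d + v\<close>, and each step replaces \<open>d\<close> by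
  \<open>d + 2\<close>.\<close>

definition bounded :: "nat \<Rightarrow> 'a \<Rightarrow> 'a \<Rightarrow> bool" where
  "bounded n b c \<longleftrightarrow> ge ((10 / 3 + 2 * real n + v) / 4) b \<and> ge (2 / 3 + real n) c"

lemma ge_square_root: "ge (2 * r) (c ^ 2) \<Longrightarrow> ge r c"
  using ge_power_iff[of 2 r c] by simp

lemma c_expand: "(\<theta> ^ 2 * b ^ 4 + a11 * b ^ 2 + b + \<beta>) / a21 =
    \<theta> ^ 2 / a21 * b ^ 4 + c2 * b ^ 2 + c1 * b + \<beta> / a21"
  by (simp add: c1_def c2_def add_divide_distrib)

lemma ge_T: "ge (- 2 - v) (\<theta> ^ 2 / a21)"
  using nonzero by (simp add: ge_iff val_divide val_power vals)

lemma initial: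
  assumes "poly (Q 0) b = 0"
  shows "\<exists>c. solves 0 0 b c \<and> bounded 0 b c"
proof -
  obtain c where c: "c ^ 2 = (\<theta> ^ 2 * b ^ 4 + a11 * b ^ 2 + b + 0) / a21" using square_root by blast
  have s: "solves 0 0 b c" using assms c unfolding solves_iff by (simp add: rhs_def)
  let ?s = "(10 / 3 + v) / 4"
  have b: "ge ?s b" using assms by (rule root_bound)
  \<comment> \<open>4/3 is \<open>- 2 - v\<close> plus four times \<open>?s\<close>; the other two
    terms reach it because \<open>v \<le> - (4 / 3)\<close>.\<close>
  have "ge (4 / 3) (\<theta> ^ 2 / a21 * b ^ 4)"
    using ge_mult[OF ge_T ge_power[OF b, of 4]] by (rule ge_mono) (simp add: field_simps)
  moreover have "ge (4 / 3) (c2 * b ^ 2)"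
    using ge_mult[OF _ ge_power[OF b, of 2], of "val c2" c2]
    by (rule ge_mono) (use v_le val_coeffs in \<open>auto simp: ge_iff field_simps\<close>)
  moreover have "ge (4 / 3) (c1 * b)"
    using ge_mult[OF _ b, of "val c1" c1]
    by (rule ge_mono) (use v_le val_coeffs in \<open>auto simp: ge_iff field_simps\<close>)
  ultimately have "ge (4 / 3) (c ^ 2)" unfolding c c_expand by (intro ge_add) auto
  then have "ge (2 / 3) c" using ge_square_root[of "2 / 3" c] by simp
  then have "bounded 0 b c" using b by (simp add: bounded_def)
  then show ?thesis using s by blast
qed

text \<open>The constant term of \<open>Q\<close> has valuation at least \<open>d\<close>, so
  \<open>newton_root\<close> gives a root with \<open>c4 * b ^ 4\<close> at least as small. Since
  \<open>c4\<close> has valuation \<open>- 2 - v\<close>, the bound for \<open>b ^ 4\<close>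
  improves by 2, while every term of \<open>c ^ 2\<close> keeps valuation at least
  \<open>d\<close>.\<close>

lemma step:
  assumes "bounded n b0 c0"
  shows "\<exists>b c. solves (b0 ^ 4) (c0 ^ 4) b c \<and> bounded (Suc n) b c"
proof -
  define d where "d = 10 / 3 + 2 * real n"
  have d: "10 / 3 \<le> d" by (simp add: d_def)
  have b0: "ge ((d + v) / 4) b0" and c0: "ge (2 / 3 + real n) c0"
    using assms by (auto simp: bounded_def d_def add_ac)
  let ?\<beta> = "b0 ^ 4" and ?\<gamma> = "c0 ^ 4"
  have \<beta>: "ge (d + v) ?\<beta>" using ge_power[OF b0, of 4] by (rule ge_mono) (simp add: field_simps)
  have \<beta>1: "ge d (?\<beta> / a21)" using ge_divide[OF \<beta> nonzero(4)] by (simp add: vals)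
  have "ge (- 4 + 4 * (d + v) - 4 * v) (\<theta> ^ 4 * ?\<beta> ^ 4 / a21 ^ 4)"
    using ge_divide[OF ge_mult[OF _ ge_power[OF \<beta>, of 4], of "-4" "\<theta> ^ 4"], of "a21 ^ 4"] nonzero
    by (simp add: ge_iff[of _ "\<theta> ^ 4"] val_power vals)
  \<comment> \<open>\<open>4 * d - 4 \<ge> d\<close> because \<open>d \<ge> 10/3\<close>.\<close>
  then have 1: "ge d (\<theta> ^ 4 * ?\<beta> ^ 4 / a21 ^ 4)" by (rule ge_mono) (use d in simp)
  have "ge (2 * (4 * (2 / 3 + real n))) (?\<gamma> ^ 2)"
    using ge_power[OF ge_power[OF c0, of 4], of 2] by simp
  then have 2: "ge d (?\<gamma> ^ 2)" by (rule ge_mono) (simp add: d_def)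
  have r: "ge d (rhs ?\<beta> ?\<gamma>)"
    unfolding rhs_def by (intro ge_add 1 2 \<beta>1)
  obtain b where b: "poly (Q (rhs ?\<beta> ?\<gamma>)) b = 0"
    and newton: "\<And>k t. ge t (coeff (Q (rhs ?\<beta> ?\<gamma>)) 0) \<Longrightarrow> ge t (coeff (Q (rhs ?\<beta> ?\<gamma>)) k * b ^ k)"
    using newton_root[of "Q (rhs ?\<beta> ?\<gamma>)"] by (auto simp: degree_Q)
  have n1: "ge d (c1 * b)" and n2: "ge d (c2 * b ^ 2)" and n4: "ge d (c4 * b ^ 4)"
    using newton[of d 1] newton[of d 2] newton[of d 4] r by (auto simp: coeff_Q simp del: One_nat_def)
  have b4: "ge (d + 2 + v) (b ^ 4)"
    using ge_divide[OF n4 val_c4(1)] val_c4 by (simp add: algebra_simps)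
  then have "ge (real 4 * ((d + 2 + v) / 4)) (b ^ 4)" by (rule ge_mono) (simp add: field_simps)
  then have "ge ((d + 2 + v) / 4) b" by (rule ge_power_iff[THEN iffD1, rotated]) simp
  then have bb: "ge ((10 / 3 + 2 * real (Suc n) + v) / 4) b" by (rule ge_mono) (simp add: d_def)
  obtain c where c: "c ^ 2 = (\<theta> ^ 2 * b ^ 4 + a11 * b ^ 2 + b + ?\<beta>) / a21" using square_root by blast
  have "ge d (\<theta> ^ 2 / a21 * b ^ 4)" using ge_mult[OF ge_T b4] by simp
  then have "ge d (c ^ 2)" unfolding c c_expand by (intro ge_add n1 n2 \<beta>1)
  then have "ge (d / 2) c" using ge_square_root[of "d / 2" c] by simp
  then have "ge (2 / 3 + real (Suc n)) c" by (rule ge_mono) (simp add: d_def)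
  then show ?thesis using bb b c unfolding bounded_def solves_iff by blast
qed

lemma frob_frob: "frob (frob x) = (x :: 'a) ^ 4"
  by (simp add: frob_def flip: power_mult)

text \<open>The value 0 at index 0 makes the equations for the constant terms homogeneous.\<close>

definition prev :: "'a fps \<Rightarrow> nat \<Rightarrow> 'a" where
  "prev f i = (case i of 0 \<Rightarrow> 0 | Suc j \<Rightarrow> fps_nth f j)"

text \<open>Invariance expresses the first two coordinates through the last two. Substituting them
  applies Frobenius twice, whence the fourth powers; the factor \<open>T\<close> produces the shift
  of the index.\<close>

lemma V_iff: "w \<in> V \<longleftrightarrow> w \<in> W \<and> w $ 1 = (fps_X + fps_const \<theta>) * tate_tau (w $ 3) \<and>
    w $ 2 = (fps_X + fps_const \<theta>) * tate_tau (w $ 4) \<and>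
    (\<forall>i. solves (prev (w $ 3) i ^ 4) (prev (w $ 4) i ^ 4) (fps_nth (w $ 3) i) (fps_nth (w $ 4) i))"
proof -
  have X: "fps_nth (tate_tau ((fps_X + fps_const \<theta>) * tate_tau f)) i =
      prev f i ^ 4 + \<theta> ^ 2 * fps_nth f i ^ 4" for f i
    by (cases i) (simp_all add: prev_def tate_tau_mult tate_tau_add tate_tau_X tate_tau_const
        distrib_right frob_frob frob_def[of \<theta>])
  have "tauW w = w \<longleftrightarrow> w $ 1 = (fps_X + fps_const \<theta>) * tate_tau (w $ 3) \<and>
      w $ 2 = (fps_X + fps_const \<theta>) * tate_tau (w $ 4) \<and>
      w $ 3 = tate_tau ((fps_X + fps_const \<theta>) * tate_tau (w $ 3)) + fps_const a11 * tate_tau (w $ 3)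
        + fps_const a21 * tate_tau (w $ 4) \<and>
      w $ 4 = tate_tau ((fps_X + fps_const \<theta>) * tate_tau (w $ 4)) + fps_const a12 * tate_tau (w $ 3)"
    unfolding vec_eq_iff[of "tauW w"] forall_4 tauW_nth by metis
  moreover have "fps_nth (tate_tau ((fps_X + fps_const \<theta>) * tate_tau (w $ 3)) + fps_const a11 * tate_tau (w $ 3)
        + fps_const a21 * tate_tau (w $ 4)) i =
      \<theta> ^ 2 * fps_nth (w $ 3) i ^ 4 + a11 * fps_nth (w $ 3) i ^ 2 + a21 * fps_nth (w $ 4) i ^ 2
        + prev (w $ 3) i ^ 4" for i
    unfolding fps_add_nth X by (simp add: frob_def ac_simps)
  moreover have "fps_nth (tate_tau ((fps_X + fps_const \<theta>) * tate_tau (w $ 4)) + fps_const a12 * tate_tau (w $ 3)) i =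
      \<theta> ^ 2 * fps_nth (w $ 4) i ^ 4 + a12 * fps_nth (w $ 3) i ^ 2 + prev (w $ 4) i ^ 4" for i
    unfolding fps_add_nth X by (simp add: frob_def ac_simps)
  ultimately show ?thesis
    unfolding V_def mem_Collect_eq fps_eq_iff[of "w $ 3"] fps_eq_iff[of "w $ 4"] solves_def
    by (simp only:) blast
qed

definition eval :: "'a fps ^ 4 \<Rightarrow> 'a" where
  "eval w = fps_nth (w $ 3) 0"

lemma solves_0_root: "solves 0 0 b c \<Longrightarrow> poly (Q 0) b = 0"
  unfolding solves_iff by (simp add: rhs_def)

lemma eval_root: "w \<in> V \<Longrightarrow> poly (Q 0) (eval w) = 0"
proof -
  assume "w \<in> V"
  then have "solves (prev (w $ 3) 0 ^ 4) (prev (w $ 4) 0 ^ 4) (fps_nth (w $ 3) 0) (fps_nth (w $ 4) 0)"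
    unfolding V_iff by blast
  then show ?thesis by (intro solves_0_root) (simp add: prev_def eval_def)
qed

lemma eval_surj:
  assumes "poly (Q 0) b = 0"
  shows "\<exists>w\<in>V. eval w = b"
proof -
  obtain c where c: "solves 0 0 b c" "bounded 0 b c" using initial assms by blast
  \<comment> \<open>The choice principle leaves the first value free, so the start
    \<open>(b, c)\<close> is carried in the invariant.\<close>
  have "\<exists>f :: nat \<Rightarrow> 'a \<times> 'a. \<forall>n. (bounded n (fst (f n)) (snd (f n)) \<and> (n = 0 \<longrightarrow> f n = (b, c))) \<and>
      solves (fst (f n) ^ 4) (snd (f n) ^ 4) (fst (f (Suc n))) (snd (f (Suc n)))"
  proof (rule dependent_nat_choice)
    show "\<exists>z. bounded 0 (fst z) (snd z) \<and> ((0::nat) = 0 \<longrightarrow> z = (b, c))"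
      using c(2) by (intro exI[of _ "(b, c)"]) simp
    show "\<exists>z'. (bounded (Suc n) (fst z') (snd z') \<and> (Suc n = 0 \<longrightarrow> z' = (b, c))) \<and>
        solves (fst z ^ 4) (snd z ^ 4) (fst z') (snd z')"
      if "bounded n (fst z) (snd z) \<and> (n = 0 \<longrightarrow> z = (b, c))" for z n
      using step[of n "fst z" "snd z"] that by auto
  qed
  then obtain f :: "nat \<Rightarrow> 'a \<times> 'a" where
    f: "\<And>n. bounded n (fst (f n)) (snd (f n))" "f 0 = (b, c)"
      "\<And>n. solves (fst (f n) ^ 4) (snd (f n) ^ 4) (fst (f (Suc n))) (snd (f (Suc n)))" by blast
  define g h where "g = Abs_fps (\<lambda>n. fst (f n))" and "h = Abs_fps (\<lambda>n. snd (f n))"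
  have "\<exists>N. \<forall>i\<ge>N. ge r (fps_nth g i)" for r
  proof -
    obtain N :: nat where N: "4 * r - v \<le> real N" using real_arch_simple by blast
    have "ge r (fps_nth g i)" if "i \<ge> N" for i
    proof -
      have "ge ((10 / 3 + 2 * real i + v) / 4) (fps_nth g i)" using f(1)[of i] by (simp add: bounded_def g_def)
      then show ?thesis by (rule ge_mono) (use N that in \<open>simp add: field_simps\<close>)
    qed
    then show ?thesis by blast
  qed
  then have g: "g \<in> tate_algebra ord" by (simp add: tate_iff)
  have "\<exists>N. \<forall>i\<ge>N. ge r (fps_nth h i)" for r
  proof -
    obtain N :: nat where N: "r \<le> real N" using real_arch_simple by blast
    have "ge r (fps_nth h i)" if "i \<ge> N" for i
    proof -
      have "ge (2 / 3 + real i) (fps_nth h i)" using f(1)[of i] by (simp add: bounded_def h_def)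
      then show ?thesis by (rule ge_mono) (use N that in simp)
    qed
    then show ?thesis by blast
  qed
  then have h: "h \<in> tate_algebra ord" by (simp add: tate_iff)
  define w :: "'a fps ^ 4" where "w = (\<chi> k. if k = 1 then (fps_X + fps_const \<theta>) * tate_tau g
    else if k = 2 then (fps_X + fps_const \<theta>) * tate_tau h else if k = 3 then g else h)"
  have w: "w $ 1 = (fps_X + fps_const \<theta>) * tate_tau g" "w $ 2 = (fps_X + fps_const \<theta>) * tate_tau h"
    "w $ 3 = g" "w $ 4 = h" by (simp_all add: w_def)
  have "w \<in> W"
    using g h by (simp add: W_def forall_4 w distrib_right tate_add tate_X tate_const tate_tau_in)
  moreover have "solves (prev g i ^ 4) (prev h i ^ 4) (fps_nth g i) (fps_nth h i)" for i
    using c(1) f(2) f(3)[of "i - 1"] by (cases i) (simp_all add: prev_def g_def h_def)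
  ultimately have "w \<in> V" unfolding V_iff w by simp
  moreover have "eval w = b" by (simp add: eval_def w g_def f(2))
  ultimately show ?thesis by blast
qed

lemma eval_image: "eval ` V = {b. poly (Q 0) b = 0}"
  using eval_root eval_surj by blast

text \<open>At index 0 the first equation becomes \<open>a21 * c ^ 2 = 0\<close>, so all four
  constant terms vanish with \<open>b\<close>. Since \<open>tauW\<close> commutes with
  \<open>T\<close>, the factor cancels from the invariance.\<close>

lemma V_divide:
  assumes w: "w \<in> V" and e: "eval w = 0"
  shows "\<exists>w'\<in>V. w = fps_X *s w'"
proof -
  have eqs: "w \<in> W" "w $ 1 = (fps_X + fps_const \<theta>) * tate_tau (w $ 3)"
    "w $ 2 = (fps_X + fps_const \<theta>) * tate_tau (w $ 4)"
    "solves (prev (w $ 3) 0 ^ 4) (prev (w $ 4) 0 ^ 4) (fps_nth (w $ 3) 0) (fps_nth (w $ 4) 0)"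
    using w unfolding V_iff by blast+
  have b: "fps_nth (w $ 3) 0 = 0" using e by (simp add: eval_def)
  then have c: "fps_nth (w $ 4) 0 = 0"
    using eqs(4) nonzero by (simp add: prev_def solves_def)
  have z: "fps_nth (w $ k) 0 = 0" for k
  proof -
    have "fps_nth (w $ 1) 0 = 0" "fps_nth (w $ 2) 0 = 0"
      unfolding eqs(2,3) by (simp_all add: b c)
    then show ?thesis using b c exhaust_4[of k] by auto
  qed
  define w' :: "'a fps ^ 4" where "w' = (\<chi> k. fps_shift 1 (w $ k))"
  have ww: "w = fps_X *s w'"
  proof -
    have "fps_nth (w $ k) i = fps_nth (fps_X * fps_shift 1 (w $ k)) i" for k i
      using z[of k] by (cases i) auto
    then show ?thesis by (simp add: vec_eq_iff w'_def fps_eq_iff)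
  qed
  have "w' \<in> W"
    unfolding W_def mem_Collect_eq tate_iff
  proof (intro allI)
    fix k r
    have "w $ k \<in> tate_algebra ord" using eqs(1) by (simp add: W_def)
    then obtain N where N: "\<forall>i\<ge>N. ge r (fps_nth (w $ k) i)" unfolding tate_iff by blast
    then have "\<forall>i\<ge>N. ge r (fps_nth (w' $ k) i)" by (simp add: w'_def)
    then show "\<exists>N. \<forall>i\<ge>N. ge r (fps_nth (w' $ k) i)" by blast
  qed
  moreover have "fps_X *s tauW w' = fps_X *s w'"
    using w ww unfolding V_def by (metis (mono_tags, lifting) mem_Collect_eq tate_tau_X tauW_smult)
  then have "tauW w' = w'" by (simp add: vec_eq_iff)
  ultimately show ?thesis using ww by (auto simp: V_def)
qed

section \<open>The filtration by small coefficients\<close>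

definition small :: "'a \<Rightarrow> bool" where
  "small x \<longleftrightarrow> x = 0 \<or> 1 < val x"

lemma small_0 [simp]: "small 0"
  by (simp add: small_def)

lemma small_add:
  assumes "small x" "small y"
  shows "small (x + y)"
proof (cases "x = 0 \<or> y = 0")
  case False
  then have "ge (min (val x) (val y)) (x + y)" by (intro ge_add) (auto simp: ge_iff)
  then show ?thesis using assms False by (auto simp: small_def ge_iff)
qed (use assms in auto)

definition Fil :: "nat \<Rightarrow> ('a fps ^ 4) set" where
  "Fil n = {w \<in> V. \<forall>i\<ge>n. small (fps_nth (w $ 3) i)}"

text \<open>The constant term of the third coordinate is a root of \<open>Q 0\<close> that is 0 or
  of valuation above 1, hence 0. The quotient by \<open>T\<close> lies in \<open>Fil 0\<close>
  again, so all coefficients vanish in turn.\<close>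

lemma Fil_0: "Fil 0 = {0}"
proof -
  have X: "\<exists>w'\<in>Fil 0. w = fps_X *s w'" if w: "w \<in> Fil 0" for w
  proof -
    have "w \<in> V" "small (eval w)" using w by (auto simp: Fil_def eval_def)
    then have "eval w = 0" using eval_root root_large_eq_0 small_def by blast
    then obtain w' where w': "w' \<in> V" "w = fps_X *s w'" using V_divide \<open>w \<in> V\<close> by blast
    have "small (fps_nth (w' $ 3) i)" for i
    proof -
      have "small (fps_nth (w $ 3) (Suc i))" using w by (simp add: Fil_def)
      then show ?thesis by (simp add: w'(2))
    qed
    then show ?thesis using w' by (auto simp: Fil_def)
  qed
  have "\<forall>w\<in>Fil 0. \<forall>k. fps_nth (w $ k) i = 0" for i
  proof (induction i)
    case 0
    show ?case using X by fastforce
  next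
    case (Suc i)
    show ?case
    proof (intro ballI allI)
      fix w k assume "w \<in> Fil 0"
      then obtain w' where "w' \<in> Fil 0" "w = fps_X *s w'" using X by blast
      then show "fps_nth (w $ k) (Suc i) = 0" using Suc by simp
    qed
  qed
  then have "w = 0" if "w \<in> Fil 0" for w using that by (simp add: vec_eq_iff fps_eq_iff)
  moreover have "0 \<in> Fil 0" by (simp add: Fil_def V_0 small_def)
  ultimately show ?thesis by blast
qed

interpretation lattice: filtered_lattice ord \<theta> V eval Fil
proof unfold_locales
  show "finite (eval ` V)"
    unfolding eval_image by (rule card_ge_0_finite) (simp add: card_roots_Q)
  show "V \<subseteq> (\<Union>n. Fil n)"
  proof
    fix w assume w: "w \<in> V"
    then have "w $ 3 \<in> tate_algebra ord" by (simp add: V_def W_def)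
    \<comment> \<open>Any bound above 1 would do, as \<open>small\<close> is a strict
      condition.\<close>
    then obtain N where N: "\<forall>i\<ge>N. ge 2 (fps_nth (w $ 3) i)" unfolding tate_iff by blast
    then have "w \<in> Fil N" using w by (auto simp: Fil_def small_def ge_iff)
    then show "w \<in> (\<Union>n. Fil n)" by blast
  qed
  show "w \<in> Fil n" if "w \<in> V" "fps_X *s w \<in> Fil (Suc n)" for w n
    unfolding Fil_def
  proof (intro CollectI conjI allI impI)
    fix i assume "n \<le> i"
    then have "small (fps_nth ((fps_X *s w) $ 3) (Suc i))" using that(2) unfolding Fil_def by blast
    then show "small (fps_nth (w $ 3) i)" by simp
  qed (fact that(1))
  show "eval (fps_of_poly p *s w) = coeff p 0 * eval w" for p w
    by (simp add: eval_def)
  show "Fil 0 = {0}" by (rule Fil_0)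
  show "\<exists>w'\<in>V. w = fps_X *s w'" if "w \<in> V" "eval w = 0" for w
    using that by (rule V_divide)
qed (auto simp: V_0 V_add V_smult eval_def Fil_def small_add)

theorem h1_eq: "h1 ord (anderson_motive \<theta> A) = 4"
proof -
  obtain \<Phi> where "bij_betw \<Phi> (carrier H) V" "\<zero>\<^bsub>H\<^esub> \<in> carrier H \<and> \<Phi> \<zero>\<^bsub>H\<^esub> = 0"
    "\<And>x y. x \<in> carrier H \<Longrightarrow> y \<in> carrier H \<Longrightarrow> x \<oplus>\<^bsub>H\<^esub> y \<in> carrier H \<and> \<Phi> (x \<oplus>\<^bsub>H\<^esub> y) = \<Phi> x + \<Phi> y"
    "\<And>p x. p \<in> poly_over Fq \<Longrightarrow> x \<in> carrier H \<Longrightarrow>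
      p \<odot>\<^bsub>H\<^esub> x \<in> carrier H \<and> \<Phi> (p \<odot>\<^bsub>H\<^esub> x) = fps_of_poly p *s \<Phi> x"
    using H1_coordinates by blast
  moreover have "card (eval ` V) = 2 ^ 4" by (simp add: eval_image card_roots_Q)
  ultimately show ?thesis unfolding h1_def by (rule lattice.module_rank_eq)
qed

end

theorem proposition7p4:
  fixes ord :: "'a::field \<Rightarrow> ereal" and \<theta> a11 a12 a21 :: 'a and u v :: real
  assumes "C_infinity ord \<theta>"
    and "ord a11 = -1"
    and "a12 \<noteq> 0" and "a21 \<noteq> 0"
    and "ord a12 = ereal u" and "ord a21 = ereal v"
    and "(u, v) \<in> D12"
    and "v \<le> - (4 / 3)"
  shows "h1 ord (anderson_motive \<theta> (vector [vector [a11, a12], vector [a21, 0]])) = 4"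
proof -
  interpret C_infinity ord \<theta> by fact
  interpret motive_D12 ord \<theta> a11 a12 a21 u v
    by unfold_locales (use assms in \<open>auto simp: D12_def\<close>)
  show ?thesis using h1_eq unfolding A_def .
qed

end
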